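(* Let $r,d\ge 1$, let $G_1,\dots,G_r\subseteq\mathbb{C}$ and $\Omega_1,\dots,\Omega_d\subseteq\mathbb{C}$ be simply connected domains, and set $G=\prod_{i=1}^r G_i$, $\Omega=\prod_{i=1}^d\Omega_i$. Let $(N_k)_{k\ge 0}$ be an enumeration of $\mathbb{N}^d$ and let $\mu$ be an infinite subset of $\mathbb{N}$. Then the set $U^\mu_H(G,\Omega)$ is a $G_\delta$ and dense subset of $H(G\times\Omega)$, and it contains a vector space except $0$ that is dense in $H(G\times\Omega)$; that is, there is a linear subspace $E$ of $H(G\times\Omega)$, dense in $H(G\times\Omega)$, with $E\setminus\{0\}\subseteq U^\mu_H(G,\Omega)$.
   Context: $\mathbb{N}=\{0,1,2,\dots\}$. $H(G\times\Omega)$ is the space of holomorphic functions on $G\times\Omega$ with the topology of uniform convergence on compact subsets. Points of $G\times\Omega$ are written $(w,z)$. Suprema of nonnegative quantities over the empty set are $0$. Partial sums: for $f\in H(G\times\Omega)$, $w\in G$, $\zeta\in\Omega$ and $m=(m_1,\dots,m_d)\in\mathbb{N}^d$, let $\gamma_m(f,w,\zeta)=\frac{1}{m_1!\cdots m_d!}\frac{\partial^{m_1+\dots+m_d}}{\partial u_1^{m_1}\cdots\partial u_d^{m_d}}f(w,u)\big|_{u=\zeta}$, and for $n\ge0$ let $S_n(f,w,\zeta)(z)=\sum_{k=0}^n\gamma_{N_k}(f,w,\zeta)(z-\zeta)^{N_k}$ for $z\in\mathbb{C}^d$, where $z^m=z_1^{m_1}\cdots z_d^{m_d}$. A differential operator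 of mixed partial derivatives in $(w,z)$ is an operator $D=\frac{\partial^{m_1+\dots+m_{r+d}}}{\partial w_1^{m_1}\cdots\partial w_r^{m_r}\partial z_1^{m_{r+1}}\cdots\partial z_d^{m_{r+d}}}$ with $(m_1,\dots,m_{r+d})\in\mathbb{N}^{r+d}$ (the identity included); applied to $S_n(f,w,\zeta)(z)$ it differentiates in $(w,z)$ with $\zeta$ fixed. The class $U^\mu_H(G,\Omega)$ is the set of $f\in H(G\times\Omega)$ such that: for every $K=\prod_{i=1}^dK_i$ with each $K_i\subseteq\mathbb{C}$ compact and $\mathbb{C}\setminus K_i$ connected, and with $\Omega_{i_0}\cap K_{i_0}=\emptyset$ for at least one $i_0\in\{1,\dots,d\}$, and for every holomorphic function $h:G\times V\to\mathbb{C}$, where $V\subseteq\mathbb{C}^d$ is an open set containing $K$, there exists a strictly increasing sequence $(\lambda_n)_{n\ge1}$ in $\mu$ such that, as $n\to\infty$, $\sup_{\zeta\in M}\sup_{w\in L}\sup_{z\in K}|D(S_{\lambda_n}(f,w,\zeta)(z)-h(w,z))|\to0$ and $\sup_{\zeta\in M}\sup_{w\in L}\sup_{z\in M}|S_{\lambda_n}(f,w,\zeta)(z)-f(w,z)|\to0$ for every compact $L\subseteq G$, every compact $M\subseteq\Omega$ and every differential operator $D$ of mixed partial derivatives in $(w,z)$. *)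

theory Defs
  imports "HOL-Analysis.Analysis" "HOL-Library.Function_Algebras"
begin

definition vprod :: "('n \<Rightarrow> 'a set) \<Rightarrow> ('a ^ 'n) set"
  where "vprod A = {x. \<forall>i. x $ i \<in> A i}"

definition simply_connected_domain :: "complex set \<Rightarrow> bool"
  where "simply_connected_domain S \<longleftrightarrow> open S \<and> S \<noteq> {} \<and> connected S \<and> simply_connected S"

text \<open>Holomorphy in the variables \<open>(w, z)\<close>: at every point there is a Frechet derivative that
  is complex-linear. It is only used for open \<open>S\<close>.\<close>

definition mholomorphic_on ::
    "((complex ^ 'r::finite) \<times> (complex ^ 'd::finite) \<Rightarrow> complex) \<Rightarrow> ((complex ^ 'r) \<times> (complex ^ 'd)) set \<Rightarrow> bool"
    (infix "mholomorphic'_on" 50)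
  where "f mholomorphic_on S \<longleftrightarrow>
    (\<forall>p\<in>S. \<exists>f'. (f has_derivative f') (at p) \<and> (\<forall>c v w. f' (c *s v, c *s w) = c * f' (v, w)))"

text \<open>The space \<open>H(S)\<close>. A function on \<open>S\<close> is represented by its extension by \<open>0\<close> to the whole
  type, so that equality in \<open>H(S)\<close> is equality of functions and the vector space operations are
  the pointwise ones.\<close>

definition hol_space ::
    "((complex ^ 'r::finite) \<times> (complex ^ 'd::finite)) set \<Rightarrow> ((complex ^ 'r) \<times> (complex ^ 'd) \<Rightarrow> complex) set"
  where "hol_space S = {f. f mholomorphic_on S \<and> (\<forall>p. p \<notin> S \<longrightarrow> f p = 0)}"

definition open_in_hol_space ::
    "((complex ^ 'r::finite) \<times> (complex ^ 'd::finite)) set \<Rightarrow> ((complex ^ 'r) \<times> (complex ^ 'd) \<Rightarrow> complex) set \<Rightarrow> bool"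
  where "open_in_hol_space S U \<longleftrightarrow> U \<subseteq> hol_space S \<and>
    (\<forall>f\<in>U. \<exists>C \<epsilon>. compact C \<and> C \<subseteq> S \<and> \<epsilon> > 0 \<and>
       (\<forall>g\<in>hol_space S. (\<forall>p\<in>C. cmod (g p - f p) < \<epsilon>) \<longrightarrow> g \<in> U))"

text \<open>The topology of uniform convergence on compact subsets of \<open>S\<close>.\<close>

definition hol_topology ::
    "((complex ^ 'r::finite) \<times> (complex ^ 'd::finite)) set \<Rightarrow> ((complex ^ 'r) \<times> (complex ^ 'd) \<Rightarrow> complex) topology"
  where "hol_topology S = topology (open_in_hol_space S)"

lemma istopology_open_in_hol_space: "istopology (open_in_hol_space S)"
proof -
  have "open_in_hol_space S (U \<inter> V)" if U: "open_in_hol_space S U" and V: "open_in_hol_space S V" for U V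
    unfolding open_in_hol_space_def
  proof (intro conjI ballI)
    show "U \<inter> V \<subseteq> hol_space S"
      using U by (auto simp: open_in_hol_space_def)
  next
    fix f assume "f \<in> U \<inter> V"
    then have "f \<in> U" "f \<in> V" by auto
    obtain C \<epsilon> where C: "compact C" "C \<subseteq> S" "\<epsilon> > 0"
        "\<forall>g\<in>hol_space S. (\<forall>p\<in>C. cmod (g p - f p) < \<epsilon>) \<longrightarrow> g \<in> U"
      using bspec[OF conjunct2[OF U[unfolded open_in_hol_space_def]] \<open>f \<in> U\<close>] by (elim exE conjE) rule
    obtain C' \<epsilon>' where C': "compact C'" "C' \<subseteq> S" "\<epsilon>' > 0"
        "\<forall>g\<in>hol_space S. (\<forall>p\<in>C'. cmod (g p - f p) < \<epsilon>') \<longrightarrow> g \<in> V"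
      using bspec[OF conjunct2[OF V[unfolded open_in_hol_space_def]] \<open>f \<in> V\<close>] by (elim exE conjE) rule
    show "\<exists>C \<epsilon>. compact C \<and> C \<subseteq> S \<and> \<epsilon> > 0 \<and>
       (\<forall>g\<in>hol_space S. (\<forall>p\<in>C. cmod (g p - f p) < \<epsilon>) \<longrightarrow> g \<in> U \<inter> V)"
    proof (intro exI conjI ballI impI)
      show "compact (C \<union> C')" "C \<union> C' \<subseteq> S" "min \<epsilon> \<epsilon>' > 0"
        using C(1-3) C'(1-3) by auto
    next
      fix g assume g: "g \<in> hol_space S" "\<forall>p\<in>C \<union> C'. cmod (g p - f p) < min \<epsilon> \<epsilon>'"
      have "g \<in> U"
        by (rule C(4)[rule_format, OF g(1)]) (use g(2) in simp)
      moreover have "g \<in> V"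
        by (rule C'(4)[rule_format, OF g(1)]) (use g(2) in simp)
      ultimately show "g \<in> U \<inter> V" by simp
    qed
  qed
  moreover have "open_in_hol_space S (\<Union>\<K>)" if \<K>: "\<forall>U\<in>\<K>. open_in_hol_space S U" for \<K>
    unfolding open_in_hol_space_def
  proof (intro conjI ballI)
    show "\<Union>\<K> \<subseteq> hol_space S"
      using \<K> by (auto simp: open_in_hol_space_def)
  next
    fix f assume "f \<in> \<Union>\<K>"
    then obtain U where U: "U \<in> \<K>" "f \<in> U" by blast
    then obtain C \<epsilon> where C: "compact C" "C \<subseteq> S" "\<epsilon> > 0"
        "\<forall>g\<in>hol_space S. (\<forall>p\<in>C. cmod (g p - f p) < \<epsilon>) \<longrightarrow> g \<in> U"
      using bspec[OF conjunct2[OF bspec[OF \<K> U(1), unfolded open_in_hol_space_def]] U(2)] by (elim exE conjE) rule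
    show "\<exists>C \<epsilon>. compact C \<and> C \<subseteq> S \<and> \<epsilon> > 0 \<and>
       (\<forall>g\<in>hol_space S. (\<forall>p\<in>C. cmod (g p - f p) < \<epsilon>) \<longrightarrow> g \<in> \<Union>\<K>)"
    proof (intro exI conjI ballI impI)
      fix g assume g: "g \<in> hol_space S" "\<forall>p\<in>C. cmod (g p - f p) < \<epsilon>"
      show "g \<in> \<Union>\<K>"
        using C(4)[rule_format, OF g(1)] g(2) U(1) by (intro UnionI[of U]) simp_all
    qed (rule C)+
  qed
  ultimately show ?thesis
    unfolding istopology_def by (intro conjI allI impI)
qed

lemma openin_hol_topology: "openin (hol_topology S) U \<longleftrightarrow> open_in_hol_space S U"
  unfolding hol_topology_def topology_inverse'[OF istopology_open_in_hol_space] ..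

lemma topspace_hol_topology: "topspace (hol_topology S) = hol_space S"
proof
  show "topspace (hol_topology S) \<subseteq> hol_space S"
    using openin_topspace[of "hol_topology S"]
    unfolding openin_hol_topology open_in_hol_space_def by (rule conjunct1)
next
  have "\<exists>C \<epsilon>. compact C \<and> C \<subseteq> S \<and> \<epsilon> > 0 \<and>
       (\<forall>g\<in>hol_space S. (\<forall>p\<in>C. cmod (g p - f p) < \<epsilon>) \<longrightarrow> g \<in> hol_space S)" for f
    by (rule exI[of _ "{}"], rule exI[of _ 1]) simp
  then have "openin (hol_topology S) (hol_space S)"
    unfolding openin_hol_topology open_in_hol_space_def by simp
  then show "hol_space S \<subseteq> topspace (hol_topology S)"
    by (rule openin_subset)
qed

interpretation fun_cspace: vector_space "\<lambda>(c::complex) (f::'a \<Rightarrow> complex) x. c * f x"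
  by unfold_locales (auto simp: fun_eq_iff algebra_simps)

definition partial_deriv :: "'n::finite \<Rightarrow> (complex ^ 'n \<Rightarrow> complex) \<Rightarrow> complex ^ 'n \<Rightarrow> complex"
  where "partial_deriv i f x = deriv (\<lambda>t. f (\<chi> j. if j = i then t else x $ j)) (x $ i)"

text \<open>The index type carries no order, so the coordinates are listed in some fixed order. On
  holomorphic functions partial derivatives commute and \<open>mixed_partial\<close> does not depend on it.\<close>

definition coord_list :: "'n::finite list"
  where "coord_list = (SOME is. distinct is \<and> set is = UNIV)"

definition mixed_partial :: "nat ^ 'n::finite \<Rightarrow> (complex ^ 'n \<Rightarrow> complex) \<Rightarrow> complex ^ 'n \<Rightarrow> complex"
  where "mixed_partial m f = foldr (\<lambda>i g. (partial_deriv i ^^ (m $ i)) g) coord_list f"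

definition taylor_coeff ::
    "nat ^ 'd::finite \<Rightarrow> ((complex ^ 'r::finite) \<times> (complex ^ 'd) \<Rightarrow> complex) \<Rightarrow> complex ^ 'r \<Rightarrow> complex ^ 'd \<Rightarrow> complex"
  where "taylor_coeff m f w \<zeta> = 1 / (\<Prod>i\<in>UNIV. fact (m $ i)) * mixed_partial m (\<lambda>u. f (w, u)) \<zeta>"

definition vpower :: "complex ^ 'd::finite \<Rightarrow> nat ^ 'd \<Rightarrow> complex"
  where "vpower z m = (\<Prod>i\<in>UNIV. (z $ i) ^ (m $ i))"

definition partial_sum ::
    "(nat \<Rightarrow> nat ^ 'd::finite) \<Rightarrow> nat \<Rightarrow> ((complex ^ 'r::finite) \<times> (complex ^ 'd) \<Rightarrow> complex) \<Rightarrow>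
     complex ^ 'r \<Rightarrow> complex ^ 'd \<Rightarrow> complex ^ 'd \<Rightarrow> complex"
  where "partial_sum N n f w \<zeta> z = (\<Sum>k\<le>n. taylor_coeff (N k) f w \<zeta> * vpower (z - \<zeta>) (N k))"

text \<open>The operator of order \<open>a\<close> in \<open>w\<close> and \<open>b\<close> in \<open>z\<close>.\<close>

definition mixed_diff_op ::
    "nat ^ 'r::finite \<Rightarrow> nat ^ 'd::finite \<Rightarrow> ((complex ^ 'r) \<times> (complex ^ 'd) \<Rightarrow> complex) \<Rightarrow>
     (complex ^ 'r) \<times> (complex ^ 'd) \<Rightarrow> complex"
  where "mixed_diff_op a b F = (\<lambda>(w, z). mixed_partial a (\<lambda>w'. mixed_partial b (\<lambda>z'. F (w', z')) z) w)"

text \<open>The suprema are taken in \<^typ>\<open>ennreal\<close>, where the supremum of the empty set is \<open>0\<close>.\<close>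

definition universal_class ::
    "(nat \<Rightarrow> nat ^ 'd::finite) \<Rightarrow> nat set \<Rightarrow> (complex ^ 'r::finite) set \<Rightarrow> ('d \<Rightarrow> complex set) \<Rightarrow>
     ((complex ^ 'r) \<times> (complex ^ 'd) \<Rightarrow> complex) set"
  where "universal_class N \<mu> G \<Omega> = {f \<in> hol_space (G \<times> vprod \<Omega>).
    \<forall>K V h.
      (\<forall>i. compact (K i) \<and> connected (- K i)) \<and> (\<exists>i\<^sub>0. \<Omega> i\<^sub>0 \<inter> K i\<^sub>0 = {}) \<and>
      open V \<and> vprod K \<subseteq> V \<and> h mholomorphic_on (G \<times> V) \<longrightarrow>
      (\<exists>l::nat \<Rightarrow> nat. strict_mono l \<and> range l \<subseteq> \<mu> \<and>
        (\<forall>L M a b. compact L \<and> L \<subseteq> G \<and> compact M \<and> M \<subseteq> vprod \<Omega> \<longrightarrow>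
          ((\<lambda>n. SUP \<zeta>\<in>M. SUP w\<in>L. SUP z\<in>vprod K.
              ennreal (cmod (mixed_diff_op a b
                (\<lambda>(w, z). partial_sum N (l n) f w \<zeta> z - h (w, z)) (w, z)))) \<longlonglongrightarrow> 0) \<and>
          ((\<lambda>n. SUP \<zeta>\<in>M. SUP w\<in>L. SUP z\<in>M.
              ennreal (cmod (partial_sum N (l n) f w \<zeta> z - f (w, z)))) \<longlonglongrightarrow> 0)))}"

end

theory Submission
  imports Defs "HOL-Complex_Analysis.Complex_Analysis"
begin

text \<open>A countable family of compact sets \<open>K\<close> and of rational polynomials \<open>p\<close> suffices to test
  universality: if \<open>K\<close> is compact with connected complement and misses a connected open set \<open>S\<close>,
  it lies in a large disc minus \<open>S\<close> and minus a finite union of rational balls joining \<open>S\<close> to the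
  exterior of the disc. Each test is an open condition by Cauchy's estimates, so the universal class is
  a \<open>G\<^sub>\<delta>\<close> set.

  Density rests on one approximation step. A polynomial \<open>g\<close> equals its partial sums of large order,
  so it is enough to change \<open>g\<close> into a polynomial close to \<open>g\<close> on a compact set of the domain and close
  to a given polynomial \<open>p\<close> over \<open>K\<close>. This is done by adding \<open>(p - g) q(z\<^sub>i)\<close>, where \<open>q\<close> is a polynomial
  in the coordinate that separates \<open>K\<close> from the domain, close to \<open>1\<close> on one side and to \<open>0\<close> on the
  other; it comes from Runge's theorem. Repeating this step in the space of sequences
  \<open>(f\<^sub>j)\<close> produces a dense sequence for which, along common orders, the partial sums of one chosen \<open>f\<^sub>j\<close>
  approach \<open>p\<close> over \<open>K\<close> while those of the other \<open>f\<^sub>j\<close> tend to \<open>0\<close> there. Hence every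
  combination of the \<open>f\<^sub>j\<close> with a nonzero coefficient is universal.\<close>

text \<open>The supremum over centres \<open>\<zeta>\<close> does no harm: a polynomial is
  reproduced exactly by all its late partial sums, with a threshold independent of \<open>w\<close>,
  \<open>\<zeta>\<close> and \<open>z\<close>. Polynomials can therefore be edited as mere
  functions, and Taylor coefficients matter only through the continuity of the n-th partial sum in
  \<open>f\<close> for one fixed \<open>n\<close>.

  The vector space is what forces sequences of functions. If every member were universal by itself,
  its good orders would be unrelated to those of the others, and in a linear combination the other
  members could do anything over \<open>K\<close>. One order has to serve finitely many members at
  once, with target zero for all but one; that one is aimed at the target divided by its
  coefficient.

  The analytic obstacle is Runge's theorem in several variables, for \<open>h\<close> holomorphic
  near a product. Treating one variable at a time works only if the points at which the function is
  sampled do not depend on the remaining variables. Derivatives are never approximated on their own: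
  functions are approximated on slightly larger sets and Cauchy's inequality, applied along words of
  partial derivatives in a fixed order, does the rest.\<close>

no_notation fps_nth (infixl "$" 75)

section \<open>Runge's theorem in one variable\<close>

definition poly_approximable :: "complex set \<Rightarrow> (complex \<Rightarrow> complex) \<Rightarrow> bool"
  where "poly_approximable K f \<longleftrightarrow> (\<forall>e>0. \<exists>p. \<forall>z\<in>K. cmod (f z - poly p z) \<le> e)"

lemma poly_approximable_poly: "poly_approximable K (poly p)"
  unfolding poly_approximable_def by (metis diff_self less_imp_le norm_zero)

lemma poly_approximable_polyI: "(\<And>z. z \<in> K \<Longrightarrow> f z = poly p z) \<Longrightarrow> poly_approximable K f"
  unfolding poly_approximable_def by (intro allI impI exI[of _ p]) simp

lemma poly_approximable_limit:
  assumes "\<And>e. e > 0 \<Longrightarrow> \<exists>g. poly_approximable K g \<and> (\<forall>z\<in>K. cmod (f z - g z) \<le> e)"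
  shows "poly_approximable K f"
  unfolding poly_approximable_def
proof (intro allI impI)
  fix e :: real assume "e > 0"
  then obtain g where g: "poly_approximable K g" "\<forall>z\<in>K. cmod (f z - g z) \<le> e/2"
    using assms[of "e/2"] by auto
  then obtain p where "\<forall>z\<in>K. cmod (g z - poly p z) \<le> e/2"
    using \<open>e > 0\<close> unfolding poly_approximable_def by (meson half_gt_zero)
  with g(2) have "\<forall>z\<in>K. cmod (f z - poly p z) \<le> e"
    by (metis norm_diff_triangle_le field_sum_of_halves)
  then show "\<exists>p. \<forall>z\<in>K. cmod (f z - poly p z) \<le> e" ..
qed

lemma poly_approximable_add:
  assumes "poly_approximable K f" "poly_approximable K g"
  shows "poly_approximable K (\<lambda>z. f z + g z)"
  unfolding poly_approximable_def
proof (intro allI impI)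
  fix e :: real assume "e > 0"
  then obtain p q where p: "\<forall>z\<in>K. cmod (f z - poly p z) \<le> e/2" and q: "\<forall>z\<in>K. cmod (g z - poly q z) \<le> e/2"
    using assms unfolding poly_approximable_def by (meson half_gt_zero)
  have "cmod (f z + g z - poly (p + q) z) \<le> e" if "z \<in> K" for z
    using norm_triangle_mono[OF bspec[OF p that] bspec[OF q that]] by (simp add: algebra_simps)
  then show "\<exists>p. \<forall>z\<in>K. cmod (f z + g z - poly p z) \<le> e" by blast
qed

lemma poly_approximable_bounded:
  assumes "poly_approximable K f" "compact K"
  obtains B where "B > 0" "\<And>z. z \<in> K \<Longrightarrow> cmod (f z) \<le> B"
proof -
  obtain p where p: "\<forall>z\<in>K. cmod (f z - poly p z) \<le> 1"
    using assms(1) unfolding poly_approximable_def by (meson zero_less_one)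
  have "bounded (poly p ` K)"
    by (intro compact_imp_bounded compact_continuous_image assms continuous_intros)
  then obtain C where C: "\<forall>z\<in>K. cmod (poly p z) \<le> C"
    by (auto simp: bounded_iff)
  show ?thesis
  proof (rule that[of "\<bar>C\<bar> + 1"])
    fix z assume "z \<in> K"
    have "cmod (f z) \<le> cmod (f z - poly p z) + cmod (poly p z)"
      by (metis diff_add_cancel norm_triangle_ineq)
    then show "cmod (f z) \<le> \<bar>C\<bar> + 1"
      using p C \<open>z \<in> K\<close> by force
  qed simp
qed

lemma poly_approximable_mult:
  assumes "poly_approximable K f" "poly_approximable K g" "compact K"
  shows "poly_approximable K (\<lambda>z. f z * g z)"
proof -
  obtain B where B: "B > 0" "\<And>z. z \<in> K \<Longrightarrow> cmod (f z) \<le> B"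
    using poly_approximable_bounded[OF assms(1,3)] by blast
  show ?thesis
    unfolding poly_approximable_def
  proof (intro allI impI)
    fix e :: real assume "e > 0"
    then obtain q where q: "\<forall>z\<in>K. cmod (g z - poly q z) \<le> e / (2 * B)"
      using assms(2) B(1) unfolding poly_approximable_def by (meson divide_pos_pos mult_pos_pos zero_less_numeral)
    have "bounded (poly q ` K)"
      by (intro compact_imp_bounded compact_continuous_image assms continuous_intros)
    then obtain C where C: "C > 0" "\<forall>z\<in>K. cmod (poly q z) \<le> C"
      unfolding bounded_pos by auto
    obtain p where p: "\<forall>z\<in>K. cmod (f z - poly p z) \<le> e / (2 * C)"
      using assms(1) C(1) \<open>e > 0\<close> unfolding poly_approximable_def by (meson divide_pos_pos mult_pos_pos zero_less_numeral)
    have "cmod (f z * g z - poly (p * q) z) \<le> e" if z: "z \<in> K" for z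
    proof -
      have "f z * g z - poly (p * q) z = f z * (g z - poly q z) + (f z - poly p z) * poly q z"
        by (simp add: algebra_simps)
      also have "cmod \<dots> \<le> B * (e / (2*B)) + e / (2*C) * C"
      proof (intro order.trans[OF norm_triangle_ineq] add_mono)
        show "cmod (f z * (g z - poly q z)) \<le> B * (e / (2*B))"
          unfolding norm_mult using B(2)[OF z] bspec[OF q z] B(1) by (intro mult_mono) simp_all
        show "cmod ((f z - poly p z) * poly q z) \<le> e / (2*C) * C"
          unfolding norm_mult using bspec[OF C(2) z] bspec[OF p z] \<open>e > 0\<close> C(1) by (intro mult_mono) simp_all
      qed
      also have "\<dots> = e" using B(1) C(1) by (simp add: field_simps)
      finally show ?thesis .
    qed
    then show "\<exists>p. \<forall>z\<in>K. cmod (f z * g z - poly p z) \<le> e" by blast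
  qed
qed

text \<open>The geometric series with ratio at most 1/2 converges uniformly, and its partial sums
  are approximable because approximable functions on a compact set form an algebra. This is the
  engine that moves poles.\<close>

lemma poly_approximable_geometric:
  assumes "poly_approximable K u" "compact K" "\<And>z. z \<in> K \<Longrightarrow> cmod (u z) \<le> 1/2"
  shows "poly_approximable K (\<lambda>z. 1 / (1 - u z))"
proof (rule poly_approximable_limit)
  fix e :: real assume "e > 0"
  have pow: "poly_approximable K (\<lambda>z. u z ^ n)" for n
  proof (induction n)
    case 0 show ?case by (rule poly_approximable_polyI[of _ _ 1]) simp
  next
    case (Suc n) then show ?case using poly_approximable_mult[OF assms(1) Suc assms(2)] by (simp only: power_Suc)
  qed
  have sums: "poly_approximable K (\<lambda>z. \<Sum>n<m. u z ^ n)" for m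
  proof (induction m)
    case 0 show ?case by (rule poly_approximable_polyI[of _ _ 0]) simp
  next
    case (Suc m) then show ?case using poly_approximable_add[OF Suc pow[of m]] by (simp only: sum.lessThan_Suc)
  qed
  \<comment> \<open>Half of \<open>e\<close>, because the tail carries the factor
    \<open>1 / (1 - u z)\<close>, of modulus at most 2.\<close>
  obtain m where m: "(1/2::real) ^ m < e / 2"
    using real_arch_pow_inv[of "e/2" "1/2"] \<open>e > 0\<close> by auto
  have "cmod (1 / (1 - u z) - (\<Sum>n<m. u z ^ n)) \<le> e" if z: "z \<in> K" for z
  proof -
    have ne: "u z \<noteq> 1" using assms(3)[OF z] by auto
    have "cmod 1 - cmod (u z) \<le> cmod (1 - u z)" by (rule norm_triangle_ineq2)
    then have half: "cmod (1 - u z) \<ge> 1/2" using assms(3)[OF z] by simp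
    have "1 / (1 - u z) - (\<Sum>n<m. u z ^ n) = u z ^ m / (1 - u z)"
    proof -
      have "(\<Sum>n<m. u z ^ n) = (1 - u z ^ m) / (1 - u z)"
        using ne by (simp only: sum_gp_strict) simp
      then show ?thesis by (simp only: diff_divide_distrib) simp
    qed
    also have "cmod \<dots> \<le> (1/2)^m / (1/2)"
      unfolding norm_divide norm_power using half assms(3)[OF z]
      by (intro frac_le power_mono) auto
    also have "\<dots> \<le> e" using m by simp
    finally show ?thesis .
  qed
  then show "\<exists>g. poly_approximable K g \<and> (\<forall>z\<in>K. cmod (1 / (1 - u z) - g z) \<le> e)"
    using sums by blast
qed

text \<open>Since \<open>b - z = (a - z) * (1 - (a - b) / (a - z))\<close>, the kernel with pole
  \<open>b\<close> is a geometric series in the kernel with pole \<open>a\<close>; the last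
  hypothesis says that its ratio is at most 1/2 on \<open>K\<close>.\<close>

lemma poly_approximable_move_pole:
  assumes "poly_approximable K (\<lambda>z. 1 / (a - z))" "compact K" "a \<notin> K" "b \<notin> K"
    "\<And>z. z \<in> K \<Longrightarrow> 2 * cmod (a - b) \<le> cmod (a - z)"
  shows "poly_approximable K (\<lambda>z. 1 / (b - z))"
proof -
  have c: "poly_approximable K (\<lambda>z. (a - b) * (1 / (a - z)))"
    using poly_approximable_mult[OF poly_approximable_poly[of K "[:a - b:]"] assms(1,2)] by simp
  have bd: "cmod ((a - b) * (1 / (a - z))) \<le> 1/2" if "z \<in> K" for z
    using assms(5)[OF that] assms(3) that by (auto simp: norm_divide norm_mult divide_simps)
  have ap: "poly_approximable K (\<lambda>z. 1 / (a - z) * (1 / (1 - (a - b) * (1 / (a - z)))))"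
    by (rule poly_approximable_mult[OF assms(1) poly_approximable_geometric[OF c assms(2) bd] assms(2)])
  have eq: "1 / (a - z) * (1 / (1 - (a - b) * (1 / (a - z)))) = 1 / (b - z)" if "z \<in> K" for z
  proof -
    have "a - z \<noteq> 0" "b - z \<noteq> 0" using that assms(3,4) by auto
    then show ?thesis by (simp add: divide_simps)
  qed
  show ?thesis using ap eq unfolding poly_approximable_def by (metis (no_types, lifting))
qed

text \<open>Runge's pole pushing: the property holds for a pole far away, where the kernel is a
  power series, and it passes between neighbouring poles, so it spreads over the connected
  complement.\<close>

lemma poly_approximable_Cauchy_kernel:
  assumes "compact K" "connected (- K)" "a \<notin> K"
  shows "poly_approximable K (\<lambda>z. 1 / (a - z))"
proof -
  obtain R where R: "R > 0" "\<And>z. z \<in> K \<Longrightarrow> cmod z \<le> R"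
    using compact_imp_bounded[OF assms(1)] by (meson bounded_pos)
  \<comment> \<open>Twice the bound of \<open>K\<close> makes \<open>z / a0\<close> at most 1/2 in
    modulus on \<open>K\<close>.\<close>
  define a0 :: complex where "a0 = of_real (2 * R)"
  have na0: "cmod a0 = 2 * R" using R by (simp add: a0_def)
  have a0: "a0 \<notin> K" using R na0 by force
  have nz: "a0 \<noteq> 0" using na0 R by auto
  have lin: "poly_approximable K (\<lambda>z. inverse a0 * z)"
    by (rule poly_approximable_polyI[of _ _ "[:0, inverse a0:]"]) simp
  have small: "cmod (inverse a0 * z) \<le> 1/2" if "z \<in> K" for z
  proof -
    have "cmod (inverse a0 * z) = inverse (2 * R) * cmod z"
      by (simp only: norm_mult norm_inverse na0)
    also have "\<dots> \<le> inverse (2 * R) * R"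
      using R(2)[OF that] R(1) by (intro mult_left_mono) simp_all
    also have "\<dots> = 1/2" using R(1) by simp
    finally show ?thesis .
  qed
  have geo: "poly_approximable K (\<lambda>z. 1 / (1 - inverse a0 * z))"
    by (rule poly_approximable_geometric[OF lin assms(1) small])
  have const: "poly_approximable K (\<lambda>z. inverse a0)"
    by (rule poly_approximable_polyI[of _ _ "[:inverse a0:]"]) simp
  have "poly_approximable K (\<lambda>z. inverse a0 * (1 / (1 - inverse a0 * z)))"
    by (rule poly_approximable_mult[OF const geo assms(1)])
  moreover have "(\<lambda>z. inverse a0 * (1 / (1 - inverse a0 * z))) = (\<lambda>z. 1 / (a0 - z))"
  proof
    fix z
    have "inverse a0 * (1 / (1 - inverse a0 * z)) = 1 / (a0 * (1 - inverse a0 * z))"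
      using nz by (simp add: divide_inverse)
    also have "a0 * (1 - inverse a0 * z) = a0 - z" using nz by (simp add: right_diff_distrib)
    finally show "inverse a0 * (1 / (1 - inverse a0 * z)) = 1 / (a0 - z)" .
  qed
  ultimately have base: "poly_approximable K (\<lambda>z. 1 / (a0 - z))"
    by simp
  show ?thesis
  proof (rule connected_induction_simple[OF assms(2), of a0 a "\<lambda>a. poly_approximable K (\<lambda>z. 1 / (a - z))"])
    fix c assume "c \<in> - K"
    then obtain d where d: "d > 0" "ball c d \<subseteq> - K"
      by (rule openE[OF open_Compl[OF compact_imp_closed[OF assms(1)]]])
    show "\<exists>T. openin (top_of_set (- K)) T \<and> c \<in> T \<and> (\<forall>x\<in>T. \<forall>y\<in>T. poly_approximable K (\<lambda>z. 1 / (x - z)) \<longrightarrow>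
            poly_approximable K (\<lambda>z. 1 / (y - z)))"
    proof (intro exI conjI ballI impI)
      \<comment> \<open>With radius \<open>d/6\<close>, two poles are at distance below
        \<open>d/3\<close>, while each is at least \<open>5d/6\<close> away from \<open>K\<close>;
        this leaves the factor 2 needed to move from one to the other.\<close>
      show "openin (top_of_set (- K)) (ball c (d/6))"
        using d subset_ball[of "d/6" d c] by (intro open_subset) auto
      show "c \<in> ball c (d/6)" using d by simp
    next
      fix x y assume xy: "x \<in> ball c (d/6)" "y \<in> ball c (d/6)" "poly_approximable K (\<lambda>z. 1 / (x - z))"
      have K: "x \<notin> K" "y \<notin> K"
        using xy d subset_ball[of "d/6" d c] by auto
      show "poly_approximable K (\<lambda>z. 1 / (y - z))"
      proof (rule poly_approximable_move_pole[where a = x, OF xy(3) assms(1) K])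
        fix z assume "z \<in> K"
        then have "dist c z \<ge> d" using d(2) by (meson ComplD mem_ball not_less subsetD)
        moreover have "dist c x < d/6" "dist c y < d/6" using xy by auto
        moreover have "dist c z \<le> dist c x + dist x z" by (rule dist_triangle)
        moreover have "dist x y \<le> dist c x + dist c y" by (rule dist_triangle3)
        ultimately have "2 * dist x y \<le> dist x z" using d(1)
          by linarith
        then show "2 * cmod (x - y) \<le> cmod (x - z)"
          by (simp only: dist_norm)
      qed
    qed
  next
    show "a0 \<in> - K" "a \<in> - K" using a0 assms(3) by simp_all
  qed (rule base)
qed

section \<open>Quadrature rules with polynomial weights\<close>

definition quad_sum :: "(complex \<times> complex poly) list \<Rightarrow> (complex \<Rightarrow> complex) \<Rightarrow> complex \<Rightarrow> complex"
  where "quad_sum xs f z = (\<Sum>(a, q)\<leftarrow>xs. f a * poly q z)"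

definition unit_hol :: "complex set \<Rightarrow> (complex \<Rightarrow> complex) set"
  where "unit_hol V = {f. f holomorphic_on V \<and> (\<forall>z\<in>V. cmod (f z) \<le> 1)}"

text \<open>The approximation is uniform over the unit ball of bounded holomorphic functions, so that it can
  be applied to one coordinate of a function of several variables with the others as parameters.\<close>

definition quadrature :: "complex set \<Rightarrow> complex set \<Rightarrow> ((complex \<Rightarrow> complex) \<Rightarrow> complex \<Rightarrow> complex) \<Rightarrow> bool"
  where "quadrature K V \<Phi> \<longleftrightarrow> (\<forall>e>0. \<exists>xs. fst ` set xs \<subseteq> V \<and>
    (\<forall>f\<in>unit_hol V. \<forall>z\<in>K. cmod (\<Phi> f z - quad_sum xs f z) \<le> e))"

lemma quad_sum_append: "quad_sum (xs @ ys) f z = quad_sum xs f z + quad_sum ys f z"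
  by (simp add: quad_sum_def)

lemma quadrature_cong:
  assumes "quadrature K V \<Psi>" "\<And>f z. f \<in> unit_hol V \<Longrightarrow> z \<in> K \<Longrightarrow> \<Phi> f z = \<Psi> f z"
  shows "quadrature K V \<Phi>"
  using assms unfolding quadrature_def by simp

lemma quadrature_zero: "quadrature K V (\<lambda>f z. 0)"
  unfolding quadrature_def by (intro allI impI exI[of _ "[]"]) (simp add: quad_sum_def)

lemma quadrature_add:
  assumes "quadrature K V \<Phi>" "quadrature K V \<Psi>"
  shows "quadrature K V (\<lambda>f z. \<Phi> f z + \<Psi> f z)"
  unfolding quadrature_def
proof (intro allI impI)
  fix e :: real assume e: "e > 0"
  obtain xs where xs: "fst ` set xs \<subseteq> V"
      "\<And>f z. f \<in> unit_hol V \<Longrightarrow> z \<in> K \<Longrightarrow> cmod (\<Phi> f z - quad_sum xs f z) \<le> e/2"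
    using assms(1)[unfolded quadrature_def, rule_format, OF half_gt_zero[OF e]] by blast
  obtain ys where ys: "fst ` set ys \<subseteq> V"
      "\<And>f z. f \<in> unit_hol V \<Longrightarrow> z \<in> K \<Longrightarrow> cmod (\<Psi> f z - quad_sum ys f z) \<le> e/2"
    using assms(2)[unfolded quadrature_def, rule_format, OF half_gt_zero[OF e]] by blast
  have "cmod (\<Phi> f z + \<Psi> f z - quad_sum (xs @ ys) f z) \<le> e" if "f \<in> unit_hol V" "z \<in> K" for f z
    using norm_triangle_mono[OF xs(2)[OF that] ys(2)[OF that]] by (simp add: quad_sum_append algebra_simps)
  then show "\<exists>xs. fst ` set xs \<subseteq> V \<and>
      (\<forall>f\<in>unit_hol V. \<forall>z\<in>K. cmod (\<Phi> f z + \<Psi> f z - quad_sum xs f z) \<le> e)"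
    using xs(1) ys(1) by (intro exI[of _ "xs @ ys"]) auto
qed

lemma quadrature_cmult:
  assumes "quadrature K V \<Phi>"
  shows "quadrature K V (\<lambda>f z. c * \<Phi> f z)"
  unfolding quadrature_def
proof (intro allI impI)
  fix e :: real assume e: "e > 0"
  define e' where "e' = e / (cmod c + 1)"
  have e': "e' > 0" using e by (simp add: e'_def add_nonneg_pos)
  obtain xs where xs: "fst ` set xs \<subseteq> V"
      "\<And>f z. f \<in> unit_hol V \<Longrightarrow> z \<in> K \<Longrightarrow> cmod (\<Phi> f z - quad_sum xs f z) \<le> e'"
    using assms[unfolded quadrature_def, rule_format, OF e'] by blast
  define ys where "ys = map (\<lambda>(a, q). (a, smult c q)) xs"
  have ys: "quad_sum ys f z = c * quad_sum xs f z" for f z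
    unfolding quad_sum_def ys_def by (induction xs) (auto simp: algebra_simps)
  have "cmod (c * \<Phi> f z - quad_sum ys f z) \<le> e" if "f \<in> unit_hol V" "z \<in> K" for f z
  proof -
    have "cmod (c * \<Phi> f z - quad_sum ys f z) = cmod c * cmod (\<Phi> f z - quad_sum xs f z)"
      by (simp only: ys norm_mult right_diff_distrib[symmetric])
    also have "\<dots> \<le> (cmod c + 1) * e'"
      using xs(2)[OF that] e' by (intro mult_mono) simp_all
    also have "\<dots> = e" by (simp add: e'_def add_nonneg_eq_0_iff)
    finally show ?thesis .
  qed
  moreover have "fst ` set ys \<subseteq> V" using xs(1) by (auto simp: ys_def)
  ultimately show "\<exists>xs. fst ` set xs \<subseteq> V \<and>
      (\<forall>f\<in>unit_hol V. \<forall>z\<in>K. cmod (c * \<Phi> f z - quad_sum xs f z) \<le> e)" by blast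
qed

lemma quadrature_sum:
  assumes "finite I" "\<And>i. i \<in> I \<Longrightarrow> quadrature K V (\<Phi> i)"
  shows "quadrature K V (\<lambda>f z. \<Sum>i\<in>I. \<Phi> i f z)"
  using assms
proof (induction I)
  case empty show ?case using quadrature_zero by simp
next
  case (insert x I)
  have "quadrature K V (\<lambda>f z. \<Phi> x f z + (\<Sum>i\<in>I. \<Phi> i f z))"
    by (rule quadrature_add) (use insert in simp_all)
  then show ?case using insert(1,2) by simp
qed

lemma quadrature_limit:
  assumes "\<And>e. e > 0 \<Longrightarrow> \<exists>\<Psi>. quadrature K V \<Psi> \<and> (\<forall>f\<in>unit_hol V. \<forall>z\<in>K. cmod (\<Phi> f z - \<Psi> f z) \<le> e)"
  shows "quadrature K V \<Phi>"
  unfolding quadrature_def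
proof (intro allI impI)
  fix e :: real assume e: "e > 0"
  obtain \<Psi> where \<Psi>: "quadrature K V \<Psi>" "\<And>f z. f \<in> unit_hol V \<Longrightarrow> z \<in> K \<Longrightarrow> cmod (\<Phi> f z - \<Psi> f z) \<le> e/2"
    using assms[OF half_gt_zero[OF e]] by blast
  obtain xs where xs: "fst ` set xs \<subseteq> V"
      "\<And>f z. f \<in> unit_hol V \<Longrightarrow> z \<in> K \<Longrightarrow> cmod (\<Psi> f z - quad_sum xs f z) \<le> e/2"
    using \<Psi>(1)[unfolded quadrature_def, rule_format, OF half_gt_zero[OF e]] by blast
  have "cmod (\<Phi> f z - quad_sum xs f z) \<le> e" if "f \<in> unit_hol V" "z \<in> K" for f z
    using norm_triangle_mono[OF \<Psi>(2)[OF that] xs(2)[OF that]] by simp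
  then show "\<exists>xs. fst ` set xs \<subseteq> V \<and>
      (\<forall>f\<in>unit_hol V. \<forall>z\<in>K. cmod (\<Phi> f z - quad_sum xs f z) \<le> e)" using xs(1) by blast
qed

text \<open>Replacing \<open>g\<close> by a polynomial costs the error of \<open>g\<close> times
  \<open>cmod (f a)\<close>, and the latter is at most 1 on the unit ball; this is where boundedness
  gives uniformity in \<open>f\<close>.\<close>

lemma quadrature_point:
  assumes "a \<in> V" "poly_approximable K g"
  shows "quadrature K V (\<lambda>f z. f a * g z)"
  unfolding quadrature_def
proof (intro allI impI)
  fix e :: real assume e: "e > 0"
  obtain p where p: "\<And>z. z \<in> K \<Longrightarrow> cmod (g z - poly p z) \<le> e"
    using assms(2) e unfolding poly_approximable_def by blast
  have "cmod (f a * g z - quad_sum [(a, p)] f z) \<le> e" if "f \<in> unit_hol V" "z \<in> K" for f z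
  proof -
    have "cmod (f a * g z - quad_sum [(a, p)] f z) = cmod (f a) * cmod (g z - poly p z)"
      by (simp add: quad_sum_def right_diff_distrib[symmetric] norm_mult)
    also have "\<dots> \<le> 1 * e"
      using that assms(1) p[OF that(2)] by (intro mult_mono) (simp_all add: unit_hol_def)
    finally show ?thesis by simp
  qed
  then show "\<exists>xs. fst ` set xs \<subseteq> V \<and>
      (\<forall>f\<in>unit_hol V. \<forall>z\<in>K. cmod (f a * g z - quad_sum xs f z) \<le> e)"
    using assms(1) by (intro exI[of _ "[(a, p)]"]) simp
qed

text \<open>Each cell of length \<open>1/n\<close> contributes at most \<open>L/n * 1/n\<close>.
  Mere convergence of Riemann sums would not do: the rate must depend on \<open>L\<close> alone, so
  that one \<open>n\<close> serves every function of the unit ball.\<close>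

lemma Riemann_sum_Lipschitz:
  fixes \<phi> :: "real \<Rightarrow> complex"
  assumes lip: "\<And>x y. x \<in> {0..1} \<Longrightarrow> y \<in> {0..1} \<Longrightarrow> cmod (\<phi> x - \<phi> y) \<le> L * \<bar>x - y\<bar>"
    and cont: "continuous_on {0..1} \<phi>" and n: "n > 0"
  shows "cmod (integral {0..1} \<phi> - (\<Sum>k<n. \<phi> (real k / real n) / of_nat n)) \<le> L / real n"
proof -
  have L0: "L \<ge> 0" using order.trans[OF norm_ge_zero lip[of 0 1]] by simp
  have "cmod (integral {0..real m / real n} \<phi> - (\<Sum>k<m. \<phi> (real k / real n) / of_nat n))
          \<le> real m * (L / real n * (1 / real n))" if "m \<le> n" for m
    using that
  proof (induction m)
    case 0 then show ?case by simp
  next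
    case (Suc m)
    let ?a = "real m / real n" and ?b = "real (Suc m) / real n"
    have ab: "0 \<le> ?a" "?a \<le> ?b" "?b \<le> 1" "?b - ?a = 1 / real n"
      using n Suc.prems by (simp_all add: divide_simps)
    have sub: "{?a..?b} \<subseteq> {0..1}" "{0..?b} \<subseteq> {0..1}" using ab by auto
    have ca: "continuous_on {?a..?b} \<phi>" and cb: "continuous_on {0..?b} \<phi>"
      using continuous_on_subset[OF cont] sub by auto
    have "integral {0..?b} \<phi> = integral {0..?a} \<phi> + integral {?a..?b} \<phi>"
      by (rule Henstock_Kurzweil_Integration.integral_combine[symmetric])
        (use ab cb integrable_continuous_interval in auto)
    moreover have "integral {?a..?b} (\<lambda>x. \<phi> x - \<phi> ?a) = integral {?a..?b} \<phi> - \<phi> ?a / of_nat n"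
    proof -
      have "integral {?a..?b} (\<lambda>x. \<phi> x - \<phi> ?a) = integral {?a..?b} \<phi> - integral {?a..?b} (\<lambda>x. \<phi> ?a)"
        by (intro Henstock_Kurzweil_Integration.integral_diff integrable_continuous_interval ca continuous_intros)
      also have "integral {?a..?b} (\<lambda>x. \<phi> ?a) = (?b - ?a) *\<^sub>R \<phi> ?a"
        using ab(2) by simp
      also have "\<dots> = \<phi> ?a / of_nat n" unfolding ab(4) by (simp add: scaleR_conv_of_real)
      finally show ?thesis .
    qed
    ultimately have "integral {0..?b} \<phi> - (\<Sum>k<Suc m. \<phi> (real k / real n) / of_nat n)
        = (integral {0..?a} \<phi> - (\<Sum>k<m. \<phi> (real k / real n) / of_nat n)) + integral {?a..?b} (\<lambda>x. \<phi> x - \<phi> ?a)"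
      by simp
    moreover have "cmod (integral {?a..?b} (\<lambda>x. \<phi> x - \<phi> ?a)) \<le> L / real n * (?b - ?a)"
    proof (rule integral_bound)
      fix t assume t: "t \<in> {?a..?b}"
      have "cmod (\<phi> t - \<phi> ?a) \<le> L * \<bar>t - ?a\<bar>" using subsetD[OF sub(1) t] subsetD[OF sub(1), of ?a] ab(2) by (intro lip) simp_all
      also have "\<dots> \<le> L * (1 / real n)" using t L0 ab(4) by (intro mult_left_mono) auto
      finally show "cmod (\<phi> t - \<phi> ?a) \<le> L / real n" by simp
    next
      show "continuous_on {?a..?b} (\<lambda>x. \<phi> x - \<phi> ?a)" by (intro continuous_intros ca)
    qed (rule ab(2))
    ultimately have "cmod (integral {0..?b} \<phi> - (\<Sum>k<Suc m. \<phi> (real k / real n) / of_nat n))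
        \<le> real m * (L / real n * (1 / real n)) + L / real n * (1 / real n)"
      using Suc.IH Suc.prems unfolding ab(4) by (metis Suc_leD norm_triangle_mono)
    also have "\<dots> = real (Suc m) * (L / real n * (1 / real n))"
      by (simp only: of_nat_Suc distrib_right mult_1_left add.commute)
    finally show ?case .
  qed
  from this[of n] show ?thesis using n by simp
qed

text \<open>The integral is replaced by a Riemann sum, whose terms are values of \<open>f\<close> at
  fixed points times Cauchy kernels with poles off \<open>K\<close>. Cauchy's inequality bounds the
  derivative of the integrand uniformly in \<open>f\<close> and \<open>z\<close>, so the number of
  nodes can be fixed beforehand.\<close>

lemma quadrature_segment:
  assumes K: "compact K" "connected (- K)" and V: "open V" and seg: "closed_segment a b \<subseteq> V - K"
  shows "quadrature K V (\<lambda>f z. contour_integral (linepath a b) (\<lambda>\<zeta>. f \<zeta> / (\<zeta> - z)))"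
proof (rule quadrature_limit)
  fix e :: real assume e: "e > 0"
  have "open (V - K)" using V K compact_imp_closed by blast
  then obtain d2 where d2: "d2 > 0" "(\<Union>x\<in>closed_segment a b. ball x d2) \<subseteq> V - K"
    using compact_subset_open_imp_ball_epsilon_subset[OF compact_segment _ seg] by blast
  \<comment> \<open>Half the clearance: circles of radius \<open>d\<close> around points of the
    segment stay in \<open>V\<close> and at distance at least \<open>d\<close> from
    \<open>K\<close>, so the integrand is at most \<open>1/d\<close> on them.\<close>
  define d where "d = d2 / 2"
  have d: "d > 0" using d2 by (simp add: d_def)
  \<comment> \<open>\<open>1/d/d\<close> bounds the derivative of the integrand; one factor
    \<open>cmod (b - a)\<close> is the speed of the parametrization, the other comes from the
    differential.\<close>
  define L where "L = (1 / d / d * cmod (b - a)) * cmod (b - a)"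
  obtain n where n: "n > 0" "L / real n \<le> e"
  proof -
    obtain n :: nat where "L / e < real n" using reals_Archimedean2 by blast
    then have "L < real n * e" using e by (simp only: pos_divide_less_eq)
    also have "\<dots> \<le> e * real (Suc n)" using e by (simp add: algebra_simps)
    finally have "L / real (Suc n) \<le> e" by (simp only: pos_divide_le_eq of_nat_0_less_iff zero_less_Suc)
    then show thesis using that[of "Suc n"] by blast
  qed
  define pt where "pt k = linepath a b (real k / real n)" for k :: nat
  define \<Psi> where "\<Psi> f z = (\<Sum>k<n. (b - a) / of_nat n * (f (pt k) * (1 / (pt k - z))))"
    for f :: "complex \<Rightarrow> complex" and z
  have pt: "pt k \<in> closed_segment a b" if "k < n" for k
    unfolding pt_def using that by (intro linepath_in_path) (simp add: divide_simps)
  have "quadrature K V \<Psi>"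
    unfolding \<Psi>_def
  proof (intro quadrature_sum quadrature_cmult quadrature_point)
    fix k assume "k \<in> {..<n}"
    then have "pt k \<in> V - K" using pt seg by auto
    then show "pt k \<in> V" "poly_approximable K (\<lambda>z. 1 / (pt k - z))"
      using poly_approximable_Cauchy_kernel[OF K] by auto
  qed simp
  moreover have "cmod (contour_integral (linepath a b) (\<lambda>\<zeta>. f \<zeta> / (\<zeta> - z)) - \<Psi> f z) \<le> e"
    if f: "f \<in> unit_hol V" and z: "z \<in> K" for f z
  proof -
    define g where "g = (\<lambda>\<zeta>. f \<zeta> / (\<zeta> - z))"
    have hol: "g holomorphic_on V - K"
      unfolding g_def using f z
      by (intro holomorphic_intros) (auto simp: unit_hol_def intro: holomorphic_on_subset)
    have der: "cmod (deriv g x) \<le> 1 / d / d" if x: "x \<in> closed_segment a b" for x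
    proof -
      have sub: "cball x d \<subseteq> ball x d2" using d2 by (auto simp: d_def)
      also have "\<dots> \<subseteq> V - K" using d2 x by blast
      finally have sub': "cball x d \<subseteq> V - K" .
      have "z \<notin> ball x d2" using d2(2) x z by blast
      then have xz: "dist x z \<ge> 2 * d" by (simp add: d_def)
      have "cmod ((deriv ^^ 1) g x) \<le> fact 1 * (1 / d) / d ^ 1"
      proof (rule Cauchy_inequality[OF _ _ d])
        show "g holomorphic_on ball x d" "continuous_on (cball x d) g"
          using holomorphic_on_subset[OF hol sub'] holomorphic_on_subset[OF hol order.trans[OF ball_subset_cball sub']]
            holomorphic_on_imp_continuous_on by blast+
        fix y assume y: "cmod (x - y) = d"
        then have yV: "y \<in> V" using sub' by (auto simp: dist_norm subset_iff)
        have "dist x z \<le> dist x y + dist y z" by (rule dist_triangle)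
        then have "cmod (y - z) \<ge> d" using y xz by (simp add: dist_norm)
        moreover have "cmod (f y) \<le> 1" using f yV by (simp add: unit_hol_def)
        ultimately show "cmod (g y) \<le> 1 / d"
          unfolding g_def norm_divide using d by (intro frac_le) auto
      qed
      then show ?thesis by simp
    qed
    have dif: "(g has_field_derivative deriv g x) (at x within closed_segment a b)" if "x \<in> closed_segment a b" for x
      using holomorphic_derivI[OF hol \<open>open (V - K)\<close>] that seg by blast
    have lip: "cmod (g x - g y) \<le> 1 / d / d * cmod (x - y)" if "x \<in> closed_segment a b" "y \<in> closed_segment a b" for x y
      by (rule field_differentiable_bound[OF convex_closed_segment dif der that])
    define \<phi> where "\<phi> = (\<lambda>x. g (linepath a b x) * (b - a))"
    have gc: "continuous_on (closed_segment a b) g"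
      using holomorphic_on_imp_continuous_on[OF holomorphic_on_subset[OF hol seg]] .
    have lipphi: "cmod (\<phi> x - \<phi> y) \<le> L * \<bar>x - y\<bar>" if "x \<in> {0..1}" "y \<in> {0..1}" for x y
    proof -
      have "linepath a b x - linepath a b y = of_real (x - y) * (b - a)"
        by (simp add: linepath_def scaleR_conv_of_real algebra_simps)
      then have lp: "cmod (linepath a b x - linepath a b y) = cmod (b - a) * \<bar>x - y\<bar>"
        by (simp only: norm_mult norm_of_real mult.commute)
      have "cmod (\<phi> x - \<phi> y) = cmod (g (linepath a b x) - g (linepath a b y)) * cmod (b - a)"
        by (simp only: \<phi>_def left_diff_distrib[symmetric] norm_mult)
      also have "\<dots> \<le> (1 / d / d * cmod (linepath a b x - linepath a b y)) * cmod (b - a)"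
        by (intro mult_right_mono lip linepath_in_path that) simp
      also have "\<dots> = L * \<bar>x - y\<bar>" unfolding lp L_def by (simp only: mult_ac)
      finally show ?thesis .
    qed
    have phic: "continuous_on {0..1} \<phi>"
      unfolding \<phi>_def
      by (intro continuous_intros continuous_on_compose2[OF gc]) (auto simp: linepath_in_path)
    have "contour_integral (linepath a b) g = integral {0..1} \<phi>"
      using has_contour_integral_integral[OF contour_integrable_continuous_linepath[OF gc]]
      unfolding has_contour_integral_linepath \<phi>_def by (rule integral_unique[symmetric])
    moreover have "\<Psi> f z = (\<Sum>k<n. \<phi> (real k / real n) / of_nat n)"
      unfolding \<Psi>_def \<phi>_def g_def pt_def by (intro sum.cong) (simp_all add: divide_inverse mult_ac)
    ultimately have "cmod (contour_integral (linepath a b) g - \<Psi> f z) \<le> L / real n"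
      using Riemann_sum_Lipschitz[OF lipphi phic n(1)] by simp
    then show ?thesis using n(2) unfolding g_def by linarith
  qed
  ultimately show "\<exists>\<Psi>. quadrature K V \<Psi> \<and> (\<forall>f\<in>unit_hol V. \<forall>z\<in>K.
      cmod (contour_integral (linepath a b) (\<lambda>\<zeta>. f \<zeta> / (\<zeta> - z)) - \<Psi> f z) \<le> e)" by blast
qed

section \<open>Cauchy's formula along the edges of a grid\<close>

lemma int_Abel_sum:
  fixes u v :: "int \<Rightarrow> complex"
  assumes "u n = 0" "u (- n - 1) = 0"
  shows "(\<Sum>j\<in>{-n..n}. u j * (v j - v (j + 1))) = (\<Sum>j\<in>{-n..n}. (u j - u (j - 1)) * v j)"
proof -
  have "(\<Sum>j\<in>{-n..n}. u j * v (j + 1)) = (\<Sum>j\<in>{-n+1..n+1}. u (j - 1) * v j)"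
    by (rule sum.reindex_bij_witness[of _ "\<lambda>j. j - 1" "\<lambda>j. j + 1"]) auto
  also have "\<dots> = (\<Sum>j\<in>{-n..n}. u (j - 1) * v j)"
  proof (rule sum.mono_neutral_cong)
    show "u (j - 1) * v j = 0" if "j \<in> {-n..n} - {-n+1..n+1}" for j
    proof -
      have "j = - n" using that by auto
      then show ?thesis using assms by simp
    qed
    show "u (j - 1) * v j = 0" if "j \<in> {-n+1..n+1} - {-n..n}" for j
    proof -
      have "j = n + 1" using that by auto
      then show ?thesis using assms by simp
    qed
  qed simp_all
  finally show ?thesis
    by (simp add: right_diff_distrib left_diff_distrib sum_subtractf)
qed

text \<open>Top and left edges are reversed so that every edge is directed rightwards or upwards. An
  edge shared by two squares then yields the same integral with opposite signs.\<close>

lemma contour_integral_rectpath: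
  assumes "continuous_on (path_image (rectpath (Complex x y) (Complex x' y'))) F"
    "x \<le> x'" "y \<le> y'"
  shows "contour_integral (rectpath (Complex x y) (Complex x' y')) F =
    contour_integral (linepath (Complex x y) (Complex x' y)) F
    + contour_integral (linepath (Complex x' y) (Complex x' y')) F
    - contour_integral (linepath (Complex x y') (Complex x' y')) F
    - contour_integral (linepath (Complex x y) (Complex x y')) F"
proof -
  let ?a = "Complex x y" and ?b = "Complex x' y" and ?c = "Complex x' y'" and ?d = "Complex x y'"
  have im: "path_image (rectpath ?a ?c) = closed_segment ?a ?b \<union> (closed_segment ?b ?c \<union> (closed_segment ?c ?d \<union> closed_segment ?d ?a))"
    by (simp add: rectpath_def Let_def path_image_join)
  have i: "F contour_integrable_on linepath ?a ?b" "F contour_integrable_on linepath ?b ?c"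
      "F contour_integrable_on linepath ?c ?d" "F contour_integrable_on linepath ?d ?a"
    using assms(1) unfolding im
    by (auto intro!: contour_integrable_continuous_linepath elim: continuous_on_subset)
  have rev: "contour_integral (linepath ?c ?d) F = - contour_integral (linepath ?d ?c) F"
      "contour_integral (linepath ?d ?a) F = - contour_integral (linepath ?a ?d) F"
    using contour_integral_reversepath[of "linepath ?d ?c" F] contour_integral_reversepath[of "linepath ?a ?d" F] by simp_all
  have "contour_integral (rectpath ?a ?c) F = contour_integral (linepath ?a ?b) F
    + (contour_integral (linepath ?b ?c) F + (contour_integral (linepath ?c ?d) F + contour_integral (linepath ?d ?a) F))"
    using i by (simp add: rectpath_def Let_def contour_integrable_join)
  then show ?thesis unfolding rev by simp
qed

text \<open>Needed because the grid formula is first obtained in the open squares; continuity in the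
  pole carries it over to points of \<open>K\<close> on grid lines.\<close>

lemma contour_integral_Cauchy_kernel_cont:
  assumes "continuous_on (closed_segment a b) f" "z \<notin> closed_segment a b"
  shows "isCont (\<lambda>w. contour_integral (linepath a b) (\<lambda>\<zeta>. f \<zeta> / (\<zeta> - w))) z"
proof -
  have "((\<lambda>w. contour_integral (linepath a b) (\<lambda>\<zeta>. f \<zeta> / (\<zeta> - w))) has_field_derivative
      (of_nat 1 * contour_integral (linepath a b) (\<lambda>\<zeta>. f \<zeta> / (\<zeta> - z) ^ Suc 1))) (at z)"
  proof (rule Cauchy_next_derivative(2)[where S = UNIV and B = "cmod (b - a)"])
    fix w assume "w \<in> UNIV - path_image (linepath a b)"
    then have "continuous_on (closed_segment a b) (\<lambda>\<zeta>. f \<zeta> / (\<zeta> - w))"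
      using assms(1) by (intro continuous_intros) auto
    then show "((\<lambda>\<zeta>. f \<zeta> / (\<zeta> - w) ^ 1) has_contour_integral
        contour_integral (linepath a b) (\<lambda>\<zeta>. f \<zeta> / (\<zeta> - w))) (linepath a b)"
      using has_contour_integral_integral[OF contour_integrable_continuous_linepath] by simp
  qed (use assms in \<open>auto simp: vector_derivative_linepath_at\<close>)
  then show ?thesis by (rule DERIV_isCont)
qed

text \<open>Cauchy's formula is summed over the small grid squares that meet \<open>K\<close>; an edge common to two of
  them is traversed in both directions and cancels, and the remaining edges do not meet \<open>K\<close>.\<close>

lemma Cauchy_grid_formula:
  fixes K V :: "complex set"
  assumes K: "compact K" and V: "open V" and KV: "K \<subseteq> V"
  obtains I :: "(bool \<times> int \<times> int) set" and a b c where "finite I"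
    "\<And>i. i \<in> I \<Longrightarrow> closed_segment (a i) (b i) \<subseteq> V - K"
    "\<And>f z. f holomorphic_on V \<Longrightarrow> z \<in> K \<Longrightarrow>
      f z = (\<Sum>i\<in>I. c i * contour_integral (linepath (a i) (b i)) (\<lambda>\<zeta>. f \<zeta> / (\<zeta> - z)))"
proof -
  obtain d where d: "d > 0" "(\<Union>x\<in>K. ball x d) \<subseteq> V"
    using compact_subset_open_imp_ball_epsilon_subset[OF K V KV] by blast
  \<comment> \<open>The diagonal of a square of side \<open>d/2\<close> is shorter than
    \<open>d\<close>, so a square meeting \<open>K\<close> lies in \<open>V\<close>.\<close>
  define h where "h = d / 2"
  have h: "h > 0" using d by (simp add: h_def)
  define gp where "gp i j = Complex (h * of_int i) (h * of_int j)" for i j :: int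
  define Q where "Q i j = cbox (gp i j) (gp (i + 1) (j + 1))" for i j
  have Qiff: "z \<in> Q i j \<longleftrightarrow> h * of_int i \<le> Re z \<and> Re z \<le> h * of_int i + h \<and> h * of_int j \<le> Im z \<and> Im z \<le> h * of_int j + h" for z i j
    by (simp add: Q_def gp_def in_cbox_complex_iff algebra_simps)
  define meets :: "int \<Rightarrow> int \<Rightarrow> complex" where "meets i j = (if Q i j \<inter> K \<noteq> {} then 1 else 0)" for i j
  have Qsub: "Q i j \<subseteq> V" if "meets i j \<noteq> 0" for i j
  proof -
    obtain k where k: "k \<in> Q i j" "k \<in> K" using \<open>meets i j \<noteq> 0\<close> by (auto simp: meets_def split: if_splits)
    have "dist k x < d" if "x \<in> Q i j" for x
    proof -
      have "\<bar>Re (k - x)\<bar> \<le> h" "\<bar>Im (k - x)\<bar> \<le> h" using k(1) that by (auto simp: Qiff)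
      then have "(cmod (k - x))\<^sup>2 \<le> h\<^sup>2 + h\<^sup>2"
        unfolding cmod_power2 by (intro add_mono) (auto simp: abs_le_square_iff[symmetric] h less_imp_le)
      also have "\<dots> < d\<^sup>2" using d(1) by (simp add: h_def power2_eq_square)
      finally have "cmod (k - x) < d" using d(1) by (simp add: power2_less_imp_less)
      then show ?thesis by (simp add: dist_norm)
    qed
    then show ?thesis using d(2) k(2) by (auto simp: subset_iff)
  qed
  obtain R where R: "\<And>z. z \<in> K \<Longrightarrow> cmod z \<le> R" and "R > 0"
    using compact_imp_bounded[OF K] by (meson bounded_pos)
  \<comment> \<open>The margin of 2 puts all squares that meet \<open>K\<close> strictly inside the
    index range, so the boundary terms of the summation by parts vanish.\<close>
  obtain n :: int where n: "R / h + 2 < of_int n" by (meson ex_less_of_int)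
  have idx: "- n < i \<and> i < n \<and> - n < j \<and> j < n" if "meets i j \<noteq> 0" for i j
  proof -
    obtain k where k: "k \<in> Q i j" "k \<in> K" using \<open>meets i j \<noteq> 0\<close> by (auto simp: meets_def split: if_splits)
    have aux: "- n < m \<and> m < n" if "h * of_int m \<le> t" "t \<le> h * of_int m + h" "\<bar>t\<bar> \<le> R" for m t
    proof -
      have "R + 2 * h < h * of_int n" using n h by (simp add: field_simps)
      moreover have "h * of_int (- n) = - (h * of_int n)" by simp
      ultimately have "h * of_int m < h * of_int n" "h * of_int (- n) < h * of_int m"
        using that h by linarith+
      then have "of_int m < (of_int n :: real)" "of_int (- n) < (of_int m :: real)"
        using h by (simp_all only: mult_less_cancel_left_pos)
      then show ?thesis by linarith
    qed
    have "\<bar>Re k\<bar> \<le> R" "\<bar>Im k\<bar> \<le> R"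
      using R[OF k(2)] abs_Re_le_cmod abs_Im_le_cmod order.trans by blast+
    with k(1) show ?thesis unfolding Qiff using aux[of i "Re k"] aux[of j "Im k"] by blast
  qed
  define A where "A = {-n..n}"
  define a :: "bool \<times> int \<times> int \<Rightarrow> complex" where "a = (\<lambda>(t, i, j). gp i j)"
  define b where "b = (\<lambda>(t, i, j). if t then gp (i + 1) j else gp i (j + 1))"
  \<comment> \<open>\<open>True\<close> stands for horizontal and \<open>False\<close> for vertical
    edges. The coefficient is the jump of the indicator \<open>meets\<close> across the edge, signed
    by the counterclockwise orientation of the squares.\<close>
  define c where "c = (\<lambda>(t, i, j). 1 / (2 * of_real pi * \<i>) * (if t then meets i j - meets i (j - 1) else meets (i - 1) j - meets i j))"
  define I where "I = {x \<in> UNIV \<times> A \<times> A. c x \<noteq> 0}"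
  have finI: "finite I" unfolding I_def A_def by simp
  have gpQ: "gp i j \<in> Q i j" "gp (i + 1) j \<in> Q i j" "gp i (j + 1) \<in> Q i j"
      "gp i j \<in> Q i (j - 1)" "gp (i + 1) j \<in> Q i (j - 1)" "gp i j \<in> Q (i - 1) j" "gp i (j + 1) \<in> Q (i - 1) j" for i j
    unfolding Qiff gp_def using h by (simp_all add: algebra_simps)
  have convQ: "convex (Q i j)" for i j unfolding Q_def by simp
  have segsub: "closed_segment (a x) (b x) \<subseteq> V - K" if "x \<in> I" for x
  proof -
    obtain t i j where x: "x = (t, i, j)" by (cases x) auto
    define i' j' where "i' = (if t then i else i - 1)" and "j' = (if t then j - 1 else j)"
    have sub: "closed_segment (a x) (b x) \<subseteq> Q i j" "closed_segment (a x) (b x) \<subseteq> Q i' j'"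
      using closed_segment_subset[OF gpQ(1,2) convQ] closed_segment_subset[OF gpQ(1,3) convQ]
        closed_segment_subset[OF gpQ(4,5) convQ] closed_segment_subset[OF gpQ(6,7) convQ]
      by (simp_all add: x a_def b_def i'_def j'_def)
    \<comment> \<open>A nonzero jump means that exactly one of the two squares at the edge meets
      \<open>K\<close>. That square lies in \<open>V\<close>, the other misses \<open>K\<close>, and
      the edge belongs to both.\<close>
    have "meets i j \<noteq> meets i' j'" using that by (auto simp: I_def x c_def i'_def j'_def split: if_splits)
    then have "(meets i j \<noteq> 0 \<and> Q i' j' \<inter> K = {}) \<or> (meets i' j' \<noteq> 0 \<and> Q i j \<inter> K = {})"
      by (auto simp: meets_def split: if_splits)
    then show ?thesis using sub Qsub by blast
  qed
  \<comment> \<open>For \<open>z\<close> in an open square no grid edge passes through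
    \<open>z\<close>, so Cauchy's formula applies in that square and Cauchy's theorem in the
    others.\<close>
  have inner: "f z = (\<Sum>x\<in>I. c x * contour_integral (linepath (a x) (b x)) (\<lambda>\<zeta>. f \<zeta> / (\<zeta> - z)))"
    if f: "f holomorphic_on V" and z: "z \<in> box (gp i0 j0) (gp (i0 + 1) (j0 + 1))" and meets0: "meets i0 j0 \<noteq> 0" for f z i0 j0
  proof -
    define F where "F = (\<lambda>\<zeta>. f \<zeta> / (\<zeta> - z))"
    define hI where "hI i j = contour_integral (linepath (gp i j) (gp (i + 1) j)) F" for i j
    define vI where "vI i j = contour_integral (linepath (gp i j) (gp i (j + 1))) F" for i j
    have zb: "h * of_int i0 < Re z" "Re z < h * of_int (i0 + 1)" "h * of_int j0 < Im z" "Im z < h * of_int (j0 + 1)"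
      using z by (auto simp: in_box_complex_iff gp_def)
    have between: "\<not> (h * of_int i < h * (of_int m :: real) \<and> h * of_int m < h * of_int (i + 1))" for i m
      using h by (simp only: mult_less_cancel_left_pos of_int_less_iff) linarith
    have notgrid: "Re z \<noteq> h * of_int m" "Im z \<noteq> h * of_int m" for m
      using zb between[of i0 m] between[of j0 m] by auto
    have zpath: "z \<notin> path_image (rectpath (gp i j) (gp (i + 1) (j + 1)))" for i j
      using notgrid[of i] notgrid[of "i + 1"] notgrid[of j] notgrid[of "j + 1"] h
      by (subst path_image_rectpath) (auto simp: gp_def)
    have sq: "meets i j * (hI i j + vI (i + 1) j - hI i (j + 1) - vI i j)
        = (if i = i0 \<and> j = j0 then 2 * of_real pi * \<i> * f z else 0)" for i j
    proof (cases "meets i j = 0")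
      case True then show ?thesis using meets0 by auto
    next
      case False
      then have meets1: "meets i j = 1" by (simp add: meets_def split: if_splits)
      let ?g = "rectpath (gp i j) (gp (i + 1) (j + 1))"
      have pQ: "path_image ?g \<subseteq> Q i j"
        unfolding Q_def by (rule path_image_rectpath_subset_cbox) (use h in \<open>simp_all add: gp_def\<close>)
      have fQ: "f holomorphic_on Q i j" using f Qsub[OF False] by (rule holomorphic_on_subset)
      have "continuous_on (path_image ?g) F"
        unfolding F_def using fQ pQ zpath[of i j]
        by (intro continuous_intros) (auto intro: continuous_on_subset holomorphic_on_imp_continuous_on)
      then have "hI i j + vI (i + 1) j - hI i (j + 1) - vI i j = contour_integral ?g F"
        unfolding hI_def vI_def gp_def
        by (subst contour_integral_rectpath) (use h in simp_all)
      also have "\<dots> = (if i = i0 \<and> j = j0 then 2 * of_real pi * \<i> * f z else 0)"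
      proof (cases "i = i0 \<and> j = j0")
        case True
        then have "z \<in> interior (Q i j)" "winding_number ?g z = 1"
          using z winding_number_rectpath by (auto simp: Q_def)
        then have "(F has_contour_integral (2 * pi * \<i> * winding_number ?g z * f z)) ?g"
          unfolding F_def using pQ zpath[of i j] by (intro Cauchy_integral_formula_convex_simple[OF convQ fQ]) auto
        then show ?thesis using True \<open>winding_number ?g z = 1\<close> by (simp add: contour_integral_unique)
      next
        case outside: False
        have "z \<notin> Q i j"
        proof
          assume "z \<in> Q i j"
          then have "h * of_int i < Re z" "Re z < h * of_int (i + 1)" "h * of_int j < Im z" "Im z < h * of_int (j + 1)"
            using notgrid[of i] notgrid[of "i+1"] notgrid[of j] notgrid[of "j+1"] by (auto simp: Qiff order_less_le algebra_simps)
          with zb have "h * of_int i < h * of_int (i0 + 1)" "h * of_int i0 < h * of_int (i + 1)"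
             "h * of_int j < h * of_int (j0 + 1)" "h * of_int j0 < h * of_int (j + 1)" by linarith+
          then have "i < i0 + 1" "i0 < i + 1" "j < j0 + 1" "j0 < j + 1"
            using h by (simp_all only: mult_less_cancel_left_pos of_int_less_iff)
          then have "i = i0" "j = j0" by linarith+
          with outside show False by simp
        qed
        then have "F holomorphic_on Q i j"
          unfolding F_def using fQ by (intro holomorphic_intros) auto
        then have "(F has_contour_integral 0) ?g"
          using pQ by (intro Cauchy_theorem_convex_simple[OF _ convQ]) auto
        then show ?thesis using contour_integral_unique outside by auto
      qed
      finally show ?thesis using meets1 by simp
    qed
    have in0: "i0 \<in> A" "j0 \<in> A" using idx[OF meets0] by (auto simp: A_def)
    have ends: "meets i n = 0" "meets i (-n-1) = 0" "meets n i = 0" "meets (-n-1) i = 0" for i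
      using idx[of i n] idx[of i "-n-1"] idx[of n i] idx[of "-n-1" i] by auto
    have "2 * of_real pi * \<i> * f z = (\<Sum>i\<in>A. \<Sum>j\<in>A. if i = i0 \<and> j = j0 then 2 * of_real pi * \<i> * f z else 0)"
    proof -
      have "(\<Sum>i\<in>A. \<Sum>j\<in>A. if i = i0 \<and> j = j0 then 2 * of_real pi * \<i> * f z else 0)
          = (\<Sum>i\<in>A. if i = i0 then (\<Sum>j\<in>A. if j = j0 then 2 * of_real pi * \<i> * f z else 0) else 0)"
        by (intro sum.cong) auto
      also have "\<dots> = 2 * of_real pi * \<i> * f z" using in0 by (simp add: A_def)
      finally show ?thesis by simp
    qed
    also have "\<dots> = (\<Sum>i\<in>A. \<Sum>j\<in>A. meets i j * (hI i j + vI (i + 1) j - hI i (j + 1) - vI i j))"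
      by (simp only: sq)
    also have "\<dots> = (\<Sum>i\<in>A. \<Sum>j\<in>A. meets i j * (hI i j - hI i (j + 1))) - (\<Sum>j\<in>A. \<Sum>i\<in>A. meets i j * (vI i j - vI (i + 1) j))"
    proof -
      have "meets i j * (hI i j + vI (i + 1) j - hI i (j + 1) - vI i j)
          = meets i j * (hI i j - hI i (j + 1)) - meets i j * (vI i j - vI (i + 1) j)" for i j
        by (simp add: algebra_simps)
      then show ?thesis by (simp only: sum_subtractf sum.swap[of "\<lambda>i j. meets j i * (vI j i - vI (j + 1) i)"])
    qed
    also have "(\<Sum>i\<in>A. \<Sum>j\<in>A. meets i j * (hI i j - hI i (j + 1))) = (\<Sum>i\<in>A. \<Sum>j\<in>A. (meets i j - meets i (j - 1)) * hI i j)"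
      unfolding A_def by (intro sum.cong refl int_Abel_sum ends)
    also have "(\<Sum>j\<in>A. \<Sum>i\<in>A. meets i j * (vI i j - vI (i + 1) j)) = (\<Sum>j\<in>A. \<Sum>i\<in>A. (meets i j - meets (i - 1) j) * vI i j)"
      unfolding A_def by (intro sum.cong refl int_Abel_sum[of "\<lambda>i. meets i _" n "\<lambda>i. vI i _"] ends)
    also have "\<dots> = (\<Sum>i\<in>A. \<Sum>j\<in>A. (meets i j - meets (i - 1) j) * vI i j)" by (rule sum.swap)
    finally have eq: "2 * of_real pi * \<i> * f z = (\<Sum>i\<in>A. \<Sum>j\<in>A. (meets i j - meets i (j - 1)) * hI i j)
        + (\<Sum>i\<in>A. \<Sum>j\<in>A. (meets (i - 1) j - meets i j) * vI i j)"
      by (simp add: sum_subtractf left_diff_distrib)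
    define T where "T = (\<lambda>x. c x * contour_integral (linepath (a x) (b x)) F)"
    have T1: "T (True, i, j) = 1 / (2 * of_real pi * \<i>) * ((meets i j - meets i (j - 1)) * hI i j)" for i j
      by (simp only: T_def c_def a_def b_def hI_def prod.case if_True mult.assoc)
    have T2: "T (False, i, j) = 1 / (2 * of_real pi * \<i>) * ((meets (i - 1) j - meets i j) * vI i j)" for i j
      by (simp only: T_def c_def a_def b_def vI_def prod.case if_False mult.assoc)
    have "(\<Sum>x\<in>I. T x) = (\<Sum>x\<in>UNIV \<times> A \<times> A. T x)"
      by (rule sum.mono_neutral_left) (auto simp: I_def A_def T_def)
    also have "\<dots> = (\<Sum>t\<in>UNIV. \<Sum>i\<in>A. \<Sum>j\<in>A. T (t, i, j))"
      by (simp add: sum.cartesian_product split_def)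
    also have "\<dots> = (\<Sum>i\<in>A. \<Sum>j\<in>A. T (True, i, j)) + (\<Sum>i\<in>A. \<Sum>j\<in>A. T (False, i, j))"
      by (simp add: UNIV_bool add.commute)
    also have "\<dots> = 1 / (2 * of_real pi * \<i>) * (2 * of_real pi * \<i> * f z)"
      unfolding eq T1 T2 by (simp only: sum_distrib_left distrib_left)
    also have "\<dots> = f z" by simp
    finally show ?thesis by (simp only: T_def F_def)
  qed
  show thesis
  proof (rule that[OF finI segsub])
    fix f z assume f: "f holomorphic_on V" and z: "z \<in> K"
    define D where "D w = f w - (\<Sum>x\<in>I. c x * contour_integral (linepath (a x) (b x)) (\<lambda>\<zeta>. f \<zeta> / (\<zeta> - w)))" for w
    have "isCont D z"
      unfolding D_def
    proof (intro continuous_intros)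
      show "isCont f z" using holomorphic_on_imp_continuous_on[OF f] V z KV by (meson continuous_on_eq_continuous_at subsetD)
      fix x assume "x \<in> I"
      then show "isCont (\<lambda>w. contour_integral (linepath (a x) (b x)) (\<lambda>\<zeta>. f \<zeta> / (\<zeta> - w))) z"
        using segsub[of x] z holomorphic_on_imp_continuous_on[OF f]
        by (intro contour_integral_Cauchy_kernel_cont) (auto elim: continuous_on_subset)
    qed
    define i0 j0 where "i0 = \<lfloor>Re z / h\<rfloor>" and "j0 = \<lfloor>Im z / h\<rfloor>"
    have zQ: "z \<in> Q i0 j0"
    proof -
      have "of_int i0 \<le> Re z / h" "Re z / h < of_int i0 + 1" "of_int j0 \<le> Im z / h" "Im z / h < of_int j0 + 1"
        by (auto simp: i0_def j0_def)
      then show ?thesis unfolding Qiff using h by (simp add: field_simps)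
    qed
    then have meets0: "meets i0 j0 \<noteq> 0" using z by (auto simp: meets_def)
    \<comment> \<open>\<open>z\<close> may lie on a grid line, but it is in the closure of an open
      square on which \<open>D\<close> vanishes, and \<open>D\<close> is continuous at
      \<open>z\<close>.\<close>
    have "D z = 0"
    proof (rule ccontr)
      assume "D z \<noteq> 0"
      then obtain e where e: "e > 0" "\<And>y. dist z y < e \<Longrightarrow> D y \<noteq> 0"
        using continuous_at_avoid[OF \<open>isCont D z\<close>, of 0] by auto
      have ne: "box (gp i0 j0) (gp (i0 + 1) (j0 + 1)) \<noteq> {}"
        using h by (simp add: box_ne_empty gp_def Basis_complex_def algebra_simps)
      have "z \<in> closure (box (gp i0 j0) (gp (i0 + 1) (j0 + 1)))"
        using zQ closure_box[OF ne] by (simp add: Q_def)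
      then obtain y where "y \<in> box (gp i0 j0) (gp (i0 + 1) (j0 + 1))" "dist y z < e"
        using e(1) unfolding closure_approachable by blast
      then show False using e(2)[of y] inner[OF f _ meets0, of y] by (simp add: D_def dist_commute)
    qed
    then show "f z = (\<Sum>x\<in>I. c x * contour_integral (linepath (a x) (b x)) (\<lambda>\<zeta>. f \<zeta> / (\<zeta> - z)))"
      by (simp add: D_def)
  qed
qed

theorem Runge_quadrature:
  assumes "compact K" "connected (- K)" "open V" "K \<subseteq> V"
  shows "quadrature K V (\<lambda>f z. f z)"
proof (rule Cauchy_grid_formula[OF assms(1,3,4)])
  fix I :: "(bool \<times> int \<times> int) set" and a b c
  assume I: "finite I"
    "\<And>i. i \<in> I \<Longrightarrow> closed_segment (a i) (b i) \<subseteq> V - K"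
    "\<And>f z. f holomorphic_on V \<Longrightarrow> z \<in> K \<Longrightarrow>
      f z = (\<Sum>i\<in>I. c i * contour_integral (linepath (a i) (b i)) (\<lambda>\<zeta>. f \<zeta> / (\<zeta> - z)))"
  show ?thesis
  proof (rule quadrature_cong)
    show "quadrature K V (\<lambda>f z. \<Sum>i\<in>I. c i * contour_integral (linepath (a i) (b i)) (\<lambda>\<zeta>. f \<zeta> / (\<zeta> - z)))"
      by (intro quadrature_sum[OF I(1)] quadrature_cmult quadrature_segment[OF assms(1-3)] I(2))
    show "f z = (\<Sum>i\<in>I. c i * contour_integral (linepath (a i) (b i)) (\<lambda>\<zeta>. f \<zeta> / (\<zeta> - z)))"
      if "f \<in> unit_hol V" "z \<in> K" for f z
      using that by (intro I(3)) (simp_all add: unit_hol_def)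
  qed
qed

section \<open>Separately holomorphic functions and partial derivatives\<close>

type_synonym ('r, 'd) cspace = "(complex ^ 'r) \<times> (complex ^ 'd)"

text \<open>A sum type as index set treats the \<open>w\<close>- and the \<open>z\<close>-variables
  alike, so that each one-variable argument is made once.\<close>

fun coord :: "'r + 'd \<Rightarrow> ('r::finite, 'd::finite) cspace \<Rightarrow> complex" where
  "coord (Inl i) x = fst x $ i"
| "coord (Inr j) x = snd x $ j"

fun upd_coord :: "'r + 'd \<Rightarrow> ('r::finite, 'd::finite) cspace \<Rightarrow> complex \<Rightarrow> ('r, 'd) cspace" where
  "upd_coord (Inl i) x t = (\<chi> j. if j = i then t else fst x $ j, snd x)"
| "upd_coord (Inr i) x t = (fst x, \<chi> j. if j = i then t else snd x $ j)"

definition coord_deriv :: "'r + 'd \<Rightarrow> (('r::finite, 'd::finite) cspace \<Rightarrow> complex) \<Rightarrow> ('r, 'd) cspace \<Rightarrow> complex"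
  where "coord_deriv c F x = deriv (\<lambda>t. F (upd_coord c x t)) (coord c x)"

text \<open>Continuity with holomorphy in each variable is the working notion of holomorphy: it
  reduces everything to slices of one complex variable. On open sets it agrees with
  \<open>mholomorphic_on\<close> by Osgood's lemma below.\<close>

definition sep_hol :: "('r::finite, 'd::finite) cspace set \<Rightarrow> (('r, 'd) cspace \<Rightarrow> complex) \<Rightarrow> bool"
  where "sep_hol S F \<longleftrightarrow> continuous_on S F \<and>
    (\<forall>x\<in>S. \<forall>c. (\<lambda>t. F (upd_coord c x t)) field_differentiable at (coord c x))"

lemma coord_upd_coord: "coord c (upd_coord c' x t) = (if c = c' then t else coord c x)"
  by (cases c; cases c') auto

lemma upd_coord_upd_coord [simp]: "upd_coord c (upd_coord c x t) s = upd_coord c x s"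
  by (cases c) (auto simp: vec_eq_iff)

lemma upd_coord_commute: "c \<noteq> c' \<Longrightarrow> upd_coord c (upd_coord c' x t) s = upd_coord c' (upd_coord c x s) t"
  by (cases c; cases c') (auto simp: vec_eq_iff)

lemma upd_coord_coord [simp]: "upd_coord c x (coord c x) = x"
  by (cases c) (auto simp: vec_eq_iff prod_eq_iff)

lemma cspace_eqI: "(\<And>c. coord c x = coord c y) \<Longrightarrow> x = y"
  by (metis coord.simps prod_eq_iff vec_eq_iff)

lemma coord_diff [simp]: "coord c (x - y) = coord c x - coord c y"
  by (cases c) auto

lemma norm_coord_le: "cmod (coord c x) \<le> norm x"
proof (cases c)
  case (Inl i)
  have "cmod (fst x $ i) \<le> norm (fst x)" by (rule Finite_Cartesian_Product.norm_nth_le)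
  also have "\<dots> \<le> norm x" by (metis norm_fst_le prod.collapse)
  finally show ?thesis using Inl by simp
next
  case (Inr i)
  have "cmod (snd x $ i) \<le> norm (snd x)" by (rule Finite_Cartesian_Product.norm_nth_le)
  also have "\<dots> \<le> norm x" by (metis norm_snd_le prod.collapse)
  finally show ?thesis using Inr by simp
qed

lemma norm_cspace_mono:
  assumes "\<And>c. cmod (coord c x) \<le> cmod (coord c y)"
  shows "norm x \<le> norm y"
proof -
  have "norm (fst x) \<le> norm (fst y)"
    unfolding norm_vec_def using assms[of "Inl _"] by (intro L2_set_mono) auto
  moreover have "norm (snd x) \<le> norm (snd y)"
    unfolding norm_vec_def using assms[of "Inr _"] by (intro L2_set_mono) auto
  ultimately show ?thesis
    unfolding norm_prod_def by (intro real_sqrt_le_mono add_mono power_mono) auto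
qed

lemma norm_cspace_le_sum: "norm x \<le> (\<Sum>c\<in>UNIV. cmod (coord c x))"
proof -
  have "norm x \<le> norm (fst x) + norm (snd x)"
    by (metis norm_Pair_le prod.collapse)
  also have "\<dots> \<le> (\<Sum>i\<in>UNIV. cmod (fst x $ i)) + (\<Sum>i\<in>UNIV. cmod (snd x $ i))"
    unfolding norm_vec_def by (intro add_mono L2_set_le_sum) auto
  also have "\<dots> = (\<Sum>c\<in>UNIV. cmod (coord c x))"
    by (simp add: UNIV_Plus_UNIV[symmetric] sum.Plus del: UNIV_Plus_UNIV)
  finally show ?thesis .
qed

lemma dist_upd_coord: "dist (upd_coord c x s) (upd_coord c x t) = dist s t"
proof (rule antisym)
  have "coord c' (upd_coord c x s - upd_coord c x t) = (if c' = c then s - t else 0)" for c'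
    by (simp add: coord_upd_coord)
  then have "(\<Sum>c'\<in>UNIV. cmod (coord c' (upd_coord c x s - upd_coord c x t))) = (\<Sum>c'\<in>UNIV. if c' = c then cmod (s - t) else 0)"
    by (intro sum.cong) auto
  then show "dist (upd_coord c x s) (upd_coord c x t) \<le> dist s t"
    using norm_cspace_le_sum[of "upd_coord c x s - upd_coord c x t"] by (simp add: dist_norm)
  show "dist s t \<le> dist (upd_coord c x s) (upd_coord c x t)"
    using norm_coord_le[of c "upd_coord c x s - upd_coord c x t"] by (simp add: dist_norm coord_upd_coord)
qed

lemma dist_upd_coord_self: "dist x (upd_coord c x t) = dist (coord c x) t"
  using dist_upd_coord[of c x "coord c x" t] by simp

lemma continuous_on_coord [continuous_intros]:
  "continuous_on S f \<Longrightarrow> continuous_on S (\<lambda>x. coord c (f x))"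
  by (cases c) (auto intro!: continuous_intros)

lemma continuous_on_upd_coord [continuous_intros]:
  assumes "continuous_on S f" "continuous_on S g"
  shows "continuous_on S (\<lambda>x. upd_coord c (f x) (g x))"
proof (cases c)
  case (Inl i)
  have "continuous_on S (\<lambda>x. if j = i then g x else fst (f x) $ j)" for j
    using assms by (cases "j = i") (auto intro!: continuous_intros)
  then show ?thesis unfolding Inl upd_coord.simps using assms by (intro continuous_intros) auto
next
  case (Inr i)
  have "continuous_on S (\<lambda>x. if j = i then g x else snd (f x) $ j)" for j
    using assms by (cases "j = i") (auto intro!: continuous_intros)
  then show ?thesis unfolding Inr upd_coord.simps using assms by (intro continuous_intros) auto
qed

lemma sep_hol_slice:
  assumes "sep_hol S F" "\<And>t. t \<in> T \<Longrightarrow> upd_coord c x t \<in> S"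
  shows "(\<lambda>t. F (upd_coord c x t)) holomorphic_on T"
proof (unfold holomorphic_on_def, rule ballI, rule field_differentiable_at_within)
  fix t assume "t \<in> T"
  then have "(\<lambda>s. F (upd_coord c (upd_coord c x t) s)) field_differentiable at (coord c (upd_coord c x t))"
    using assms(1)[unfolded sep_hol_def] assms(2)[of t] by blast
  then show "(\<lambda>t. F (upd_coord c x t)) field_differentiable at t" by (simp only: upd_coord_upd_coord coord_upd_coord if_True simp_thms)
qed

lemma sep_holI:
  assumes "open S" "continuous_on S F"
    "\<And>x c T. open T \<Longrightarrow> (\<And>t. t \<in> T \<Longrightarrow> upd_coord c x t \<in> S) \<Longrightarrow> (\<lambda>t. F (upd_coord c x t)) holomorphic_on T"
  shows "sep_hol S F"
  unfolding sep_hol_def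
proof (intro conjI ballI allI)
  fix x c assume "x \<in> S"
  then obtain e where e: "e > 0" "ball x e \<subseteq> S" using assms(1) by (auto elim: openE)
  have "(\<lambda>t. F (upd_coord c x t)) holomorphic_on ball (coord c x) e"
  proof (rule assms(3))
    show "upd_coord c x t \<in> S" if "t \<in> ball (coord c x) e" for t
      using that e(2) dist_upd_coord_self[of x c t] by auto
  qed simp
  then show "(\<lambda>t. F (upd_coord c x t)) field_differentiable at (coord c x)"
    using e(1) by (simp add: holomorphic_on_imp_differentiable_at)
qed (rule assms)

lemma sep_hol_subset: "sep_hol S F \<Longrightarrow> T \<subseteq> S \<Longrightarrow> sep_hol T F"
  unfolding sep_hol_def using continuous_on_subset by blast

lemma sep_hol_cong:
  assumes "sep_hol S F" "open S" "\<And>x. x \<in> S \<Longrightarrow> F x = G x"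
  shows "sep_hol S G"
proof (rule sep_holI[OF assms(2)])
  show "continuous_on S G" using assms unfolding sep_hol_def by (metis continuous_on_cong)
  show "(\<lambda>t. G (upd_coord c x t)) holomorphic_on T" if "\<And>t. t \<in> T \<Longrightarrow> upd_coord c x t \<in> S" for c x T
    using sep_hol_slice[OF assms(1) that] by (rule holomorphic_transform) (use that assms(3) in auto)
qed

lemma sep_hol_const [intro]: "sep_hol S (\<lambda>x. k)"
  unfolding sep_hol_def by simp

lemma sep_hol_add [intro]: "sep_hol S F \<Longrightarrow> sep_hol S G \<Longrightarrow> sep_hol S (\<lambda>x. F x + G x)"
  unfolding sep_hol_def by (auto intro!: continuous_intros derivative_intros)

lemma sep_hol_diff [intro]: "sep_hol S F \<Longrightarrow> sep_hol S G \<Longrightarrow> sep_hol S (\<lambda>x. F x - G x)"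
  unfolding sep_hol_def by (auto intro!: continuous_intros derivative_intros)

lemma sep_hol_mult [intro]: "sep_hol S F \<Longrightarrow> sep_hol S G \<Longrightarrow> sep_hol S (\<lambda>x. F x * G x)"
  unfolding sep_hol_def by (auto intro!: continuous_intros derivative_intros)

lemma sep_hol_sum [intro]: "(\<And>i. i \<in> I \<Longrightarrow> sep_hol S (F i)) \<Longrightarrow> sep_hol S (\<lambda>x. \<Sum>i\<in>I. F i x)"
  by (induction I rule: infinite_finite_induct) auto

lemma sep_hol_prod [intro]: "(\<And>i. i \<in> I \<Longrightarrow> sep_hol S (F i)) \<Longrightarrow> sep_hol S (\<lambda>x. \<Prod>i\<in>I. F i x)"
  by (induction I rule: infinite_finite_induct) auto

lemma sep_hol_power [intro]: "sep_hol S F \<Longrightarrow> sep_hol S (\<lambda>x. F x ^ n)"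
  by (induction n) auto

lemma sep_hol_coord [intro]: "sep_hol S (coord c)"
  unfolding sep_hol_def
proof (intro conjI ballI allI)
  show "continuous_on S (coord c)" by (intro continuous_intros)
  show "(\<lambda>t. coord c (upd_coord c' x t)) field_differentiable at (coord c' x)" for x c'
    by (cases "c = c'") (auto simp: coord_upd_coord)
qed

section \<open>First partial derivatives\<close>

lemma coord_deriv_cong:
  assumes "open S" "x \<in> S" "\<And>y. y \<in> S \<Longrightarrow> F y = G y"
  shows "coord_deriv c F x = coord_deriv c G x"
  unfolding coord_deriv_def
proof (rule deriv_cong_ev)
  obtain e where e: "e > 0" "ball x e \<subseteq> S" using assms(1,2) by (auto elim: openE)
  have "eventually (\<lambda>t. t \<in> ball (coord c x) e) (nhds (coord c x))"
    using e(1) by (intro eventually_nhds_in_open) auto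
  then show "eventually (\<lambda>t. F (upd_coord c x t) = G (upd_coord c x t)) (nhds (coord c x))"
  proof (rule eventually_mono)
    fix t assume "t \<in> ball (coord c x) e"
    then have "upd_coord c x t \<in> S" using e(2) dist_upd_coord_self[of x c t] by auto
    then show "F (upd_coord c x t) = G (upd_coord c x t)" by (rule assms(3))
  qed
qed simp

lemma coord_deriv_diff:
  assumes "sep_hol S F" "sep_hol S G" "x \<in> S"
  shows "coord_deriv c (\<lambda>x. F x - G x) x = coord_deriv c F x - coord_deriv c G x"
  using assms unfolding coord_deriv_def sep_hol_def by (intro deriv_diff) auto

lemma coord_deriv_add:
  assumes "sep_hol S F" "sep_hol S G" "x \<in> S"
  shows "coord_deriv c (\<lambda>x. F x + G x) x = coord_deriv c F x + coord_deriv c G x"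
  using assms unfolding coord_deriv_def sep_hol_def by (intro deriv_add) auto

lemma coord_deriv_cmult:
  assumes "sep_hol S F" "x \<in> S"
  shows "coord_deriv c (\<lambda>x. k * F x) x = k * coord_deriv c F x"
  using assms unfolding coord_deriv_def sep_hol_def by (intro deriv_cmult) auto

lemma coord_deriv_bound:
  assumes F: "sep_hol S F" and cb: "cball x \<rho> \<subseteq> S" "\<rho> > 0"
    and B: "\<And>y. y \<in> cball x \<rho> \<Longrightarrow> cmod (F y) \<le> B"
  shows "cmod (coord_deriv c F x) \<le> B / \<rho>"
proof -
  have mem: "upd_coord c x t \<in> cball x \<rho>" if "t \<in> cball (coord c x) \<rho>" for t
    using that dist_upd_coord_self[of x c t] by simp
  have "cmod ((deriv ^^ 1) (\<lambda>t. F (upd_coord c x t)) (coord c x)) \<le> fact 1 * B / \<rho> ^ 1"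
  proof (rule Cauchy_inequality)
    have "(\<lambda>t. F (upd_coord c x t)) holomorphic_on cball (coord c x) \<rho>"
      using mem cb(1) by (intro sep_hol_slice[OF F]) blast
    then show "(\<lambda>t. F (upd_coord c x t)) holomorphic_on ball (coord c x) \<rho>"
      "continuous_on (cball (coord c x) \<rho>) (\<lambda>t. F (upd_coord c x t))"
      by (auto intro: holomorphic_on_subset holomorphic_on_imp_continuous_on)
    show "cmod (F (upd_coord c x t)) \<le> B" if "cmod (coord c x - t) = \<rho>" for t
      using that by (intro B mem) (simp add: dist_norm)
  qed (rule cb)
  then show ?thesis unfolding coord_deriv_def by simp
qed

text \<open>Cauchy's inequality is applied to the difference of two parallel slices, which is
  uniformly small because \<open>F\<close> is uniformly continuous on a compact ball.\<close>

lemma continuous_on_coord_deriv: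
  assumes S: "open S" and F: "sep_hol S F"
  shows "continuous_on S (coord_deriv c F)"
  unfolding continuous_on_iff
proof (intro ballI allI impI)
  fix x and e :: real assume x: "x \<in> S" and e: "e > 0"
  obtain r where r: "r > 0" "cball x r \<subseteq> S" using S x by (meson open_contains_cball)
  \<comment> \<open>Half of \<open>r\<close>, since both the base point and the coordinate may move
    by \<rho>.\<close>
  define \<rho> where "\<rho> = r / 2"
  have \<rho>: "\<rho> > 0" using r by (simp add: \<rho>_def)
  have "uniformly_continuous_on (cball x r) F"
    using F r(2) unfolding sep_hol_def by (intro compact_uniformly_continuous) (auto elim: continuous_on_subset)
  moreover have "e * \<rho> / 2 > 0" using e \<rho> by simp
  ultimately obtain d where d: "d > 0"
      "\<And>y z. y \<in> cball x r \<Longrightarrow> z \<in> cball x r \<Longrightarrow> dist z y < d \<Longrightarrow> dist (F z) (F y) < e * \<rho> / 2"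
    unfolding uniformly_continuous_on_def by blast
  show "\<exists>d>0. \<forall>x'\<in>S. dist x' x < d \<longrightarrow> dist (coord_deriv c F x') (coord_deriv c F x) < e"
  proof (intro exI[of _ "min d \<rho>"] conjI ballI impI)
    show "min d \<rho> > 0" using d \<rho> by simp
    fix y assume y: "y \<in> S" "dist y x < min d \<rho>"
    \<comment> \<open>Both slices are shifted to centre 0, so the difference of the partial
      derivatives is the derivative of a single function there.\<close>
    define g where "g s = F (upd_coord c x (coord c x + s)) - F (upd_coord c y (coord c y + s))" for s
    have memx: "upd_coord c x (coord c x + s) \<in> cball x r" if "cmod s \<le> \<rho>" for s
      using dist_upd_coord_self[of x c "coord c x + s"] that \<rho> by (simp add: dist_norm \<rho>_def)
    have memy: "upd_coord c y (coord c y + s) \<in> cball x r" if "cmod s \<le> \<rho>" for s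
    proof -
      have "dist x (upd_coord c y (coord c y + s)) \<le> dist x y + dist y (upd_coord c y (coord c y + s))" by (rule dist_triangle)
      also have "\<dots> \<le> \<rho> + \<rho>" using y(2) that unfolding dist_upd_coord_self by (simp add: dist_norm norm_minus_commute)
      finally show ?thesis by (simp add: \<rho>_def)
    qed
    have hx: "(\<lambda>t. F (upd_coord c x t)) holomorphic_on cball (coord c x) \<rho>"
    proof (rule sep_hol_slice[OF F])
      fix t assume "t \<in> cball (coord c x) \<rho>"
      then show "upd_coord c x t \<in> S" using memx[of "t - coord c x"] r(2) by (auto simp: dist_norm norm_minus_commute)
    qed
    have hy: "(\<lambda>t. F (upd_coord c y t)) holomorphic_on cball (coord c y) \<rho>"
    proof (rule sep_hol_slice[OF F])
      fix t assume "t \<in> cball (coord c y) \<rho>"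
      then show "upd_coord c y t \<in> S" using memy[of "t - coord c y"] r(2) by (auto simp: dist_norm norm_minus_commute)
    qed
    have img: "(\<lambda>s. coord c z + s) ` cball 0 \<rho> \<subseteq> cball (coord c z) \<rho>" for z by (auto simp: dist_norm)
    have add: "(\<lambda>s. k + s) holomorphic_on cball 0 \<rho>" for k :: complex by (intro holomorphic_intros)
    have hg: "g holomorphic_on cball 0 \<rho>"
      unfolding g_def
      using holomorphic_on_compose_gen[OF add hx img, unfolded o_def] holomorphic_on_compose_gen[OF add hy img, unfolded o_def]
      by (rule holomorphic_on_diff)
    have "cmod ((deriv ^^ 1) g 0) \<le> fact 1 * (e * \<rho> / 2) / \<rho> ^ 1"
    proof (rule Cauchy_inequality)
      show "g holomorphic_on ball 0 \<rho>" "continuous_on (cball 0 \<rho>) g"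
        using hg by (auto intro: holomorphic_on_subset holomorphic_on_imp_continuous_on)
      fix s :: complex assume s: "cmod (0 - s) = \<rho>"
      have "dist (upd_coord c x (coord c x + s)) (upd_coord c y (coord c y + s)) \<le> dist x y"
        unfolding dist_norm by (rule norm_cspace_mono) (auto simp: coord_upd_coord)
      then have "dist (upd_coord c x (coord c x + s)) (upd_coord c y (coord c y + s)) < d" using y(2) by (simp add: dist_commute)
      then have "dist (F (upd_coord c x (coord c x + s))) (F (upd_coord c y (coord c y + s))) < e * \<rho> / 2"
        using s by (intro d(2) memx memy) auto
      then show "cmod (g s) \<le> e * \<rho> / 2" by (simp add: g_def dist_norm)
    qed (rule \<rho>)
    then have "cmod (deriv g 0) \<le> e / 2" using \<rho> by simp
    moreover have "deriv g 0 = coord_deriv c F x - coord_deriv c F y"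
    proof -
      have sh: "((\<lambda>s. F (upd_coord c z (coord c z + s))) has_field_derivative coord_deriv c F z) (at 0)" if "z \<in> S" for z
      proof -
        have "((\<lambda>t. F (upd_coord c z t)) has_field_derivative coord_deriv c F z) (at (0 + coord c z))"
          using F that unfolding sep_hol_def coord_deriv_def by (simp add: field_differentiable_derivI)
        then show ?thesis unfolding DERIV_shift by (simp add: add.commute)
      qed
      show ?thesis unfolding g_def by (intro DERIV_imp_deriv DERIV_diff sh x y)
    qed
    ultimately show "dist (coord_deriv c F y) (coord_deriv c F x) < e"
      using e by (simp add: dist_norm norm_minus_commute)
  qed
qed

text \<open>Taylor's formula of order one, with the second derivative bounded by Cauchy's inequality
  on discs of radius \<rho>/2: \<open>2 * B / (\<rho>/2)\<^sup>2\<close> is the constant. The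
  explicit rate makes difference quotients converge uniformly in a parameter.\<close>

lemma second_order_bound:
  assumes h: "h holomorphic_on cball a \<rho>" and \<rho>: "\<rho> > 0" and B: "\<And>t. t \<in> cball a \<rho> \<Longrightarrow> cmod (h t) \<le> B"
    and s: "s \<noteq> 0" "cmod s \<le> \<rho> / 2"
  shows "cmod ((h (a + s) - h a) / s - deriv h a) \<le> 8 * B / \<rho>\<^sup>2 * cmod s"
proof -
  define C where "C = cball a (\<rho> / 2)"
  define f where "f i = (deriv ^^ i) h" for i :: nat
  have hb: "h holomorphic_on ball a \<rho>" using h by (rule holomorphic_on_subset) auto
  have der: "(f i has_field_derivative f (Suc i) x) (at x within C)" if "x \<in> C" for i x
  proof -
    have "(deriv ^^ i) h holomorphic_on ball a \<rho>" using hb by (intro holomorphic_higher_deriv) auto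
    moreover have "x \<in> ball a \<rho>" using that \<rho> by (auto simp: C_def)
    ultimately have "((deriv ^^ i) h has_field_derivative deriv ((deriv ^^ i) h) x) (at x)"
      by (intro holomorphic_derivI) auto
    then show ?thesis by (simp add: f_def has_field_derivative_at_within)
  qed
  have bd: "cmod (f (Suc 1) x) \<le> 8 * B / \<rho>\<^sup>2" if x: "x \<in> C" for x
  proof -
    have sub: "cball x (\<rho>/2) \<subseteq> cball a \<rho>"
    proof
      fix y assume "y \<in> cball x (\<rho>/2)"
      then show "y \<in> cball a \<rho>" using x dist_triangle[of a y x] by (simp add: C_def)
    qed
    have "cmod ((deriv ^^ 2) h x) \<le> fact 2 * B / (\<rho>/2) ^ 2"
    proof (rule Cauchy_inequality)
      show "h holomorphic_on ball x (\<rho>/2)" "continuous_on (cball x (\<rho>/2)) h"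
        using holomorphic_on_subset[OF h sub] holomorphic_on_imp_continuous_on by (auto intro: holomorphic_on_subset)
      show "cmod (h y) \<le> B" if "cmod (x - y) = \<rho>/2" for y
        using that sub by (intro B) (auto simp: dist_norm subset_iff)
    qed (use \<rho> in simp)
    then show ?thesis by (simp add: f_def numeral_2_eq_2 power2_eq_square)
  qed
  have "cmod (f 0 (a + s) - (\<Sum>i\<le>1. f i a * (a + s - a) ^ i / fact i)) \<le> 8 * B / \<rho>\<^sup>2 * cmod (a + s - a) ^ Suc 1 / fact 1"
    by (rule complex_Taylor[of C]) (use der bd \<rho> s in \<open>auto simp: C_def dist_norm\<close>)
  then have "cmod (h (a + s) - h a - deriv h a * s) \<le> 8 * B / \<rho>\<^sup>2 * (cmod s)\<^sup>2"
    by (simp add: f_def algebra_simps power2_eq_square)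
  moreover have "(h (a + s) - h a) / s - deriv h a = (h (a + s) - h a - deriv h a * s) / s"
    using s(1) by (simp add: diff_divide_distrib)
  ultimately show ?thesis using s(1) by (simp add: norm_divide divide_le_eq power2_eq_square)
qed

text \<open>In the coordinate of differentiation this is the one-variable fact. In another
  coordinate the derivative is a uniform limit of difference quotients, each of which is holomorphic
  in that coordinate.\<close>

lemma sep_hol_coord_deriv:
  assumes S: "open S" and F: "sep_hol S F"
  shows "sep_hol S (coord_deriv c F)"
proof (rule sep_holI[OF S continuous_on_coord_deriv[OF S F]])
  fix x c' and T :: "complex set" assume T: "open T" "\<And>t. t \<in> T \<Longrightarrow> upd_coord c' x t \<in> S"
  show "(\<lambda>t. coord_deriv c F (upd_coord c' x t)) holomorphic_on T"
  proof (cases "c' = c")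
    case True
    have "(\<lambda>t. F (upd_coord c' x t)) holomorphic_on T" by (rule sep_hol_slice[OF F T(2)])
    then have "deriv (\<lambda>t. F (upd_coord c' x t)) holomorphic_on T" using T(1) by (rule holomorphic_deriv)
    moreover have "deriv (\<lambda>t. F (upd_coord c' x t)) = (\<lambda>t. coord_deriv c F (upd_coord c' x t))"
      by (auto simp: coord_deriv_def True coord_upd_coord)
    ultimately show ?thesis by simp
  next
    case False
    define a where "a = coord c x"
    have eq: "coord_deriv c F (upd_coord c' x t) = deriv (\<lambda>u. F (upd_coord c (upd_coord c' x t) u)) a" for t
      using False by (simp add: coord_deriv_def coord_upd_coord a_def)
    show ?thesis
      unfolding holomorphic_on_def
    proof (rule ballI, rule field_differentiable_at_within)
      fix t0 assume t0: "t0 \<in> T"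
      obtain r where r: "r > 0" "cball (upd_coord c' x t0) r \<subseteq> S" using S T(2)[OF t0] by (meson open_contains_cball)
      define \<rho> where "\<rho> = r / 2"
      have \<rho>: "\<rho> > 0" using r by (simp add: \<rho>_def)
      have "compact (F ` cball (upd_coord c' x t0) r)"
        using F r(2) unfolding sep_hol_def by (intro compact_continuous_image) (auto elim: continuous_on_subset)
      then obtain B where "\<forall>w\<in>F ` cball (upd_coord c' x t0) r. cmod w \<le> B"
        using compact_imp_bounded bounded_iff by blast
      then have B: "\<And>y. y \<in> cball (upd_coord c' x t0) r \<Longrightarrow> cmod (F y) \<le> B" by blast
      have mem: "upd_coord c (upd_coord c' x t) u \<in> cball (upd_coord c' x t0) r" if "t \<in> cball t0 \<rho>" "u \<in> cball a \<rho>" for t u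
      proof -
        have "dist (upd_coord c' x t0) (upd_coord c (upd_coord c' x t) u) \<le> dist (upd_coord c' x t0) (upd_coord c' x t) + dist (upd_coord c' x t) (upd_coord c (upd_coord c' x t) u)"
          by (rule dist_triangle)
        also have "\<dots> \<le> \<rho> + \<rho>"
          unfolding dist_upd_coord_self dist_upd_coord using that False by (auto simp: coord_upd_coord a_def)
        finally show ?thesis by (simp add: \<rho>_def)
      qed
      \<comment> \<open>Any null sequence of nonzero steps of modulus at most \<rho>/2 would serve;
        the bound on the steps is what the second-order estimate asks for.\<close>
      define st where "st n = complex_of_real (\<rho> / 2 / real (Suc n))" for n
      have st: "cmod (st n) = \<rho> / 2 * (1 / real (Suc n))" "st n \<noteq> 0" "cmod (st n) \<le> \<rho> / 2" for n
      proof -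
        show eq: "cmod (st n) = \<rho> / 2 * (1 / real (Suc n))" unfolding st_def norm_of_real using \<rho> by simp
        show "st n \<noteq> 0" using \<rho> by (simp only: st_def of_real_eq_0_iff) simp
        have "\<rho> / 2 * (1 / real (Suc n)) \<le> \<rho> / 2 * 1" using \<rho> by (intro mult_left_mono) simp_all
        then show "cmod (st n) \<le> \<rho> / 2" unfolding eq by simp
      qed
      define q where "q n t = (F (upd_coord c (upd_coord c' x t) (a + st n)) - F (upd_coord c (upd_coord c' x t) a)) / st n" for n t
      have slice1: "(\<lambda>t. F (upd_coord c (upd_coord c' x t) u)) holomorphic_on cball t0 \<rho>" if "u \<in> cball a \<rho>" for u
        unfolding upd_coord_commute[OF False[symmetric]]
        by (rule sep_hol_slice[OF F]) (use mem[OF _ that] r(2) upd_coord_commute[OF False[symmetric]] in \<open>metis subsetD\<close>)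
      have slice2: "(\<lambda>u. F (upd_coord c (upd_coord c' x t) u)) holomorphic_on cball a \<rho>" if "t \<in> cball t0 \<rho>" for t
        by (rule sep_hol_slice[OF F]) (use mem[OF that] r(2) in blast)
      have qhol: "q n holomorphic_on cball t0 \<rho>" for n
        unfolding q_def
      proof (intro holomorphic_intros slice1 st)
        show "a + st n \<in> cball a \<rho>" "a \<in> cball a \<rho>" using \<rho> st(3)[of n] by (auto simp: dist_norm)
      qed
      have qlim: "cmod (q n t - coord_deriv c F (upd_coord c' x t)) \<le> 4 * B / \<rho> * (1 / real (Suc n))" if t: "t \<in> cball t0 \<rho>" for n t
      proof -
        have "cmod (q n t - coord_deriv c F (upd_coord c' x t)) \<le> 8 * B / \<rho>\<^sup>2 * cmod (st n)"
          unfolding q_def eq by (rule second_order_bound[OF slice2[OF t] \<rho> B[OF mem[OF t]] st(2,3)])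
        also note st(1)
        also have "8 * B / \<rho>\<^sup>2 * (\<rho> / 2 * (1 / real (Suc n))) = 4 * B / \<rho> * (1 / real (Suc n))"
        proof -
          have "8 * B / \<rho>\<^sup>2 * (\<rho> / 2 * k) = 4 * B / \<rho> * k" for k
            using \<rho> by (simp add: power2_eq_square)
          then show ?thesis .
        qed
        finally show ?thesis .
      qed
      have "(\<lambda>n. 4 * B / \<rho> * (1 / real (Suc n))) \<longlonglongrightarrow> 4 * B / \<rho> * 0"
        by (intro tendsto_mult tendsto_const) (rule LIMSEQ_Suc[OF lim_1_over_n])
      then have "uniform_limit (cball t0 \<rho>) q (\<lambda>t. coord_deriv c F (upd_coord c' x t)) sequentially"
        unfolding uniform_limit_iff
      proof (intro allI impI)
        fix e :: real assume lim: "(\<lambda>n. 4 * B / \<rho> * (1 / real (Suc n))) \<longlonglongrightarrow> 4 * B / \<rho> * 0" and e: "e > 0"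
        have "\<forall>\<^sub>F n in sequentially. 4 * B / \<rho> * (1 / real (Suc n)) < e"
          using order_tendstoD(2)[OF lim, of e] e by simp
        then show "\<forall>\<^sub>F n in sequentially. \<forall>t\<in>cball t0 \<rho>. dist (q n t) (coord_deriv c F (upd_coord c' x t)) < e"
          by (rule eventually_mono) (auto simp: dist_norm intro: le_less_trans[OF qlim])
      qed
      then have "(\<lambda>t. coord_deriv c F (upd_coord c' x t)) holomorphic_on ball t0 \<rho>"
        by (rule holomorphic_uniform_limit[rotated])
          (simp_all add: holomorphic_on_imp_continuous_on[OF qhol] holomorphic_on_subset[OF qhol ball_subset_cball])
      then show "(\<lambda>t. coord_deriv c F (upd_coord c' x t)) field_differentiable at t0"
        using \<rho> by (simp add: holomorphic_on_imp_differentiable_at)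
    qed
  qed
qed

section \<open>Iterated partial derivatives along words\<close>

definition coord_derivs :: "('r + 'd) list \<Rightarrow> (('r::finite, 'd::finite) cspace \<Rightarrow> complex) \<Rightarrow> ('r, 'd) cspace \<Rightarrow> complex"
  where "coord_derivs cs F = foldr coord_deriv cs F"

lemma coord_derivs_simps [simp]: "coord_derivs [] F = F" "coord_derivs (c # cs) F = coord_deriv c (coord_derivs cs F)" "coord_derivs (cs @ ds) F = coord_derivs cs (coord_derivs ds F)"
  by (simp_all add: coord_derivs_def)

lemma sep_hol_coord_derivs: "open S \<Longrightarrow> sep_hol S F \<Longrightarrow> sep_hol S (coord_derivs cs F)"
  by (induction cs) (auto intro: sep_hol_coord_deriv)

lemma coord_derivs_cong:
  assumes "open S" "\<And>y. y \<in> S \<Longrightarrow> F y = G y" "x \<in> S"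
  shows "coord_derivs cs F x = coord_derivs cs G x"
  using assms(3)
proof (induction cs arbitrary: x)
  case (Cons c cs)
  show ?case unfolding coord_derivs_simps by (rule coord_deriv_cong[OF assms(1) Cons.prems Cons.IH])
qed (simp add: assms)

lemma coord_derivs_diff:
  assumes S: "open S" and FG: "sep_hol S F" "sep_hol S G" and x: "x \<in> S"
  shows "coord_derivs cs (\<lambda>x. F x - G x) x = coord_derivs cs F x - coord_derivs cs G x"
  using x
proof (induction cs arbitrary: x)
  case (Cons c cs)
  have "coord_derivs (c # cs) (\<lambda>x. F x - G x) x = coord_deriv c (\<lambda>x. coord_derivs cs F x - coord_derivs cs G x) x"
    unfolding coord_derivs_simps by (rule coord_deriv_cong[OF S Cons.prems Cons.IH])
  also have "\<dots> = coord_derivs (c # cs) F x - coord_derivs (c # cs) G x"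
    unfolding coord_derivs_simps by (intro coord_deriv_diff[of S] sep_hol_coord_derivs S FG Cons.prems)
  finally show ?case .
qed simp

lemma coord_derivs_add:
  assumes S: "open S" and FG: "sep_hol S F" "sep_hol S G" and x: "x \<in> S"
  shows "coord_derivs cs (\<lambda>x. F x + G x) x = coord_derivs cs F x + coord_derivs cs G x"
  using x
proof (induction cs arbitrary: x)
  case (Cons c cs)
  have "coord_derivs (c # cs) (\<lambda>x. F x + G x) x = coord_deriv c (\<lambda>x. coord_derivs cs F x + coord_derivs cs G x) x"
    unfolding coord_derivs_simps by (rule coord_deriv_cong[OF S Cons.prems Cons.IH])
  also have "\<dots> = coord_derivs (c # cs) F x + coord_derivs (c # cs) G x"
    unfolding coord_derivs_simps by (intro coord_deriv_add[of S] sep_hol_coord_derivs S FG Cons.prems)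
  finally show ?case .
qed simp

lemma coord_derivs_cmult:
  assumes S: "open S" and F: "sep_hol S F" and x: "x \<in> S"
  shows "coord_derivs cs (\<lambda>x. k * F x) x = k * coord_derivs cs F x"
  using x
proof (induction cs arbitrary: x)
  case (Cons c cs)
  have "coord_derivs (c # cs) (\<lambda>x. k * F x) x = coord_deriv c (\<lambda>x. k * coord_derivs cs F x) x"
    unfolding coord_derivs_simps by (rule coord_deriv_cong[OF S Cons.prems Cons.IH])
  also have "\<dots> = k * coord_derivs (c # cs) F x"
    unfolding coord_derivs_simps by (intro coord_deriv_cmult[of S] sep_hol_coord_derivs S F Cons.prems)
  finally show ?case .
qed simp

lemma coord_derivs_sum:
  assumes S: "open S" and F: "\<And>i. i \<in> I \<Longrightarrow> sep_hol S (F i)" and x: "x \<in> S"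
  shows "coord_derivs cs (\<lambda>x. \<Sum>i\<in>I. F i x) x = (\<Sum>i\<in>I. coord_derivs cs (F i) x)"
  using F
proof (induction I rule: infinite_finite_induct)
  case (insert i I)
  then show ?case using coord_derivs_add[OF S _ _ x, of "F i" "\<lambda>x. \<Sum>i\<in>I. F i x" cs] by auto
next
  \<comment> \<open>A sum over an infinite set is 0 by convention; the derivative of the zero
    function is obtained by scaling with 0.\<close>
  case (infinite I)
  then show ?case using coord_derivs_cmult[OF S sep_hol_const x, of cs 0 0] by simp
next
  case empty
  then show ?case using coord_derivs_cmult[OF S sep_hol_const x, of cs 0 0] by simp
qed

text \<open>Cauchy's inequality is iterated, half of the radius being spent on each letter. The
  constant depends on the radius and the word only, hence serves all functions, domains and
  points.\<close>

lemma coord_derivs_bound: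
  assumes "\<rho> > 0"
  obtains A where "A > 0" "\<And>(F :: ('r::finite, 'd::finite) cspace \<Rightarrow> complex) S x B. open S \<Longrightarrow> sep_hol S F \<Longrightarrow> cball x \<rho> \<subseteq> S \<Longrightarrow>
    (\<And>y. y \<in> cball x \<rho> \<Longrightarrow> cmod (F y) \<le> B) \<Longrightarrow> cmod (coord_derivs cs F x) \<le> A * B"
proof -
  have "\<exists>A>0. \<forall>(F :: ('r::finite, 'd::finite) cspace \<Rightarrow> complex) S x B. open S \<longrightarrow> sep_hol S F \<longrightarrow> cball x \<rho> \<subseteq> S \<longrightarrow>
    (\<forall>y\<in>cball x \<rho>. cmod (F y) \<le> B) \<longrightarrow> cmod (coord_derivs cs F x) \<le> A * B"
    using assms
  proof (induction cs arbitrary: \<rho>)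
    case Nil
    then show ?case by (intro exI[of _ 1]) auto
  next
    case (Cons c cs)
    then have "\<rho> / 2 > 0" by simp
    then obtain A where A: "A > 0" "\<And>(F :: ('r, 'd) cspace \<Rightarrow> complex) S x B. open S \<Longrightarrow> sep_hol S F \<Longrightarrow> cball x (\<rho>/2) \<subseteq> S \<Longrightarrow>
        \<forall>y\<in>cball x (\<rho>/2). cmod (F y) \<le> B \<Longrightarrow> cmod (coord_derivs cs F x) \<le> A * B"
      using Cons.IH by blast
    show ?case
    proof (intro exI[of _ "A * (2 / \<rho>)"] conjI allI impI)
      show "A * (2 / \<rho>) > 0" using A(1) Cons.prems by simp
      fix F :: "('r, 'd) cspace \<Rightarrow> complex" and S x B
      assume S: "open S" and F: "sep_hol S F" and sub: "cball x \<rho> \<subseteq> S" and B: "\<forall>y\<in>cball x \<rho>. cmod (F y) \<le> B"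
      have sub2: "cball y (\<rho>/2) \<subseteq> cball x \<rho>" if "y \<in> cball x (\<rho>/2)" for y
      proof
        fix z assume "z \<in> cball y (\<rho>/2)"
        then show "z \<in> cball x \<rho>" using that dist_triangle[of x z y] by simp
      qed
      have "cmod (coord_deriv c (coord_derivs cs F) x) \<le> (A * B) / (\<rho> / 2)"
      proof (rule coord_deriv_bound[OF sep_hol_coord_derivs[OF S F]])
        show "cball x (\<rho> / 2) \<subseteq> S" using sub2[of x] sub Cons.prems by auto
        fix y assume y: "y \<in> cball x (\<rho> / 2)"
        show "cmod (coord_derivs cs F y) \<le> A * B"
          by (rule A(2)[OF S F]) (use sub2[OF y] sub B in blast)+
      qed (use Cons.prems in simp)
      then show "cmod (coord_derivs (c # cs) F x) \<le> A * (2 / \<rho>) * B" by (simp add: mult_ac)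
    qed
  qed
  then obtain A where A: "A > 0" "\<forall>(F :: ('r::finite, 'd::finite) cspace \<Rightarrow> complex) S x B. open S \<longrightarrow> sep_hol S F \<longrightarrow> cball x \<rho> \<subseteq> S \<longrightarrow>
    (\<forall>y\<in>cball x \<rho>. cmod (F y) \<le> B) \<longrightarrow> cmod (coord_derivs cs F x) \<le> A * B"
    by (elim exE conjE) rule
  show thesis by (rule that[OF A(1) A(2)[rule_format]])
qed

text \<open>A slice is the composition with a complex affine line, so the chain rule applies, and
  complex linearity of the Frechet derivative turns its restriction to the line into multiplication
  by a number.\<close>

lemma mholomorphic_imp_sep_hol:
  assumes "F mholomorphic_on S"
  shows "sep_hol S F"
  unfolding sep_hol_def
proof (intro conjI ballI allI)
  show "continuous_on S F"
    using assms has_derivative_continuous unfolding mholomorphic_on_def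
    by (blast intro: continuous_at_imp_continuous_on)
  fix x c assume "x \<in> S"
  then obtain F' where F': "(F has_derivative F') (at x)" "\<And>k v w. F' (k *s v, k *s w) = k * F' (v, w)"
    using assms unfolding mholomorphic_on_def by blast
  obtain e where e: "\<And>t. upd_coord c x t = x + ((t - coord c x) *s fst e, (t - coord c x) *s snd e)"
  proof (cases c)
    case (Inl i)
    then show thesis by (intro that[of "(axis i 1, 0)"]) (auto simp: vec_eq_iff axis_def prod_eq_iff)
  next
    case (Inr i)
    then show thesis by (intro that[of "(0, axis i 1)"]) (auto simp: vec_eq_iff axis_def prod_eq_iff)
  qed
  have lin: "bounded_linear (\<lambda>h::complex. (h *s fst e, h *s snd e))"
    by (intro bounded_linear_Pair linear_conv_bounded_linear[THEN iffD1]) (auto intro!: linearI simp: vec_eq_iff algebra_simps)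
  have "((\<lambda>t. ((t - coord c x) *s fst e, (t - coord c x) *s snd e)) has_derivative (\<lambda>h. (h *s fst e, h *s snd e))) (at (coord c x))"
    by (rule bounded_linear.has_derivative[OF lin]) (auto intro!: derivative_eq_intros)
  then have "((\<lambda>t. upd_coord c x t) has_derivative (\<lambda>h. (h *s fst e, h *s snd e))) (at (coord c x))"
    unfolding e using has_derivative_add[OF has_derivative_const] by fastforce
  moreover have "(F has_derivative F') (at (upd_coord c x (coord c x)))" using F'(1) by simp
  ultimately have "((\<lambda>t. F (upd_coord c x t)) has_derivative (\<lambda>h. F' (h *s fst e, h *s snd e))) (at (coord c x))"
    by (rule has_derivative_compose)
  then have "((\<lambda>t. F (upd_coord c x t)) has_derivative (\<lambda>h. F' (fst e, snd e) * h)) (at (coord c x))"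
    by (simp only: F'(2) mult.commute)
  then show "(\<lambda>t. F (upd_coord c x t)) field_differentiable at (coord c x)"
    unfolding field_differentiable_def has_field_derivative_def by blast
qed

text \<open>Osgood's lemma: the increment is telescoped along the coordinates, and each slice is controlled by
  the continuity of the partial derivatives.\<close>

lemma sep_hol_imp_mholomorphic:
  fixes F :: "('r::finite, 'd::finite) cspace \<Rightarrow> complex"
  assumes S: "open S" and F: "sep_hol S F"
  shows "F mholomorphic_on S"
  unfolding mholomorphic_on_def
proof
  fix x assume x: "x \<in> S"
  define F' where "F' h = (\<Sum>c\<in>UNIV. coord_deriv c F x * coord c h)" for h
  have est: "\<exists>d>0. \<forall>y. norm (y - x) < d \<longrightarrow> cmod (F y - F x - F' (y - x)) \<le> e * norm (y - x)" if e: "e > 0" for e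
  proof -
    define m where "m = real CARD('r + 'd)"
    have m: "m > 0" unfolding m_def by (simp only: of_nat_0_less_iff zero_less_card_finite)
    \<comment> \<open>One share of the error for each of the \<open>m\<close> coordinates along
      which the increment is telescoped.\<close>
    define e' where "e' = e / m"
    have e': "e' > 0" using e m by (simp add: e'_def)
    obtain r where r: "r > 0" "ball x r \<subseteq> S" using S x by (auto elim: openE)
    have "\<forall>c. \<exists>d>0. \<forall>y\<in>S. dist y x < d \<longrightarrow> dist (coord_deriv c F y) (coord_deriv c F x) < e'"
      using continuous_on_coord_deriv[OF S F] x e' unfolding continuous_on_iff by blast
    then obtain D where D: "\<And>c. D c > 0" "\<And>c y. y \<in> S \<Longrightarrow> dist y x < D c \<Longrightarrow> dist (coord_deriv c F y) (coord_deriv c F x) < e'"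
      by metis
    define d where "d = min r (Min (range D))"
    have d: "d > 0" "d \<le> r" "\<And>c. d \<le> D c"
      using r D(1) by (auto simp: d_def min_le_iff_disj)
    \<comment> \<open>Induction on the set of coordinates in which \<open>y\<close> may differ from
      \<open>x\<close>. Resetting one of them to its value in \<open>x\<close> does not increase the
      distance to \<open>x\<close>, so all intermediate points stay in the ball.\<close>
    have step: "cmod (F y - F x - (\<Sum>c\<in>A. coord_deriv c F x * coord c (y - x))) \<le> real (card A) * (e' * norm (y - x))"
      if "finite A" "norm (y - x) < d" "\<And>c. c \<notin> A \<Longrightarrow> coord c y = coord c x" for A y
      using that
    proof (induction A arbitrary: y)
      case empty
      then have "y = x" by (intro cspace_eqI) auto
      then show ?case by simp
    next
      case (insert c A)
      define y' where "y' = upd_coord c y (coord c x)"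
      have le: "norm (y' - x) \<le> norm (y - x)"
        by (rule norm_cspace_mono) (simp add: y'_def coord_upd_coord)
      have "cmod (F y' - F x - (\<Sum>c\<in>A. coord_deriv c F x * coord c (y' - x))) \<le> real (card A) * (e' * norm (y' - x))"
        by (rule insert.IH) (use insert.prems le in \<open>auto simp: y'_def coord_upd_coord\<close>)
      also have "\<dots> \<le> real (card A) * (e' * norm (y - x))"
        using le e' by (intro mult_left_mono) auto
      finally have 1: "cmod (F y' - F x - (\<Sum>c\<in>A. coord_deriv c F x * coord c (y' - x))) \<le> real (card A) * (e' * norm (y - x))" .
      have eqs: "(\<Sum>c\<in>A. coord_deriv c F x * coord c (y' - x)) = (\<Sum>c\<in>A. coord_deriv c F x * coord c (y - x))"
        using insert.hyps by (intro sum.cong) (auto simp: y'_def coord_upd_coord)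
      define T where "T = closed_segment (coord c x) (coord c y)"
      have mem: "norm (upd_coord c y t - x) < d" if "t \<in> T" for t
      proof -
        have "norm (upd_coord c y t - x) \<le> norm (y - x)"
        proof (rule norm_cspace_mono)
          fix c'
          have "cmod (t - coord c x) \<le> cmod (coord c y - coord c x)"
            using segment_bound(1)[of t "coord c x" "coord c y"] that by (simp add: T_def)
          then show "cmod (coord c' (upd_coord c y t - x)) \<le> cmod (coord c' (y - x))" by (simp add: coord_upd_coord)
        qed
        then show ?thesis using insert.prems(1) by simp
      qed
      have memS: "upd_coord c y t \<in> S" if "t \<in> T" for t
      proof -
        have "upd_coord c y t \<in> ball x r" using mem[OF that] d(2) by (simp add: dist_norm norm_minus_commute)
        then show ?thesis using r(2) by blast
      qed
      \<comment> \<open>After subtraction of the linear term, the derivative of \<open>g\<close> is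
        the change of one partial derivative, which is at most \<open>e'\<close>.\<close>
      define g where "g t = F (upd_coord c y t) - coord_deriv c F x * t" for t
      have "cmod (g (coord c y) - g (coord c x)) \<le> e' * cmod (coord c y - coord c x)"
      proof (rule field_differentiable_bound)
        fix t assume t: "t \<in> T"
        have "(\<lambda>u. F (upd_coord c (upd_coord c y t) u)) field_differentiable at (coord c (upd_coord c y t))"
          using F memS[OF t] unfolding sep_hol_def by blast
        then have "((\<lambda>u. F (upd_coord c (upd_coord c y t) u)) has_field_derivative coord_deriv c F (upd_coord c y t)) (at (coord c (upd_coord c y t)))"
          unfolding coord_deriv_def by (rule field_differentiable_derivI)
        then have "((\<lambda>u. F (upd_coord c y u)) has_field_derivative coord_deriv c F (upd_coord c y t)) (at t within T)"
          by (simp add: coord_upd_coord has_field_derivative_at_within)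
        then show "(g has_field_derivative (coord_deriv c F (upd_coord c y t) - coord_deriv c F x)) (at t within T)"
          unfolding g_def by (auto intro!: derivative_eq_intros)
        show "cmod (coord_deriv c F (upd_coord c y t) - coord_deriv c F x) \<le> e'"
          using D(2)[OF memS[OF t], of c] mem[OF t] d(3)[of c] by (simp add: dist_norm)
      qed (simp_all add: T_def)
      also have "\<dots> \<le> e' * norm (y - x)"
        using norm_coord_le[of c "y - x"] e' by (intro mult_left_mono) auto
      finally have 2: "cmod (g (coord c y) - g (coord c x)) \<le> e' * norm (y - x)" .
      have "F y - F x - (\<Sum>c\<in>insert c A. coord_deriv c F x * coord c (y - x))
          = (F y' - F x - (\<Sum>c\<in>A. coord_deriv c F x * coord c (y' - x))) + (g (coord c y) - g (coord c x))"
        unfolding eqs using insert.hyps by (simp add: g_def y'_def algebra_simps)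
      then have "cmod (F y - F x - (\<Sum>c\<in>insert c A. coord_deriv c F x * coord c (y - x)))
          \<le> real (card A) * (e' * norm (y - x)) + e' * norm (y - x)"
        using norm_triangle_mono[OF 1 2] by (simp only:)
      also have "\<dots> = real (card (insert c A)) * (e' * norm (y - x))"
        using insert.hyps by (simp add: distrib_right)
      finally show ?case .
    qed
    have "cmod (F y - F x - F' (y - x)) \<le> e * norm (y - x)" if "norm (y - x) < d" for y
      using step[of UNIV y, folded m_def] that m unfolding F'_def e'_def by simp
    then show ?thesis using d(1) by blast
  qed
  have "bounded_linear F'"
    unfolding F'_def
  proof (intro bounded_linear_sum bounded_linear_const_mult)
    show "bounded_linear (coord c :: ('r, 'd) cspace \<Rightarrow> complex)" for c
    proof (rule bounded_linear_intro[where K = 1])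
      show "coord c (r *\<^sub>R x) = r *\<^sub>R coord c x" "coord c (x + y) = coord c x + coord c y" for r and x y :: "('r, 'd) cspace"
        by (cases c; simp)+
      show "cmod (coord c x) \<le> norm x * 1" for x :: "('r, 'd) cspace" using norm_coord_le by simp
    qed
  qed
  then have "(F has_derivative F') (at x)"
    unfolding has_derivative_within_alt using est by auto
  moreover have "coord c (k *s v, k *s w) = k * coord c (v, w)" for c k and v :: "complex ^ 'r" and w :: "complex ^ 'd"
    by (cases c) auto
  then have "F' (k *s v, k *s w) = k * F' (v, w)" for k v w
    unfolding F'_def by (simp add: sum_distrib_left mult_ac)
  ultimately show "\<exists>f'. (F has_derivative f') (at x) \<and> (\<forall>c v w. f' (c *s v, c *s w) = c * f' (v, w))"
    by blast
qed

section \<open>Partial sums of Taylor expansions\<close>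

text \<open>Flattening the multi-index in the order of \<open>coord_list\<close> turns a mixed
  partial derivative into one fold, so inductions run over a list and no interchange of derivatives
  is called for.\<close>

definition word :: "nat ^ 'n::finite \<Rightarrow> 'n list"
  where "word m = concat (map (\<lambda>i. replicate (m $ i) i) coord_list)"

lemma mixed_partial_word: "mixed_partial m f = foldr partial_deriv (word m) f"
proof -
  have rep: "foldr partial_deriv (replicate n i) g = (partial_deriv i ^^ n) g" for n and i :: 'a and g
    by (induction n) auto
  have "foldr (\<lambda>i g. (partial_deriv i ^^ (m $ i)) g) is f = foldr partial_deriv (concat (map (\<lambda>i. replicate (m $ i) i) is)) f" for "is"
    by (induction "is") (auto simp: rep)
  then show ?thesis by (simp add: mixed_partial_def word_def)
qed

lemma foldr_partial_deriv_fst: "foldr partial_deriv is (\<lambda>w. F (w, z)) w = coord_derivs (map Inl is) F (w, z)"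
proof (induction "is" arbitrary: w)
  case (Cons i "is")
  then have eq: "foldr partial_deriv is (\<lambda>w. F (w, z)) = (\<lambda>w. coord_derivs (map Inl is) F (w, z))" by blast
  have "foldr partial_deriv (i # is) (\<lambda>w. F (w, z)) w = partial_deriv i (\<lambda>w. coord_derivs (map Inl is) F (w, z)) w"
    by (simp only: foldr.simps o_def eq)
  also have "\<dots> = coord_derivs (map Inl (i # is)) F (w, z)"
    by (simp add: partial_deriv_def coord_deriv_def cong: if_cong)
  finally show ?case .
qed simp

lemma foldr_partial_deriv_snd: "foldr partial_deriv is (\<lambda>z. F (w, z)) z = coord_derivs (map Inr is) F (w, z)"
proof (induction "is" arbitrary: z)
  case (Cons i "is")
  then have eq: "foldr partial_deriv is (\<lambda>z. F (w, z)) = (\<lambda>z. coord_derivs (map Inr is) F (w, z))" by blast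
  have "foldr partial_deriv (i # is) (\<lambda>z. F (w, z)) z = partial_deriv i (\<lambda>z. coord_derivs (map Inr is) F (w, z)) z"
    by (simp only: foldr.simps o_def eq)
  also have "\<dots> = coord_derivs (map Inr (i # is)) F (w, z)"
    by (simp add: partial_deriv_def coord_deriv_def cong: if_cong)
  finally show ?case .
qed simp

definition op_word :: "nat ^ 'r::finite \<Rightarrow> nat ^ 'd::finite \<Rightarrow> ('r + 'd) list"
  where "op_word a b = map Inl (word a) @ map Inr (word b)"

lemma mixed_diff_op_eq_coord_derivs: "mixed_diff_op a b F x = coord_derivs (op_word a b) F x"
proof (cases x)
  case (Pair w z)
  have "mixed_diff_op a b F (w, z) = foldr partial_deriv (word a) (\<lambda>w'. coord_derivs (map Inr (word b)) F (w', z)) w"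
    by (simp add: mixed_diff_op_def mixed_partial_word foldr_partial_deriv_snd)
  then show ?thesis by (simp add: Pair foldr_partial_deriv_fst op_word_def)
qed

lemma taylor_coeff_eq_coord_derivs:
  "taylor_coeff m f w \<zeta> = 1 / (\<Prod>i\<in>UNIV. fact (m $ i)) * coord_derivs (map Inr (word m)) f (w, \<zeta>)"
  by (simp add: taylor_coeff_def mixed_partial_word foldr_partial_deriv_snd)

text \<open>With the centre frozen, a Taylor coefficient depends on \<open>w\<close> alone. Partial
  sums are therefore holomorphic for all \<open>z\<close>, although \<open>f\<close> is only given
  over \<open>Om\<close>; over \<open>K\<close> this is indispensable.\<close>

lemma sep_hol_fix_snd:
  fixes G :: "(complex ^ 'r::finite) set" and Om :: "(complex ^ 'd::finite) set"
  assumes G: "open G" and T: "sep_hol (G \<times> Om) T" and \<zeta>: "\<zeta> \<in> Om"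
  shows "sep_hol (G \<times> (UNIV :: (complex ^ 'd) set)) (\<lambda>x. T (fst x, \<zeta>))"
proof (rule sep_holI)
  show "open (G \<times> (UNIV :: (complex ^ 'd) set))" using G by (simp add: open_Times)
  have "continuous_on (G \<times> Om) T" using T by (simp add: sep_hol_def)
  then show "continuous_on (G \<times> UNIV) (\<lambda>x. T (fst x, \<zeta>))"
    by (rule continuous_on_compose2) (use \<zeta> in \<open>auto intro!: continuous_intros\<close>)
  fix x :: "('r, 'd) cspace" and c and D :: "complex set"
  assume D: "\<And>t. t \<in> D \<Longrightarrow> upd_coord c x t \<in> G \<times> UNIV"
  show "(\<lambda>t. T (fst (upd_coord c x t), \<zeta>)) holomorphic_on D"
  proof (cases c)
    case (Inl i)
    have "(\<lambda>t. T (upd_coord (Inl i) (fst x, \<zeta>) t)) holomorphic_on D"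
    proof (rule sep_hol_slice[OF T])
      fix t assume "t \<in> D"
      then show "upd_coord (Inl i) (fst x, \<zeta>) t \<in> G \<times> Om" using D[of t] \<zeta> by (simp add: Inl cong: if_cong)
    qed
    then show ?thesis by (simp add: Inl cong: if_cong)
  next
    case (Inr j)
    then show ?thesis by simp
  qed
qed

lemma sep_hol_vpower_snd: "sep_hol S (\<lambda>x. vpower (snd x - \<zeta>) m)"
proof -
  have "sep_hol S (\<lambda>x. \<Prod>i\<in>UNIV. (coord (Inr i) x - \<zeta> $ i) ^ (m $ i))"
    by (intro sep_hol_prod sep_hol_power sep_hol_diff sep_hol_coord sep_hol_const)
  then show ?thesis by (simp add: vpower_def)
qed

lemma sep_hol_partial_sum:
  assumes "open G" "open Om" "sep_hol (G \<times> Om) f" "\<zeta> \<in> Om"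
  shows "sep_hol (G \<times> UNIV) (\<lambda>x. partial_sum N n f (fst x) \<zeta> (snd x))"
  unfolding partial_sum_def taylor_coeff_eq_coord_derivs
  by (intro sep_hol_sum sep_hol_mult sep_hol_const sep_hol_vpower_snd sep_hol_fix_snd[OF assms(1) _ assms(4)] sep_hol_coord_derivs open_Times assms)

lemma partial_sum_diff:
  assumes "open S" "sep_hol S f" "sep_hol S g" "(w, \<zeta>) \<in> S"
  shows "partial_sum N n (\<lambda>x. f x - g x) w \<zeta> z = partial_sum N n f w \<zeta> z - partial_sum N n g w \<zeta> z"
  unfolding partial_sum_def taylor_coeff_eq_coord_derivs
  by (simp add: coord_derivs_diff[OF assms] algebra_simps sum_subtractf)

lemma partial_sum_add:
  assumes "open S" "sep_hol S f" "sep_hol S g" "(w, \<zeta>) \<in> S"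
  shows "partial_sum N n (\<lambda>x. f x + g x) w \<zeta> z = partial_sum N n f w \<zeta> z + partial_sum N n g w \<zeta> z"
  unfolding partial_sum_def taylor_coeff_eq_coord_derivs
  by (simp add: coord_derivs_add[OF assms] algebra_simps sum.distrib)

lemma partial_sum_cmult:
  assumes "open S" "sep_hol S f" "(w, \<zeta>) \<in> S"
  shows "partial_sum N n (\<lambda>x. k * f x) w \<zeta> z = k * partial_sum N n f w \<zeta> z"
  unfolding partial_sum_def taylor_coeff_eq_coord_derivs
  by (simp add: coord_derivs_cmult[OF assms] sum_distrib_left mult_ac)

section \<open>Continuity of a partial sum in the function\<close>

lemma compact_thickening:
  fixes L :: "'a::euclidean_space set"
  assumes "compact L" "open G" "L \<subseteq> G"
  obtains \<rho> T where "\<rho> > 0" "compact T" "T \<subseteq> G" "\<And>y. y \<in> L \<Longrightarrow> cball y \<rho> \<subseteq> T"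
proof -
  obtain \<rho> where \<rho>: "\<rho> > 0" "(\<Union>y\<in>L. cball y \<rho>) \<subseteq> G"
    using compact_subset_open_imp_cball_epsilon_subset[OF assms] by blast
  have eq: "(\<Union>y\<in>L. cball y \<rho>) = {x + y | x y. x \<in> L \<and> y \<in> cball 0 \<rho>}"
  proof (intro set_eqI iffI)
    fix v assume "v \<in> (\<Union>y\<in>L. cball y \<rho>)"
    then obtain y where y: "y \<in> L" "dist y v \<le> \<rho>" by auto
    then have "v = y + (v - y)" "v - y \<in> cball 0 \<rho>" by (simp_all add: dist_norm norm_minus_commute)
    then show "v \<in> {x + y | x y. x \<in> L \<and> y \<in> cball 0 \<rho>}" using y(1) by blast
  next
    fix v assume "v \<in> {x + y | x y. x \<in> L \<and> y \<in> cball 0 \<rho>}"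
    then obtain x y where "v = x + y" "x \<in> L" "y \<in> cball 0 \<rho>" by blast
    then show "v \<in> (\<Union>y\<in>L. cball y \<rho>)" by (intro UN_I[of x]) (simp_all add: dist_norm)
  qed
  have "compact (\<Union>y\<in>L. cball y \<rho>)"
    unfolding eq by (rule compact_sums[OF assms(1) compact_cball])
  then show thesis using \<rho> by (intro that[of \<rho> "\<Union>y\<in>L. cball y \<rho>"]) auto
qed

lemma cball_Times_subset: "cball (w, z) \<rho> \<subseteq> cball w \<rho> \<times> cball z \<rho>"
proof
  fix x assume "x \<in> cball (w, z) \<rho>"
  then show "x \<in> cball w \<rho> \<times> cball z \<rho>"
    using dist_fst_le[of "(w, z)" x] dist_snd_le[of "(w, z)" x] by (cases x) auto
qed

text \<open>Expresses that the linear map from \<open>f\<close> to the derivatives of its n-th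
  partial sum is continuous, uniformly in the centre. Both \<open>C\<close> and \<open>A\<close> may
  depend on \<open>n\<close>, which is harmless since each test fixes one order.\<close>

definition partial_sum_bounded ::
    "(complex ^ 'r::finite) set \<Rightarrow> (complex ^ 'd::finite) set \<Rightarrow> (complex ^ 'r) set \<Rightarrow> (complex ^ 'd) set \<Rightarrow> (complex ^ 'd) set \<Rightarrow>
     (nat \<Rightarrow> nat ^ 'd) \<Rightarrow> nat \<Rightarrow> ('r + 'd) list set \<Rightarrow> ('r, 'd) cspace set \<Rightarrow> real \<Rightarrow> bool"
  where "partial_sum_bounded G Om L M K N n W C A \<longleftrightarrow> compact C \<and> C \<subseteq> G \<times> Om \<and> A > 0 \<and>
    (\<forall>f B. sep_hol (G \<times> Om) f \<longrightarrow> B \<ge> 0 \<longrightarrow> (\<forall>x\<in>C. cmod (f x) \<le> B) \<longrightarrow>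
     (\<forall>\<zeta>\<in>M. \<forall>w\<in>L. \<forall>z\<in>K. \<forall>cs\<in>W. cmod (coord_derivs cs (\<lambda>x. partial_sum N n f (fst x) \<zeta> (snd x)) (w, z)) \<le> A * B))"

lemma partial_sum_boundedD:
  assumes "partial_sum_bounded G Om L M K N n W C A" "sep_hol (G \<times> Om) f" "B \<ge> 0" "\<And>x. x \<in> C \<Longrightarrow> cmod (f x) \<le> B"
    "\<zeta> \<in> M" "w \<in> L" "z \<in> K" "cs \<in> W"
  shows "cmod (coord_derivs cs (\<lambda>x. partial_sum N n f (fst x) \<zeta> (snd x)) (w, z)) \<le> A * B"
  using assms unfolding partial_sum_bounded_def by simp

text \<open>Cauchy's inequality enters twice: at the centres it bounds the Taylor coefficients by
  \<open>f\<close> on \<open>C\<close>, and at points over \<open>L\<close> and \<open>K\<close> it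
  bounds the outer derivatives by values of the partial sum on the larger set
  \<open>L1 \<times> K1\<close>.\<close>

lemma partial_sum_bounded_single:
  fixes G :: "(complex ^ 'r::finite) set" and Om :: "(complex ^ 'd::finite) set"
  assumes G: "open G" and Om: "open Om" and L: "compact L" "L \<subseteq> G" and M: "compact M" "M \<subseteq> Om" and K: "compact K"
  shows "\<exists>C A. partial_sum_bounded G Om L M K N n {cs} C A"
proof -
  obtain r1 L1 where L1: "r1 > 0" "compact L1" "L1 \<subseteq> G" "\<And>y. y \<in> L \<Longrightarrow> cball y r1 \<subseteq> L1"
    using compact_thickening[OF L(1) G L(2)] by metis
  obtain r2 K1 where K1: "r2 > 0" "compact K1" "\<And>y. y \<in> K \<Longrightarrow> cball y r2 \<subseteq> K1"
    using compact_thickening[OF K open_UNIV subset_UNIV] by metis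
  have LM: "compact (L1 \<times> M)" "open (G \<times> Om)" "L1 \<times> M \<subseteq> G \<times> Om"
    using L1 M G Om by (auto intro: compact_Times open_Times)
  obtain r3 C where C: "r3 > 0" "compact C" "C \<subseteq> G \<times> Om" "\<And>y. y \<in> L1 \<times> M \<Longrightarrow> cball y r3 \<subseteq> C"
    using compact_thickening[OF LM] by metis
  have "\<exists>A>0. \<forall>f B. sep_hol (G \<times> Om) f \<longrightarrow> (\<forall>x\<in>C. cmod (f x) \<le> B) \<longrightarrow>
      (\<forall>w\<in>L1. \<forall>\<zeta>\<in>M. cmod (taylor_coeff (N k) f w \<zeta>) \<le> A * B)" for k
  proof -
    obtain A where A: "A > 0" "\<And>(F :: ('r, 'd) cspace \<Rightarrow> complex) S x B. open S \<Longrightarrow> sep_hol S F \<Longrightarrow> cball x r3 \<subseteq> S \<Longrightarrow>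
      (\<And>y. y \<in> cball x r3 \<Longrightarrow> cmod (F y) \<le> B) \<Longrightarrow> cmod (coord_derivs (map Inr (word (N k))) F x) \<le> A * B"
      using coord_derivs_bound[OF C(1), of "map Inr (word (N k))"] by blast
    define q where "q = cmod (1 / (\<Prod>i\<in>UNIV. fact (N k $ i)))"
    have q: "q > 0" by (simp add: q_def)
    show ?thesis
    proof (intro exI[of _ "q * A"] conjI allI impI ballI)
      show "q * A > 0" using q A by simp
      fix f B w \<zeta> assume f: "sep_hol (G \<times> Om) f" and B: "\<forall>x\<in>C. cmod (f x) \<le> B" and w: "w \<in> L1" "\<zeta> \<in> M"
      have "cball (w, \<zeta>) r3 \<subseteq> C" using C(4) w by blast
      then have "cmod (coord_derivs (map Inr (word (N k))) f (w, \<zeta>)) \<le> A * B"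
        using A(2)[OF LM(2) f, of "(w, \<zeta>)" B] C(3) B by blast
      then show "cmod (taylor_coeff (N k) f w \<zeta>) \<le> q * A * B"
        unfolding taylor_coeff_eq_coord_derivs norm_mult q_def[symmetric] using q by (simp add: mult.assoc)
    qed
  qed
  then obtain A where A: "\<And>k. A k > 0" "\<And>k f B w \<zeta>. sep_hol (G \<times> Om) f \<Longrightarrow> \<forall>x\<in>C. cmod (f x) \<le> B \<Longrightarrow>
      w \<in> L1 \<Longrightarrow> \<zeta> \<in> M \<Longrightarrow> cmod (taylor_coeff (N k) f w \<zeta>) \<le> A k * B"
    by metis
  have "\<exists>R>0. \<forall>z\<in>K1. \<forall>\<zeta>\<in>M. cmod (vpower (z - \<zeta>) (N k)) \<le> R" for k
  proof -
    have "compact ((\<lambda>(z, \<zeta>). vpower (z - \<zeta>) (N k)) ` (K1 \<times> M))"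
      unfolding vpower_def split_def
      by (intro compact_continuous_image continuous_intros compact_Times K1 M)
    then have "bounded ((\<lambda>(z, \<zeta>). vpower (z - \<zeta>) (N k)) ` (K1 \<times> M))" by (rule compact_imp_bounded)
    then show ?thesis unfolding bounded_pos by fast
  qed
  then obtain R where R: "\<And>k. R k > 0" "\<And>k z \<zeta>. z \<in> K1 \<Longrightarrow> \<zeta> \<in> M \<Longrightarrow> cmod (vpower (z - \<zeta>) (N k)) \<le> R k"
    by metis
  define Q where "Q = (\<Sum>k\<le>n. A k * R k)"
  have Q: "Q > 0" unfolding Q_def using A(1) R(1) by (intro sum_pos) auto
  define \<rho> where "\<rho> = min r1 r2"
  have \<rho>: "\<rho> > 0" using L1 K1 by (simp add: \<rho>_def)
  obtain A' where A': "A' > 0" "\<And>(F :: ('r, 'd) cspace \<Rightarrow> complex) S x B. open S \<Longrightarrow> sep_hol S F \<Longrightarrow> cball x \<rho> \<subseteq> S \<Longrightarrow>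
      (\<And>y. y \<in> cball x \<rho> \<Longrightarrow> cmod (F y) \<le> B) \<Longrightarrow> cmod (coord_derivs cs F x) \<le> A' * B"
    using coord_derivs_bound[OF \<rho>, of cs] by blast
  show ?thesis
    unfolding partial_sum_bounded_def
  proof (intro exI[of _ C] exI[of _ "A' * Q"] conjI allI impI ballI)
    show "A' * Q > 0" using A'(1) Q by simp
    fix f B \<zeta> w z ds
    assume f: "sep_hol (G \<times> Om) f" and B: "B \<ge> 0" "\<forall>x\<in>C. cmod (f x) \<le> B" and mem: "\<zeta> \<in> M" "w \<in> L" "z \<in> K"
      and ds: "ds \<in> {cs}"
    have "cball (w, z) \<rho> \<subseteq> cball w \<rho> \<times> cball z \<rho>" by (rule cball_Times_subset)
    also have "\<dots> \<subseteq> L1 \<times> K1" using L1(4)[OF mem(2)] K1(3)[OF mem(3)] by (auto simp: \<rho>_def)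
    finally have sub: "cball (w, z) \<rho> \<subseteq> L1 \<times> K1" .
    have "cmod (coord_derivs cs (\<lambda>x. partial_sum N n f (fst x) \<zeta> (snd x)) (w, z)) \<le> A' * (Q * B)"
    proof (rule A'(2))
      show "open (G \<times> (UNIV :: (complex ^ 'd) set))" using G by (simp add: open_Times)
      show "sep_hol (G \<times> UNIV) (\<lambda>x. partial_sum N n f (fst x) \<zeta> (snd x))"
        using mem(1) M(2) by (intro sep_hol_partial_sum[OF G Om f]) auto
      show "cball (w, z) \<rho> \<subseteq> G \<times> UNIV" using sub L1(3) by auto
      fix y assume "y \<in> cball (w, z) \<rho>"
      then have y: "fst y \<in> L1" "snd y \<in> K1" using sub by auto
      have "cmod (partial_sum N n f (fst y) \<zeta> (snd y)) \<le> (\<Sum>k\<le>n. (A k * B) * R k)"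
        unfolding partial_sum_def norm_mult
        by (rule order.trans[OF norm_sum]) 
          (auto simp: norm_mult intro!: sum_mono mult_mono A(2)[OF f B(2)] R(2) y mem(1) mult_nonneg_nonneg B(1) less_imp_le[OF A(1)])
      also have "\<dots> = Q * B" by (simp add: Q_def sum_distrib_left mult_ac)
      finally show "cmod (partial_sum N n f (fst y) \<zeta> (snd y)) \<le> Q * B" .
    qed
    then show "cmod (coord_derivs ds (\<lambda>x. partial_sum N n f (fst x) \<zeta> (snd x)) (w, z)) \<le> A' * Q * B"
      using ds by (simp add: mult_ac)
  qed (rule C)+
qed

lemma partial_sum_bounded_exists:
  fixes G :: "(complex ^ 'r::finite) set" and Om :: "(complex ^ 'd::finite) set"
  assumes "open G" "open Om" "compact L" "L \<subseteq> G" "compact M" "M \<subseteq> Om" "compact K" "finite W"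
  shows "\<exists>C A. partial_sum_bounded G Om L M K N n W C A"
  using assms(8)
proof (induction W)
  case empty
  show ?case unfolding partial_sum_bounded_def by (rule exI[of _ "{}"], rule exI[of _ 1]) simp
next
  case (insert cs W)
  obtain C A where C: "partial_sum_bounded G Om L M K N n W C A" using insert.IH by blast
  obtain C' A' where C': "partial_sum_bounded G Om L M K N n {cs} C' A'"
    using partial_sum_bounded_single[OF assms(1-7)] by blast
  have "partial_sum_bounded G Om L M K N n (insert cs W) (C \<union> C') (max A A')"
    unfolding partial_sum_bounded_def
  proof (intro conjI allI impI ballI)
    show "compact (C \<union> C')" "C \<union> C' \<subseteq> G \<times> Om" "max A A' > 0"
      using C C' unfolding partial_sum_bounded_def by (auto intro: compact_Un)
    fix f B \<zeta> w z ds
    assume f: "sep_hol (G \<times> Om) f" and B: "B \<ge> 0" "\<forall>x\<in>C \<union> C'. cmod (f x) \<le> B" and mem: "\<zeta> \<in> M" "w \<in> L" "z \<in> K" and ds: "ds \<in> insert cs W"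
    have le: "A * B \<le> max A A' * B" "A' * B \<le> max A A' * B"
      using B(1) by (simp_all add: mult_right_mono)
    show "cmod (coord_derivs ds (\<lambda>x. partial_sum N n f (fst x) \<zeta> (snd x)) (w, z)) \<le> max A A' * B"
    proof (cases "ds \<in> W")
      case True
      show ?thesis
        by (rule order.trans[OF partial_sum_boundedD[OF C f B(1) _ mem True] le(1)]) (use B(2) in blast)
    next
      case False
      then have "ds \<in> {cs}" using ds by blast
      show ?thesis
        by (rule order.trans[OF partial_sum_boundedD[OF C' f B(1) _ mem \<open>ds \<in> {cs}\<close>] le(2)]) (use B(2) in blast)
    qed
  qed
  then show ?case by blast
qed

section \<open>Polynomials\<close>

definition monomial :: "nat ^ 'r::finite \<Rightarrow> nat ^ 'd::finite \<Rightarrow> ('r, 'd) cspace \<Rightarrow> complex"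
  where "monomial a b x = vpower (fst x) a * vpower (snd x) b"

definition mpolys :: "(('r::finite, 'd::finite) cspace \<Rightarrow> complex) set"
  where "mpolys = fun_cspace.span (range (\<lambda>(a, b). monomial a b))"

lemma mpolys_zero: "(\<lambda>x. 0) \<in> mpolys"
  using fun_cspace.span_zero unfolding mpolys_def zero_fun_def .

lemma mpolys_add: "p \<in> mpolys \<Longrightarrow> q \<in> mpolys \<Longrightarrow> (\<lambda>x. p x + q x) \<in> mpolys"
  using fun_cspace.span_add[of p _ q] unfolding mpolys_def plus_fun_def .

lemma mpolys_cmult: "p \<in> mpolys \<Longrightarrow> (\<lambda>x. c * p x) \<in> mpolys"
  using fun_cspace.span_scale[of p _ c] unfolding mpolys_def .

lemma mpolys_diff: "p \<in> mpolys \<Longrightarrow> q \<in> mpolys \<Longrightarrow> (\<lambda>x. p x - q x) \<in> mpolys"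
  using mpolys_add[OF _ mpolys_cmult[of q "-1"], of p] by simp

lemma mpolys_monomial: "monomial a b \<in> mpolys"
  unfolding mpolys_def by (rule fun_cspace.span_base) auto

lemma mpolys_induct [consumes 1, case_names zero step]:
  assumes "p \<in> mpolys" "P (\<lambda>x. 0)" "\<And>c a b p. p \<in> mpolys \<Longrightarrow> P p \<Longrightarrow> P (\<lambda>x. c * monomial a b x + p x)"
  shows "P p"
proof -
  have "p \<in> mpolys \<and> P p"
    using assms(1)[unfolded mpolys_def]
  proof (induction rule: fun_cspace.span_induct_alt)
    case base
    show ?case using assms(2) mpolys_zero by (simp add: zero_fun_def)
  next
    case (step c m p)
    then obtain a b where "m = monomial a b" by auto
    then show ?case using assms(3)[of p c a b] step.IH mpolys_add[OF mpolys_cmult[OF mpolys_monomial[of a b], of c], of p]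
      by (simp add: plus_fun_def)
  qed
  then show ?thesis ..
qed

lemma vpower_add: "vpower x (\<chi> i. m $ i + n $ i) = vpower x m * vpower x n"
  by (simp add: vpower_def power_add prod.distrib)

lemma monomial_mult: "monomial a b x * monomial a' b' x = monomial (\<chi> i. a $ i + a' $ i) (\<chi> i. b $ i + b' $ i) x"
  by (simp add: monomial_def vpower_add mult_ac)

lemma mpolys_mult:
  assumes "p \<in> mpolys" "q \<in> mpolys"
  shows "(\<lambda>x. p x * q x) \<in> mpolys"
  using assms(1)
proof (induction rule: mpolys_induct)
  case zero
  show ?case using mpolys_zero by simp
next
  case (step c a b p)
  have "(\<lambda>x. monomial a b x * q x) \<in> mpolys"
    using assms(2)
  proof (induction rule: mpolys_induct)
    case zero
    show ?case using mpolys_zero by simp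
  next
    case (step c' a' b' p')
    have "(\<lambda>x. c' * (monomial a b x * monomial a' b' x) + monomial a b x * p' x) \<in> mpolys"
      unfolding monomial_mult by (intro mpolys_add mpolys_cmult mpolys_monomial step)
    then show ?case by (simp add: algebra_simps)
  qed
  then have "(\<lambda>x. c * (monomial a b x * q x) + p x * q x) \<in> mpolys"
    by (intro mpolys_add mpolys_cmult step)
  then show ?case by (simp add: algebra_simps)
qed

lemma mpolys_const: "(\<lambda>x. c) \<in> mpolys"
  using mpolys_cmult[OF mpolys_monomial[of 0 0], of c] by (simp add: monomial_def vpower_def)

lemma mpolys_coord: "coord c \<in> mpolys"
proof (cases c)
  case (Inl i)
  have "monomial (\<chi> j. if j = i then 1 else 0) 0 = (coord c :: ('a, 'b) cspace \<Rightarrow> complex)"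
    by (rule ext) (simp add: monomial_def vpower_def Inl if_distrib cong: if_cong)
  then show ?thesis using mpolys_monomial by metis
next
  case (Inr i)
  have "monomial 0 (\<chi> j. if j = i then 1 else 0) = (coord c :: ('a, 'b) cspace \<Rightarrow> complex)"
    by (rule ext) (simp add: monomial_def vpower_def Inr if_distrib cong: if_cong)
  then show ?thesis using mpolys_monomial by metis
qed

lemma mpolys_poly_coord: "(\<lambda>x. poly q (coord c x)) \<in> mpolys"
proof (induction q)
  case 0
  show ?case using mpolys_zero by simp
next
  case (pCons a q)
  have "(\<lambda>x. a + coord c x * poly q (coord c x)) \<in> mpolys"
    by (intro mpolys_add mpolys_const mpolys_mult mpolys_coord pCons)
  then show ?case by simp
qed

lemma sep_hol_monomial: "sep_hol S (monomial a b)"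
proof -
  have "sep_hol S (\<lambda>x. (\<Prod>i\<in>UNIV. coord (Inl i) x ^ (a $ i)) * (\<Prod>i\<in>UNIV. coord (Inr i) x ^ (b $ i)))"
    by (intro sep_hol_mult sep_hol_prod sep_hol_power sep_hol_coord)
  moreover have "monomial a b = (\<lambda>x. (\<Prod>i\<in>UNIV. coord (Inl i) x ^ (a $ i)) * (\<Prod>i\<in>UNIV. coord (Inr i) x ^ (b $ i)))"
    by (rule ext) (simp add: monomial_def vpower_def)
  ultimately show ?thesis by simp
qed

lemma sep_hol_mpoly: "p \<in> mpolys \<Longrightarrow> sep_hol S p"
proof (induction rule: mpolys_induct)
  case (step c a b p)
  show ?case by (intro sep_hol_add sep_hol_mult sep_hol_const sep_hol_monomial step)
qed (rule sep_hol_const)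

text \<open>Truncated subtraction in the exponent is harmless: once \<open>k > n\<close>, the
  binomial coefficient is 0.\<close>

lemma higher_deriv_monomial:
  "(deriv ^^ k) (\<lambda>t::complex. t ^ n) = (\<lambda>x. fact k * of_nat (n choose k) * x ^ (n - k))"
proof (induction k)
  case (Suc k)
  have nat: "fact k * (n choose k) * (n - k) = fact (Suc k) * (n choose Suc k)"
  proof -
    have "(n - k) * (n choose k) = Suc k * (n choose Suc k)"
      using binomial_absorb_comp[of n k] binomial_absorption[of k n] by simp
    then show ?thesis by (simp add: algebra_simps)
  qed
  have "deriv (\<lambda>x. fact k * of_nat (n choose k) * x ^ (n - k)) x
      = fact (Suc k) * of_nat (n choose Suc k) * x ^ (n - Suc k)" for x :: complex
  proof -
    have "deriv (\<lambda>x. fact k * of_nat (n choose k) * x ^ (n - k)) x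
        = fact k * of_nat (n choose k) * (of_nat (n - k) * x ^ (n - k - 1))"
      by (rule DERIV_imp_deriv) (auto intro!: derivative_eq_intros)
    also have "\<dots> = of_nat (fact k * (n choose k) * (n - k)) * x ^ (n - k - 1)" by (simp add: mult_ac)
    also have "\<dots> = fact (Suc k) * of_nat (n choose Suc k) * x ^ (n - Suc k)"
      unfolding nat by (simp del: fact_Suc)
    finally show ?thesis .
  qed
  then show ?case unfolding funpow.simps o_def Suc.IH by blast
qed simp

lemma partial_deriv_prod:
  fixes \<psi> :: "'n::finite \<Rightarrow> complex \<Rightarrow> complex"
  assumes "\<And>j. \<psi> j holomorphic_on UNIV"
  shows "partial_deriv i (\<lambda>u. k * (\<Prod>j\<in>UNIV. \<psi> j (u $ j))) = (\<lambda>u. k * (\<Prod>j\<in>UNIV. (\<psi>(i := deriv (\<psi> i))) j (u $ j)))"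
proof
  fix u :: "complex ^ 'n"
  define R where "R = (\<Prod>j\<in>UNIV - {i}. \<psi> j (u $ j))"
  have split: "(\<Prod>j\<in>UNIV. g j) = g i * (\<Prod>j\<in>UNIV - {i}. g j)" for g :: "'n \<Rightarrow> complex"
    by (rule prod.remove) auto
  have "(\<lambda>t. k * (\<Prod>j\<in>UNIV. \<psi> j ((\<chi> j. if j = i then t else u $ j) $ j))) = (\<lambda>t. k * R * \<psi> i t)"
    unfolding split R_def by (auto simp: mult_ac intro!: prod.cong)
  moreover have "deriv (\<lambda>t. k * R * \<psi> i t) (u $ i) = k * R * deriv (\<psi> i) (u $ i)"
    using assms[of i] by (intro deriv_cmult) (simp add: holomorphic_on_imp_differentiable_at)
  moreover have "k * (\<Prod>j\<in>UNIV. (\<psi>(i := deriv (\<psi> i))) j (u $ j)) = k * R * deriv (\<psi> i) (u $ i)"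
    unfolding split R_def by (simp add: mult_ac)
  ultimately show "partial_deriv i (\<lambda>u. k * (\<Prod>j\<in>UNIV. \<psi> j (u $ j))) u = k * (\<Prod>j\<in>UNIV. (\<psi>(i := deriv (\<psi> i))) j (u $ j))"
    by (simp only: partial_deriv_def)
qed

lemma partial_deriv_power_prod:
  fixes \<psi> :: "'n::finite \<Rightarrow> complex \<Rightarrow> complex"
  assumes "\<And>j. \<psi> j holomorphic_on UNIV"
  shows "(partial_deriv i ^^ n) (\<lambda>u. k * (\<Prod>j\<in>UNIV. \<psi> j (u $ j))) = (\<lambda>u. k * (\<Prod>j\<in>UNIV. (\<psi>(i := (deriv ^^ n) (\<psi> i))) j (u $ j)))"
proof (induction n)
  case (Suc n)
  have "(\<psi>(i := (deriv ^^ n) (\<psi> i))) j holomorphic_on UNIV" for j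
    using assms by (auto intro: holomorphic_higher_deriv)
  from partial_deriv_prod[of "\<psi>(i := (deriv ^^ n) (\<psi> i))", OF this, of i k] show ?case
    by (simp add: Suc.IH)
qed simp

text \<open>On a product of functions of separate variables each partial derivative acts on its own
  factor. As \<open>coord_list\<close> has no repetitions, every factor is treated exactly once, and
  the unspecified order of the list leaves no trace.\<close>

lemma mixed_partial_prod:
  fixes \<phi> :: "'n::finite \<Rightarrow> complex \<Rightarrow> complex"
  assumes "\<And>j. \<phi> j holomorphic_on UNIV"
  shows "mixed_partial m (\<lambda>u. k * (\<Prod>j\<in>UNIV. \<phi> j (u $ j))) u = k * (\<Prod>j\<in>UNIV. (deriv ^^ (m $ j)) (\<phi> j) (u $ j))"
proof -
  have "foldr (\<lambda>i g. (partial_deriv i ^^ (m $ i)) g) is (\<lambda>u. k * (\<Prod>j\<in>UNIV. \<phi> j (u $ j)))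
      = (\<lambda>u. k * (\<Prod>j\<in>UNIV. (if j \<in> set is then (deriv ^^ (m $ j)) (\<phi> j) else \<phi> j) (u $ j)))" if "distinct is" for "is"
    using that
  proof (induction "is")
    case (Cons i "is")
    define \<psi> where "\<psi> j = (if j \<in> set is then (deriv ^^ (m $ j)) (\<phi> j) else \<phi> j)" for j
    have hol: "\<psi> j holomorphic_on UNIV" for j using assms by (auto simp: \<psi>_def intro: holomorphic_higher_deriv)
    have IH: "foldr (\<lambda>i g. (partial_deriv i ^^ (m $ i)) g) is (\<lambda>u. k * (\<Prod>j\<in>UNIV. \<phi> j (u $ j)))
        = (\<lambda>u. k * (\<Prod>j\<in>UNIV. \<psi> j (u $ j)))"
      using Cons by (simp add: \<psi>_def)
    have "\<psi>(i := (deriv ^^ (m $ i)) (\<psi> i)) = (\<lambda>j. if j \<in> set (i # is) then (deriv ^^ (m $ j)) (\<phi> j) else \<phi> j)"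
      using Cons.prems by (auto simp: \<psi>_def fun_eq_iff)
    then show ?case
      using partial_deriv_power_prod[where \<psi> = \<psi> and i = i and n = "m $ i" and k = k, OF hol] by (simp add: IH del: funpow.simps)
  qed simp
  moreover have "distinct (coord_list :: 'n list) \<and> set (coord_list :: 'n list) = UNIV"
    unfolding coord_list_def by (rule someI_ex) (metis finite_distinct_list finite_class.finite_UNIV)
  ultimately show ?thesis by (simp add: mixed_partial_def)
qed

lemma taylor_coeff_monomial:
  "taylor_coeff m (monomial a b) w \<zeta> = vpower w a * (\<Prod>i\<in>UNIV. of_nat ((b $ i) choose (m $ i)) * (\<zeta> $ i) ^ (b $ i - m $ i))"
proof -
  have "mixed_partial m (\<lambda>u. monomial a b (w, u)) \<zeta> = mixed_partial m (\<lambda>u. vpower w a * (\<Prod>j\<in>UNIV. (\<lambda>t. t ^ (b $ j)) (u $ j))) \<zeta>"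
    by (simp add: monomial_def vpower_def)
  also have "\<dots> = vpower w a * (\<Prod>i\<in>UNIV. fact (m $ i) * of_nat ((b $ i) choose (m $ i)) * (\<zeta> $ i) ^ (b $ i - m $ i))"
    by (subst mixed_partial_prod) (auto simp: higher_deriv_monomial intro!: holomorphic_intros)
  also have "\<dots> = (\<Prod>i\<in>UNIV. fact (m $ i)) * (vpower w a * (\<Prod>i\<in>UNIV. of_nat ((b $ i) choose (m $ i)) * (\<zeta> $ i) ^ (b $ i - m $ i)))"
    by (simp add: prod.distrib mult_ac)
  finally show ?thesis by (simp add: taylor_coeff_def)
qed

lemma vec_PiE_bij:
  fixes B :: "'n::finite \<Rightarrow> nat set"
  shows "bij_betw (\<lambda>g. \<chi> i. g i) (PiE UNIV B) {m. \<forall>i. m $ i \<in> B i}"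
  by (rule bij_betwI[where g = "\<lambda>m i. m $ i"]) (auto simp: vec_eq_iff)

lemma finite_bounded_vec: "finite {m :: nat ^ 'n::finite. \<forall>i. m $ i \<le> b i}"
  using bij_betw_finite[OF vec_PiE_bij[of "\<lambda>i. {..b i}"]] finite_PiE[of UNIV "\<lambda>i. {..b i}"] by simp

text \<open>Once the enumeration has passed every multi-index below \<open>b\<close>, all nonzero
  Taylor terms are present; their sum factors over the coordinates, and each factor is a binomial
  expansion of \<open>(z - \<zeta>) + \<zeta>\<close>. The threshold depends on \<open>b\<close> and
  \<open>N\<close> only.\<close>

lemma partial_sum_monomial:
  fixes N :: "nat \<Rightarrow> nat ^ 'd::finite"
  assumes "bij N"
  shows "\<exists>n0. \<forall>n\<ge>n0. \<forall>w \<zeta> z. partial_sum N n (monomial a b) w \<zeta> z = monomial a b (w, z)"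
proof -
  define D where "D = {m :: nat ^ 'd. \<forall>i. m $ i \<in> {..b $ i}}"
  have finD: "finite D" unfolding D_def using finite_bounded_vec[of "\<lambda>i. b $ i"] by simp
  \<comment> \<open>The position at which the last multi-index of the box occurs in the
    enumeration.\<close>
  define n0 where "n0 = Max (inv N ` D)"
  have D: "D \<subseteq> N ` {..n}" if "n \<ge> n0" for n
  proof
    fix m assume "m \<in> D"
    then have "inv N m \<le> n0" unfolding n0_def using finD by (intro Max_ge) auto
    then have "inv N m \<in> {..n}" using that by simp
    then have "N (inv N m) \<in> N ` {..n}" by (rule imageI)
    then show "m \<in> N ` {..n}" by (simp only: surj_f_inv_f[OF bij_is_surj[OF assms]])
  qed
  have "partial_sum N n (monomial a b) w \<zeta> z = monomial a b (w, z)" if n: "n \<ge> n0" for n and w :: "complex ^ 'a" and \<zeta> z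
  proof -
    define g where "g m = (\<Prod>i\<in>UNIV. of_nat ((b $ i) choose (m $ i)) * (\<zeta> $ i) ^ (b $ i - m $ i) * (z $ i - \<zeta> $ i) ^ (m $ i))" for m :: "nat ^ 'd"
    have "taylor_coeff m (monomial a b) w \<zeta> * vpower (z - \<zeta>) m = vpower w a * g m" for m
      by (simp add: taylor_coeff_monomial g_def vpower_def prod.distrib mult_ac)
    then have "partial_sum N n (monomial a b) w \<zeta> z = vpower w a * (\<Sum>k\<le>n. g (N k))"
      by (simp add: partial_sum_def sum_distrib_left)
    also have "(\<Sum>k\<le>n. g (N k)) = (\<Sum>m\<in>N ` {..n}. g m)"
      by (rule sum.reindex_cong[symmetric, where l = N]) (use assms in \<open>auto intro: inj_on_subset[OF bij_is_inj]\<close>)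
    also have "\<dots> = (\<Sum>m\<in>D. g m)"
    proof (rule sum.mono_neutral_right)
      show "\<forall>m\<in>N ` {..n} - D. g m = 0"
      proof
        fix m assume "m \<in> N ` {..n} - D"
        then obtain i where "b $ i < m $ i" by (auto simp: D_def not_le)
        then have "(b $ i) choose (m $ i) = 0" by (rule binomial_eq_0)
        then show "g m = 0" unfolding g_def by (intro prod_zero bexI[of _ i]) auto
      qed
    qed (use D n in auto)
    also have "\<dots> = (\<Sum>h\<in>PiE UNIV (\<lambda>i. {..b $ i}). g (\<chi> i. h i))"
      unfolding D_def by (rule sum.reindex_bij_betw[symmetric, OF vec_PiE_bij])
    also have "\<dots> = (\<Prod>i\<in>UNIV. \<Sum>k\<le>b $ i. of_nat ((b $ i) choose k) * (\<zeta> $ i) ^ (b $ i - k) * (z $ i - \<zeta> $ i) ^ k)"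
      unfolding g_def by (subst prod_sum_PiE) auto
    also have "\<dots> = vpower z b"
      unfolding vpower_def
    proof (rule prod.cong)
      fix i
      have "(\<Sum>k\<le>b $ i. of_nat ((b $ i) choose k) * (\<zeta> $ i) ^ (b $ i - k) * (z $ i - \<zeta> $ i) ^ k) = ((z $ i - \<zeta> $ i) + \<zeta> $ i) ^ (b $ i)"
        unfolding binomial_ring by (intro sum.cong) (auto simp: mult_ac)
      then show "(\<Sum>k\<le>b $ i. of_nat ((b $ i) choose k) * (\<zeta> $ i) ^ (b $ i - k) * (z $ i - \<zeta> $ i) ^ k) = (z $ i) ^ (b $ i)"
        by simp
    qed simp
    finally show ?thesis by (simp add: monomial_def[of a b "(w, z)"])
  qed
  then show ?thesis by blast
qed

lemma partial_sum_mpoly: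
  fixes N :: "nat \<Rightarrow> nat ^ 'd::finite" and p :: "('r::finite, 'd) cspace \<Rightarrow> complex"
  assumes N: "bij N" and p: "p \<in> mpolys"
  shows "\<exists>n0. \<forall>n\<ge>n0. \<forall>w \<zeta> z. partial_sum N n p w \<zeta> z = p (w, z)"
  using p
proof (induction rule: mpolys_induct)
  case zero
  have "partial_sum N n (\<lambda>x :: ('r, 'd) cspace. 0) w \<zeta> z = 0" for n w \<zeta> z
    using partial_sum_cmult[of UNIV "\<lambda>x. 0" w \<zeta> N n 0 z] by (auto simp: sep_hol_const)
  then show ?case by blast
next
  case (step c a b p)
  obtain n1 where n1: "\<And>n w \<zeta> z. n \<ge> n1 \<Longrightarrow> partial_sum N n p w \<zeta> z = p (w, z)" using step.IH by blast
  obtain n2 where n2: "\<And>n (w :: complex ^ 'r) \<zeta> z. n \<ge> n2 \<Longrightarrow> partial_sum N n (monomial a b) w \<zeta> z = monomial a b (w, z)"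
    using partial_sum_monomial[OF N] by blast
  have "partial_sum N n (\<lambda>x. c * monomial a b x + p x) w \<zeta> z = c * monomial a b (w, z) + p (w, z)"
    if "n \<ge> max n1 n2" for n w \<zeta> z
  proof -
    have "partial_sum N n (\<lambda>x. c * monomial a b x + p x) w \<zeta> z
        = partial_sum N n (\<lambda>x. c * monomial a b x) w \<zeta> z + partial_sum N n p w \<zeta> z"
      by (rule partial_sum_add[OF open_UNIV]) (auto intro: sep_hol_monomial sep_hol_mpoly[OF step.hyps])
    also have "partial_sum N n (\<lambda>x. c * monomial a b x) w \<zeta> z = c * partial_sum N n (monomial a b) w \<zeta> z"
      by (rule partial_sum_cmult[OF open_UNIV sep_hol_monomial UNIV_I])
    finally show ?thesis using that n1 n2 by simp
  qed
  then show ?case by blast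
qed

section \<open>Compact sets with connected complement\<close>

text \<open>Janiszewski's theorem; it is what permits Runge approximation on both sides of a
  separation at once.\<close>

lemma connected_Compl_Un_disjoint:
  fixes K M :: "complex set"
  assumes "compact K" "compact M" "K \<inter> M = {}" "connected (- K)" "connected (- M)"
  shows "connected (- (K \<union> M))"
  using assms by (intro Janiszewski_connected) (auto simp: compact_imp_closed)

text \<open>The holes of an ordinary compact exhaustion are filled in. The filled sets remain inside
  \<open>S\<close>, because the inside of a simply connected domain is empty.\<close>

lemma simply_connected_exhaustion:
  fixes S :: "complex set"
  assumes "simply_connected_domain S"
  obtains E where "\<And>n. compact (E n)" "\<And>n. connected (- E n)" "\<And>n. E n \<subseteq> S" "\<And>n. E n \<subseteq> E (Suc n)"
    "\<And>C. compact C \<Longrightarrow> C \<subseteq> S \<Longrightarrow> \<exists>n. C \<subseteq> E n"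
proof -
  have S: "open S" "connected S" "simply_connected S" using assms by (auto simp: simply_connected_domain_def)
  then have ins: "inside S = {}" using simply_connected_eq_empty_inside by blast
  obtain D where D: "\<And>n. compact (D n)" "\<And>n. D n \<subseteq> S" "\<And>n. D n \<subseteq> interior (D (Suc n))"
    "\<And>C. \<lbrakk>compact C; C \<subseteq> S\<rbrakk> \<Longrightarrow> \<exists>N. \<forall>n\<ge>N. C \<subseteq> D n"
    using open_Union_compact_subsets[OF S(1)] by metis
  define E where "E n = D n \<union> inside (D n)" for n
  have Eo: "E n = - outside (D n)" for n
    unfolding E_def using union_with_inside by blast
  show thesis
  proof (rule that[of E])
    fix n
    have bd: "bounded (D n)" using D(1) compact_imp_bounded by blast
    have "closed (E n)" unfolding Eo using D(1) by (simp add: compact_imp_closed open_outside closed_Compl)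
    moreover have "bounded (E n)" unfolding E_def using bd by (simp add: bounded_inside)
    ultimately show "compact (E n)" by (simp add: compact_eq_bounded_closed)
    show "connected (- E n)" unfolding Eo using bd by (simp add: connected_outside)
    show "E n \<subseteq> S" using D(2)[of n] inside_mono[OF D(2)[of n]] ins unfolding E_def by blast
    have mono: "D n \<subseteq> D (Suc n)" using D(3)[of n] interior_subset by (rule subset_trans)
    have "outside (D (Suc n)) \<subseteq> outside (D n)" using mono by (rule outside_mono)
    then show "E n \<subseteq> E (Suc n)" unfolding Eo by (simp only: Compl_subset_Compl_iff)
  next
    fix C :: "complex set" assume C: "compact C" "C \<subseteq> S"
    obtain m where "\<forall>n\<ge>m. C \<subseteq> D n" using D(4)[OF C] by (rule exE)
    then have "C \<subseteq> D m" by simp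
    also have "D m \<subseteq> E m" unfolding E_def by (rule Un_upper1)
    finally show "\<exists>n. C \<subseteq> E n" ..
  qed
qed

text \<open>Closed neighbourhoods of \<open>K\<close> may enclose holes, so they are filled, and the
  issue is that the filling could leave \<open>V\<close>. Their outsides increase to the complement
  of \<open>K\<close>, hence one of them already covers the compact part of a large disc beyond
  \<open>V\<close>.\<close>

lemma hull_thickening:
  fixes K V :: "complex set"
  assumes K: "compact K" "connected (- K)" and V: "open V" "K \<subseteq> V"
  obtains K' \<rho> where "compact K'" "connected (- K')" "K' \<subseteq> V" "\<rho> > 0" "\<And>z. z \<in> K \<Longrightarrow> cball z \<rho> \<subseteq> K'"
proof (cases "K = {}")
  \<comment> \<open>Treated apart because \<open>infdist\<close> to the empty set is 0, so the
    neighbourhoods used below would be the whole plane.\<close>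
  case True
  show thesis by (rule that[of "{}" 1]) (auto simp: True)
next
  case ne: False
  define T where "T n = {x. infdist x K \<le> 1 / real (Suc n)}" for n
  define O' where "O' n = outside (T n)" for n
  have compT: "compact (T n)" for n unfolding T_def by (rule compact_infdist_le[OF ne K(1)]) simp
  have decT: "T n \<subseteq> T m" if "m \<le> n" for m n
  proof -
    have "1 / real (Suc n) \<le> 1 / real (Suc m)" using that by (simp add: frac_le)
    then show ?thesis unfolding T_def by auto
  qed
  have openO: "open (O' n)" for n unfolding O'_def by (rule open_outside) (simp add: compT compact_imp_closed)
  have incO: "O' m \<subseteq> O' n" if "m \<le> n" for m n
    unfolding O'_def by (rule outside_mono[OF decT[OF that]])
  obtain R where R: "R > 0" "\<forall>z\<in>T 0. cmod z \<le> R"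
    using compact_imp_bounded[OF compT[of 0]] unfolding bounded_pos by blast
  have far: "x \<in> O' n" if "cmod x > R" for x n
  proof -
    have "x \<in> outside (cball 0 R)" using that by (simp add: outside_convex)
    moreover have "T 0 \<subseteq> cball 0 R" using R by auto
    ultimately have "x \<in> O' 0" unfolding O'_def using outside_mono by blast
    then show ?thesis using incO[of 0 n] by blast
  qed
  \<comment> \<open>A path from \<open>x\<close> to a far point within the connected complement has
    positive distance from \<open>K\<close>, and so it avoids \<open>T n\<close> for large
    \<open>n\<close>.\<close>
  have cover: "\<exists>n. x \<in> O' n" if x: "x \<notin> K" for x
  proof -
    define y :: complex where "y = of_real (R + 1)"
    have y: "cmod y > R" using R(1) unfolding y_def norm_of_real by simp
    have "y \<in> T 0" if "y \<in> K" using that by (simp add: T_def)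
    then have "y \<notin> K" using R(2) y by fastforce
    have "path_connected (- K)"
      using K by (simp add: connected_open_path_connected compact_imp_closed open_Compl)
    moreover have "x \<in> - K" "y \<in> - K" using x \<open>y \<notin> K\<close> by simp_all
    ultimately obtain g where g: "path g" "path_image g \<subseteq> - K" "pathstart g = x" "pathfinish g = y"
      unfolding path_connected_def by blast
    have "path_image g \<inter> K = {}" using g(2) by blast
    then obtain d where d: "d > 0" "\<And>u v. u \<in> path_image g \<Longrightarrow> v \<in> K \<Longrightarrow> d \<le> dist u v"
      using separate_compact_closed[OF compact_path_image[OF g(1)] compact_imp_closed[OF K(1)]] by blast
    obtain n where n: "1 / real (Suc n) < d" using d(1) nat_approx_posE by blast
    have "path_image g \<subseteq> - T n"
    proof
      fix u assume u: "u \<in> path_image g"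
      obtain v where v: "v \<in> K" "infdist u K = dist u v" using infdist_attains_inf[OF compact_imp_closed[OF K(1)] ne] by blast
      then show "u \<in> - T n" using d(2)[OF u v(1)] n by (simp add: T_def)
    qed
    then have "connected_component (- T n) x y"
      unfolding connected_component_def using g connected_path_image[OF g(1)] pathstart_in_path_image[of g]
        pathfinish_in_path_image[of g] by blast
    then have "connected_component (- T n) y x" by (simp add: connected_component_sym)
    then have "x \<in> O' n"
      using far[OF y, of n] outside_same_component unfolding O'_def by blast
    then show ?thesis ..
  qed
  have compB: "compact (cball 0 R - V)" using V by (simp add: compact_diff)
  have cov: "cball 0 R - V \<subseteq> (\<Union>n\<in>UNIV. O' n)" using cover V(2) by blast
  obtain F where F: "F \<subseteq> UNIV" "finite F" "cball 0 R - V \<subseteq> (\<Union>n\<in>F. O' n)"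
    by (rule compactE_image[OF compB openO cov])
  define n where "n = Max (insert 0 F)"
  have sub: "cball 0 R - V \<subseteq> O' n"
  proof
    fix x assume "x \<in> cball 0 R - V"
    then obtain m where "m \<in> F" "x \<in> O' m" using F(3) by blast
    moreover have "m \<le> n" unfolding n_def using F(2) \<open>m \<in> F\<close> by (intro Max_ge) auto
    ultimately show "x \<in> O' n" using incO by blast
  qed
  show thesis
  proof (rule that[of "- O' n" "1 / real (Suc n)"])
    have "- O' n \<subseteq> cball 0 R"
    proof
      fix x assume "x \<in> - O' n"
      then show "x \<in> cball 0 R" using far[of x n] by (cases "cmod x > R") auto
    qed
    then show "- O' n \<subseteq> V" using sub by blast
    show "compact (- O' n)"
      using \<open>- O' n \<subseteq> cball 0 R\<close> openO bounded_subset[OF bounded_cball] by (simp add: compact_eq_bounded_closed closed_Compl)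
    show "connected (- (- O' n))"
      unfolding O'_def double_compl using compact_imp_bounded[OF compT] by (simp add: connected_outside)
    fix z assume z: "z \<in> K"
    show "cball z (1 / real (Suc n)) \<subseteq> - O' n"
    proof
      fix y assume "y \<in> cball z (1 / real (Suc n))"
      then have "y \<in> T n" using infdist_le2[OF z, of y] by (simp add: T_def dist_commute)
      then show "y \<in> - O' n" unfolding O'_def outside_def by simp
    qed
  qed simp
qed

section \<open>A countable cofinal family of compact sets avoiding a domain\<close>

definition rat_balls :: "complex set set"
  where "rat_balls = range (\<lambda>(a, b, n::nat). ball (Complex (of_rat a) (of_rat b)) (1 / real (Suc n)))"

lemma countable_rat_balls: "countable rat_balls"
  unfolding rat_balls_def by (intro countable_image countableI_type)

lemma rat_ballsD: "b \<in> rat_balls \<Longrightarrow> open b" "b \<in> rat_balls \<Longrightarrow> connected b"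
  unfolding rat_balls_def by auto

lemma rat_ball_between:
  assumes "open U" "p \<in> U"
  shows "\<exists>b\<in>rat_balls. p \<in> b \<and> b \<subseteq> U"
proof -
  obtain e where e: "e > 0" "ball p e \<subseteq> U" using assms by (auto elim: openE)
  obtain n where n: "1 / real (Suc n) < e / 2" using nat_approx_posE[OF half_gt_zero[OF e(1)]] by blast
  define r where "r = 1 / real (Suc n)"
  have r: "r > 0" "2 * r < e" using n by (auto simp: r_def)
  obtain a where a: "Re p < of_rat a" "of_rat a < Re p + r / 2" using of_rat_dense[of "Re p" "Re p + r / 2"] r by auto
  obtain b where b: "Im p < of_rat b" "of_rat b < Im p + r / 2" using of_rat_dense[of "Im p" "Im p + r / 2"] r by auto
  define c where "c = Complex (of_rat a) (of_rat b)"
  have "cmod (c - p) \<le> \<bar>Re (c - p)\<bar> + \<bar>Im (c - p)\<bar>" by (rule cmod_le)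
  also have "\<dots> < r" using a b by (simp add: c_def)
  finally have d: "dist c p < r" by (simp add: dist_norm)
  have "ball c r \<subseteq> ball p e"
  proof
    fix x assume "x \<in> ball c r"
    then show "x \<in> ball p e" using d r(2) dist_triangle[of p x c] by (simp add: dist_commute)
  qed
  moreover have "ball c r \<in> rat_balls" unfolding rat_balls_def c_def r_def by (rule range_eqI[of _ _ "(a, b, n)"]) simp
  ultimately show ?thesis using d e(2) by (intro bexI[of _ "ball c r"]) auto
qed

text \<open>Connectedness of the complement is imposed as a membership condition, so countability is
  immediate and the topology is left to the proof of cofinality.\<close>

definition disjoint_compacts :: "complex set \<Rightarrow> complex set set"
  where "disjoint_compacts S = {K. \<exists>(R::nat) F. finite F \<and> F \<subseteq> rat_balls \<and>
    K = cball 0 (real R) - (S \<union> \<Union>F) \<and> connected (- K)}"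

lemma countable_disjoint_compacts: "countable (disjoint_compacts S)"
proof -
  have "countable ((\<lambda>(R, F). cball 0 (real R) - (S \<union> \<Union>F)) ` (UNIV \<times> {F. finite F \<and> F \<subseteq> rat_balls}))"
    by (intro countable_image countable_SIGMA countable_Collect_finite_subset countable_rat_balls countableI_type)
  then show ?thesis
    by (rule countable_subset[rotated]) (auto simp: disjoint_compacts_def)
qed

lemma disjoint_compactsD:
  assumes "K \<in> disjoint_compacts S" "open S"
  shows "compact K" "connected (- K)" "S \<inter> K = {}"
proof -
  obtain R :: nat and F where F: "finite F" "F \<subseteq> rat_balls" "K = cball 0 (real R) - (S \<union> \<Union>F)" "connected (- K)"
    using assms(1) unfolding disjoint_compacts_def by blast
  have "open (S \<union> \<Union>F)" using F(2) rat_ballsD assms(2) by blast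
  then show "compact K" unfolding F(3) by (intro compact_diff) auto
  show "connected (- K)" "S \<inter> K = {}" using F by auto
qed

text \<open>A path in the complement of \<open>K\<close> from \<open>S\<close> to a far point, thickened to a finite union of
  rational balls, connects \<open>S\<close> with the exterior of a large disc; removing both from the disc leaves a
  set of the countable family.\<close>

lemma disjoint_compacts_cofinal:
  assumes S: "connected S" "S \<noteq> {}" and K: "compact K" "connected (- K)" "S \<inter> K = {}"
  obtains K' where "K' \<in> disjoint_compacts S" "K \<subseteq> K'"
proof -
  obtain R :: nat where R: "K \<subseteq> cball 0 (real R)"
  proof -
    obtain r where r: "\<forall>z\<in>K. cmod z \<le> r" using compact_imp_bounded[OF K(1)] unfolding bounded_iff by blast
    obtain R :: nat where "r \<le> real R" using real_arch_simple by blast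
    then have "K \<subseteq> cball 0 (real R)" using r by force
    then show thesis by (rule that)
  qed
  obtain x where x: "x \<in> S" using S(2) by blast
  define y :: complex where "y = of_real (real R + 1)"
  have y: "cmod y > real R" unfolding y_def norm_of_real by simp
  have oK: "open (- K)" using K(1) by (simp add: compact_imp_closed open_Compl)
  have "path_connected (- K)" using K(2) oK by (simp add: connected_open_path_connected)
  moreover have "x \<in> - K" using x K(3) by auto
  moreover have "y \<in> - K" using R y by auto
  ultimately obtain g where g: "path g" "path_image g \<subseteq> - K" "pathstart g = x" "pathfinish g = y"
    unfolding path_connected_def by blast
  define P where "P = path_image g"
  have P: "compact P" "connected P" "P \<subseteq> - K"
    using g unfolding P_def by (auto simp: compact_path_image connected_path_image)
  have xy: "x \<in> P" "y \<in> P" unfolding P_def using g(3,4) pathstart_in_path_image pathfinish_in_path_image by blast+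
  define C where "C = {b \<in> rat_balls. b \<subseteq> - K \<and> b \<inter> P \<noteq> {}}"
  have "P \<subseteq> \<Union>C"
  proof
    fix p assume p: "p \<in> P"
    then obtain b where "b \<in> rat_balls" "p \<in> b" "b \<subseteq> - K" using rat_ball_between[OF oK, of p] P(3) by blast
    then show "p \<in> \<Union>C" using p by (auto simp: C_def)
  qed
  moreover have "open b" if "b \<in> C" for b using that rat_ballsD(1) by (auto simp: C_def)
  ultimately obtain F where F: "F \<subseteq> C" "finite F" "P \<subseteq> \<Union>F"
    using compactE[OF P(1)] by metis
  \<comment> \<open>Each ball is joined with the whole path \<open>P\<close>, which it meets, so all
    pieces share the point \<open>x\<close>; since \<open>F\<close> covers \<open>P\<close>, nothing
    is added to the union of the balls.\<close>
  have "connected (\<Union>((\<lambda>b. P \<union> b) ` F))"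
  proof (rule connected_Union)
    fix s assume "s \<in> (\<lambda>b. P \<union> b) ` F"
    then obtain b where b: "b \<in> F" "s = P \<union> b" by blast
    then have "P \<inter> b \<noteq> {}" "connected b" using F(1) rat_ballsD(2) by (auto simp: C_def)
    then show "connected s" unfolding b(2) using P(2) by (intro connected_Un)
  next
    show "\<Inter>((\<lambda>b. P \<union> b) ` F) \<noteq> {}" using xy(1) by blast
  qed
  moreover have "\<Union>((\<lambda>b. P \<union> b) ` F) = \<Union>F" using F(3) xy(1) by blast
  ultimately have cF: "connected (\<Union>F)" by simp
  have "connected (S \<union> \<Union>F)" using S cF x xy F(3) by (intro connected_Un) auto
  moreover have "connected (- cball (0::complex) (real R))"
    by (rule connected_complement_bounded_convex) simp_all
  moreover have "(S \<union> \<Union>F) \<inter> - cball 0 (real R) \<noteq> {}"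
  proof -
    have "y \<in> \<Union>F" "y \<in> - cball 0 (real R)" using y xy(2) F(3) by auto
    then show ?thesis by blast
  qed
  ultimately have "connected ((S \<union> \<Union>F) \<union> - cball 0 (real R))" by (rule connected_Un)
  moreover have "(S \<union> \<Union>F) \<union> - cball 0 (real R) = - (cball 0 (real R) - (S \<union> \<Union>F))" by blast
  ultimately have "connected (- (cball 0 (real R) - (S \<union> \<Union>F)))" by simp
  then have "cball 0 (real R) - (S \<union> \<Union>F) \<in> disjoint_compacts S"
    unfolding disjoint_compacts_def using F(1,2) by (auto simp: C_def)
  moreover have "K \<subseteq> cball 0 (real R) - (S \<union> \<Union>F)" using R F(1) K(3) by (auto simp: C_def)
  ultimately show thesis by (rule that)
qed

section \<open>Polynomial approximation on products\<close>

lemma open_vprod: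
  fixes A :: "'n::finite \<Rightarrow> complex set"
  assumes "\<And>i. open (A i)"
  shows "open (vprod A)"
proof -
  have "vprod A = (\<Inter>i. (\<lambda>x. x $ i) -` A i)" by (auto simp: vprod_def)
  moreover have "open ((\<lambda>x :: complex ^ 'n. x $ i) -` A i)" for i
    using assms by (intro open_vimage continuous_intros) auto
  ultimately show ?thesis by (simp add: open_INT)
qed

lemma compact_vprod:
  fixes A :: "'n::finite \<Rightarrow> complex set"
  assumes "\<And>i. compact (A i)"
  shows "compact (vprod A)"
proof -
  have eq: "vprod A = (\<Inter>i. (\<lambda>x. x $ i) -` A i)" by (auto simp: vprod_def)
  have "closed ((\<lambda>x :: complex ^ 'n. x $ i) -` A i)" for i
    using assms by (intro closed_vimage continuous_intros) (auto simp: compact_imp_closed)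
  then have "closed (vprod A)" unfolding eq by (intro closed_INT) auto
  moreover have "bounded (vprod A)"
  proof -
    have "\<exists>B. \<forall>z\<in>A i. cmod z \<le> B" for i
      using compact_imp_bounded[OF assms[of i]] unfolding bounded_iff .
    then obtain B where B: "\<And>i z. z \<in> A i \<Longrightarrow> cmod z \<le> B i" by metis
    have "norm x \<le> (\<Sum>i\<in>UNIV. B i)" if "x \<in> vprod A" for x
    proof -
      have "norm x \<le> (\<Sum>i\<in>UNIV. cmod (x $ i))" unfolding norm_vec_def by (rule L2_set_le_sum) simp
      also have "\<dots> \<le> (\<Sum>i\<in>UNIV. B i)" using that B by (intro sum_mono) (auto simp: vprod_def)
      finally show ?thesis .
    qed
    then show ?thesis unfolding bounded_iff by blast
  qed
  ultimately show ?thesis by (simp add: compact_eq_bounded_closed)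
qed

definition coord_box :: "('r + 'd \<Rightarrow> complex set) \<Rightarrow> ('r::finite, 'd::finite) cspace set"
  where "coord_box A = {x. \<forall>c. coord c x \<in> A c}"

lemma coord_box_eq: "coord_box A = vprod (\<lambda>i. A (Inl i)) \<times> vprod (\<lambda>j. A (Inr j))"
proof (intro set_eqI iffI)
  fix x assume x: "x \<in> coord_box A"
  have "fst x $ i \<in> A (Inl i)" "snd x $ j \<in> A (Inr j)" for i j
    using x unfolding coord_box_def by (metis (mono_tags) coord.simps mem_Collect_eq)+
  then show "x \<in> vprod (\<lambda>i. A (Inl i)) \<times> vprod (\<lambda>j. A (Inr j))"
    by (cases x) (auto simp: vprod_def)
next
  fix x assume x: "x \<in> vprod (\<lambda>i. A (Inl i)) \<times> vprod (\<lambda>j. A (Inr j))"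
  have "coord c x \<in> A c" for c using x by (cases c) (auto simp: vprod_def)
  then show "x \<in> coord_box A" by (simp add: coord_box_def)
qed

lemma open_coord_box: "(\<And>c. open (A c)) \<Longrightarrow> open (coord_box A)"
  unfolding coord_box_eq by (intro open_Times open_vprod)

lemma compact_coord_box: "(\<And>c. compact (A c)) \<Longrightarrow> compact (coord_box A)"
  unfolding coord_box_eq by (intro compact_Times compact_vprod)

lemma coord_box_mono: "(\<And>c. A c \<subseteq> B c) \<Longrightarrow> coord_box A \<subseteq> coord_box B"
  by (auto simp: coord_box_def)

section \<open>Runge's theorem on products, coordinate by coordinate\<close>

definition merge_coords :: "('r + 'd) set \<Rightarrow> ('r::finite, 'd::finite) cspace \<Rightarrow> ('r, 'd) cspace \<Rightarrow> ('r, 'd) cspace"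
  where "merge_coords I a x = (\<chi> i. if Inl i \<in> I then fst a $ i else fst x $ i, \<chi> j. if Inr j \<in> I then snd a $ j else snd x $ j)"

lemma coord_merge_coords: "coord c (merge_coords I a x) = (if c \<in> I then coord c a else coord c x)"
  by (cases c) (auto simp: merge_coords_def)

lemma merge_coords_empty: "merge_coords {} a x = x"
  by (rule cspace_eqI) (simp add: coord_merge_coords)

lemma merge_coords_UNIV: "merge_coords UNIV a x = a"
  by (rule cspace_eqI) (simp add: coord_merge_coords)

lemma merge_coords_insert: "c \<notin> I \<Longrightarrow> merge_coords (insert c I) (upd_coord c a s) x = upd_coord c (merge_coords I a x) s"
  by (rule cspace_eqI) (auto simp: coord_merge_coords coord_upd_coord)

lemma norm_sum_list_le:
  assumes "\<And>p. p \<in> set xs \<Longrightarrow> cmod (F p) \<le> e * B p"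
  shows "cmod (\<Sum>p\<leftarrow>xs. F p) \<le> e * (\<Sum>p\<leftarrow>xs. B p)"
  using assms
proof (induction xs)
  case (Cons p xs)
  have "cmod (F p + (\<Sum>p\<leftarrow>xs. F p)) \<le> e * B p + e * (\<Sum>p\<leftarrow>xs. B p)"
    using Cons by (intro norm_triangle_mono) simp_all
  then show ?case by (simp add: distrib_left)
qed simp

lemma sep_hol_bounded_on_compact:
  assumes "sep_hol S F" "compact X" "X \<subseteq> S"
  shows "\<exists>B>0. \<forall>x\<in>X. cmod (F x) \<le> B"
proof -
  have "continuous_on X F" using assms unfolding sep_hol_def by (auto elim: continuous_on_subset)
  then have "bounded (F ` X)" using assms(2) by (intro compact_imp_bounded compact_continuous_image)
  then obtain B where "B > 0" "\<forall>y\<in>F ` X. cmod y \<le> B" unfolding bounded_pos by blast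
  then show ?thesis by blast
qed

text \<open>Induction on the set of coordinates already sampled. The partly sampled function, as a
  function of the next coordinate, varies with \<open>x\<close>, yet it stays in the unit ball; one
  quadrature rule therefore works for all \<open>x\<close>, and its weights multiply the old
  ones.\<close>

lemma iterated_quadrature:
  fixes h :: "('r::finite, 'd::finite) cspace \<Rightarrow> complex"
  assumes A: "\<And>c. compact (A c)" "\<And>c. connected (- A c)" "\<And>c. open (V c)" "\<And>c. A c \<subseteq> V c"
    and h: "sep_hol (coord_box V) h" "\<And>x. x \<in> coord_box V \<Longrightarrow> cmod (h x) \<le> 1"
  shows "finite I \<Longrightarrow> e > 0 \<Longrightarrow> \<exists>xs. (\<forall>(a, v)\<in>set xs. v \<in> mpolys \<and> (\<forall>c\<in>I. coord c a \<in> V c)) \<and>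
    (\<forall>x\<in>coord_box A. cmod (h x - (\<Sum>(a, v)\<leftarrow>xs. h (merge_coords I a x) * v x)) \<le> e)"
proof (induction I arbitrary: e rule: finite_induct)
  case empty
  show ?case
    \<comment> \<open>With no coordinate sampled the node is irrelevant:
      \<open>merge_coords {}\<close> ignores it.\<close>
    by (rule exI[of _ "[(undefined, \<lambda>x. 1)]"]) (use mpolys_const[of 1] empty in \<open>simp add: merge_coords_empty\<close>)
next
  case (insert c I)
  have "e / 2 > 0" using insert.prems by simp
  from insert.IH[OF this] obtain xs where xs: "\<forall>(a, v)\<in>set xs. v \<in> mpolys \<and> (\<forall>c\<in>I. coord c a \<in> V c)"
    "\<forall>x\<in>coord_box A. cmod (h x - (\<Sum>(a, v)\<leftarrow>xs. h (merge_coords I a x) * v x)) \<le> e / 2" by (elim exE conjE) rule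
  have "\<forall>p. \<exists>B. p \<in> set xs \<longrightarrow> B > 0 \<and> (\<forall>x\<in>coord_box A. cmod (snd p x) \<le> B)"
  proof (intro allI)
    fix p
    show "\<exists>B. p \<in> set xs \<longrightarrow> B > 0 \<and> (\<forall>x\<in>coord_box A. cmod (snd p x) \<le> B)"
    proof (cases "p \<in> set xs")
      case True
      then have "snd p \<in> mpolys" using xs(1) by (cases p) auto
      then have "sep_hol UNIV (snd p)" by (rule sep_hol_mpoly)
      then show ?thesis
        using sep_hol_bounded_on_compact[OF _ compact_coord_box[of A, OF A(1)] subset_UNIV] by blast
    qed blast
  qed
  then obtain B where B: "\<And>p. p \<in> set xs \<Longrightarrow> B p > 0" "\<And>p x. p \<in> set xs \<Longrightarrow> x \<in> coord_box A \<Longrightarrow> cmod (snd p x) \<le> B p"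
    by metis
  \<comment> \<open>Total size of the old weights, by which the error of the new rule gets
    multiplied; the added 1 keeps it positive.\<close>
  define C where "C = (\<Sum>p\<leftarrow>xs. B p) + 1"
  have "(\<Sum>p\<leftarrow>xs. B p) \<ge> 0" using B(1) by (intro sum_list_nonneg) (auto simp: less_imp_le)
  then have C: "C > 0" by (simp add: C_def)
  define e' where "e' = e / (2 * C)"
  have e': "e' > 0" using C insert.prems by (simp add: e'_def)
  obtain ys where ys: "fst ` set ys \<subseteq> V c"
    "\<And>f z. f \<in> unit_hol (V c) \<Longrightarrow> z \<in> A c \<Longrightarrow> cmod (f z - quad_sum ys f z) \<le> e'"
    using Runge_quadrature[OF A(1-4), of c, unfolded quadrature_def, rule_format, OF e'] by blast
  \<comment> \<open>Refinement of a node: its coordinate \<open>c\<close> is set to the new sampling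
    point and its weight is multiplied by the new polynomial in that coordinate.\<close>
  define ex where "ex p r = (upd_coord c (fst p) (fst r), \<lambda>x. snd p x * poly (snd r) (coord c x))"
    for p :: "('r, 'd) cspace \<times> (('r, 'd) cspace \<Rightarrow> complex)" and r :: "complex \<times> complex poly"
  define zs where "zs = concat (map (\<lambda>p. map (ex p) ys) xs)"
  have xs1: "snd p \<in> mpolys" "c' \<in> I \<Longrightarrow> coord c' (fst p) \<in> V c'" if "p \<in> set xs" for p c'
    using xs(1) that by (auto simp: split_def)
  have mem: "snd u \<in> mpolys \<and> (\<forall>c'\<in>insert c I. coord c' (fst u) \<in> V c')" if u: "u \<in> set zs" for u
  proof -
    obtain p r where pr: "p \<in> set xs" "r \<in> set ys" "u = ex p r"
      using u unfolding zs_def by auto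
    have "snd u \<in> mpolys" unfolding pr(3) ex_def using xs1(1)[OF pr(1)] by (simp add: mpolys_mult mpolys_poly_coord)
    moreover have "fst r \<in> V c" using ys(1) pr(2) by blast
    ultimately show ?thesis using xs1(2)[OF pr(1)] by (auto simp: pr(3) ex_def coord_upd_coord)
  qed
  have est: "cmod (h x - (\<Sum>(a, v)\<leftarrow>zs. h (merge_coords (insert c I) a x) * v x)) \<le> e" if x: "x \<in> coord_box A" for x
  proof -
    have eqz: "(\<Sum>(a, v)\<leftarrow>zs. h (merge_coords (insert c I) a x) * v x)
        = (\<Sum>p\<leftarrow>xs. quad_sum ys (\<lambda>t. h (upd_coord c (merge_coords I (fst p) x) t)) (coord c x) * snd p x)"
    proof -
      have one: "(\<Sum>u\<leftarrow>map (ex p) ys. h (merge_coords (insert c I) (fst u) x) * snd u x)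
          = quad_sum ys (\<lambda>t. h (upd_coord c (merge_coords I (fst p) x) t)) (coord c x) * snd p x" for p
        unfolding quad_sum_def
      proof (induction ys)
        case (Cons r ys)
        then show ?case using insert.hyps by (cases r) (simp add: ex_def merge_coords_insert algebra_simps)
      qed simp
      show ?thesis
        unfolding zs_def split_def
      proof (induction xs)
        case (Cons p xs)
        then show ?case using one[of p] by simp
      qed simp
    qed
    have diff: "(\<Sum>(a, v)\<leftarrow>xs. h (merge_coords I a x) * v x) - (\<Sum>(a, v)\<leftarrow>zs. h (merge_coords (insert c I) a x) * v x)
        = (\<Sum>p\<leftarrow>xs. (h (merge_coords I (fst p) x) - quad_sum ys (\<lambda>t. h (upd_coord c (merge_coords I (fst p) x) t)) (coord c x)) * snd p x)"
      unfolding eqz by (simp add: split_def left_diff_distrib sum_list_subtractf)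
    have "cmod (\<Sum>p\<leftarrow>xs. (h (merge_coords I (fst p) x) - quad_sum ys (\<lambda>t. h (upd_coord c (merge_coords I (fst p) x) t)) (coord c x)) * snd p x)
        \<le> e' * (\<Sum>p\<leftarrow>xs. B p)"
    proof (rule norm_sum_list_le)
      fix p assume p: "p \<in> set xs"
      define f where "f t = h (upd_coord c (merge_coords I (fst p) x) t)" for t
      have inV: "upd_coord c (merge_coords I (fst p) x) t \<in> coord_box V" if "t \<in> V c" for t
      proof -
        have "coord c' (upd_coord c (merge_coords I (fst p) x) t) \<in> V c'" for c'
          using that xs1(2)[OF p] x A(4) by (auto simp: coord_upd_coord coord_merge_coords coord_box_def)
        then show ?thesis by (simp add: coord_box_def)
      qed
      have "f \<in> unit_hol (V c)"
        unfolding unit_hol_def f_def using sep_hol_slice[OF h(1) inV] h(2) inV by blast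
      moreover have "coord c x \<in> A c" using x by (simp add: coord_box_def)
      ultimately have "cmod (f (coord c x) - quad_sum ys f (coord c x)) \<le> e'" by (rule ys(2))
      moreover have "f (coord c x) = h (merge_coords I (fst p) x)"
        using upd_coord_coord[of c "merge_coords I (fst p) x"] insert.hyps by (simp add: f_def coord_merge_coords)
      ultimately have "cmod (h (merge_coords I (fst p) x) - quad_sum ys f (coord c x)) \<le> e'" by simp
      then show "cmod ((h (merge_coords I (fst p) x) - quad_sum ys (\<lambda>t. h (upd_coord c (merge_coords I (fst p) x) t)) (coord c x)) * snd p x) \<le> e' * B p"
        unfolding norm_mult f_def[symmetric] using B(2)[OF p x] e' by (intro mult_mono) auto
    qed
    also have "\<dots> \<le> e' * C" using e' by (intro mult_left_mono) (simp_all add: C_def)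
    also have "\<dots> = e / 2" using C by (simp add: e'_def)
    finally have "cmod ((\<Sum>(a, v)\<leftarrow>xs. h (merge_coords I a x) * v x) - (\<Sum>(a, v)\<leftarrow>zs. h (merge_coords (insert c I) a x) * v x)) \<le> e / 2"
      unfolding diff .
    from norm_triangle_mono[OF bspec[OF xs(2) x] this] show ?thesis by simp
  qed
  show ?case using mem est by (intro exI[of _ zs]) (auto simp: split_def)
qed

lemma mpolys_sum_list: "(\<And>p. p \<in> set xs \<Longrightarrow> f p \<in> mpolys) \<Longrightarrow> (\<lambda>x. \<Sum>p\<leftarrow>xs. f p x) \<in> mpolys"
  by (induction xs) (auto intro: mpolys_zero mpolys_add)

text \<open>When all coordinates are sampled, the values of \<open>h\<close> are constants, and the
  quadrature sum is a polynomial.\<close>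

theorem Runge_polydomain:
  fixes h :: "('r::finite, 'd::finite) cspace \<Rightarrow> complex"
  assumes A: "\<And>c. compact (A c)" "\<And>c. connected (- A c)" "\<And>c. open (V c)" "\<And>c. A c \<subseteq> V c"
    and h: "sep_hol (coord_box V) h" and e: "e > 0"
  shows "\<exists>p\<in>mpolys. \<forall>x\<in>coord_box A. cmod (h x - p x) \<le> e"
proof -
  \<comment> \<open>\<open>h\<close> may be unbounded on the box of \<open>V\<close>; on a compact
    intermediate box it is bounded and can be scaled into the unit ball.\<close>
  have "\<forall>c. \<exists>T. compact T \<and> T \<subseteq> V c \<and> A c \<subseteq> interior T"
  proof
    fix c
    obtain \<rho> T where T: "\<rho> > 0" "compact T" "T \<subseteq> V c" "\<And>y. y \<in> A c \<Longrightarrow> cball y \<rho> \<subseteq> T"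
      using compact_thickening[OF A(1,3,4)] by metis
    have "A c \<subseteq> interior T"
    proof
      fix y assume "y \<in> A c"
      then have "ball y \<rho> \<subseteq> T" using T(4) ball_subset_cball by blast
      then show "y \<in> interior T" using T(1) by (meson centre_in_ball interior_maximal open_ball subsetD)
    qed
    then show "\<exists>T. compact T \<and> T \<subseteq> V c \<and> A c \<subseteq> interior T" using T by blast
  qed
  then obtain T where T: "\<And>c. compact (T c)" "\<And>c. T c \<subseteq> V c" "\<And>c. A c \<subseteq> interior (T c)" by metis
  define V' where "V' c = interior (T c)" for c
  have V'T: "coord_box V' \<subseteq> coord_box T" by (rule coord_box_mono) (simp add: V'_def interior_subset)
  have TV: "coord_box T \<subseteq> coord_box V" by (rule coord_box_mono) (rule T)
  obtain B where B: "B > 0" "\<And>x. x \<in> coord_box T \<Longrightarrow> cmod (h x) \<le> B"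
    using sep_hol_bounded_on_compact[OF h compact_coord_box[of T, OF T(1)] TV] by blast
  define g where "g x = inverse (of_real B) * h x" for x
  have g: "sep_hol (coord_box V') g"
    unfolding g_def by (intro sep_hol_mult sep_hol_const sep_hol_subset[OF h]) (use V'T TV in blast)
  have g1: "cmod (g x) \<le> 1" if "x \<in> coord_box V'" for x
  proof -
    have "cmod (h x) \<le> B" using B(2) that V'T by blast
    then show ?thesis using B(1) by (simp add: g_def norm_divide divide_simps)
  qed
  have "e / B > 0" using e B by simp
  then obtain xs where xs: "\<forall>(a, v)\<in>set xs. v \<in> mpolys \<and> (\<forall>c\<in>UNIV. coord c a \<in> V' c)"
    "\<forall>x\<in>coord_box A. cmod (g x - (\<Sum>(a, v)\<leftarrow>xs. g (merge_coords UNIV a x) * v x)) \<le> e / B"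
    using iterated_quadrature[of A V' g UNIV "e / B", OF A(1,2) _ _ g g1] T(3) by (auto simp: V'_def)
  define p where "p = (\<lambda>x. of_real B * (\<Sum>(a, v)\<leftarrow>xs. g a * v x))"
  have "p \<in> mpolys"
    unfolding p_def split_def using xs(1) by (intro mpolys_cmult mpolys_sum_list) auto
  moreover have "cmod (h x - p x) \<le> e" if x: "x \<in> coord_box A" for x
  proof -
    have "h x - p x = of_real B * (g x - (\<Sum>(a, v)\<leftarrow>xs. g (merge_coords UNIV a x) * v x))"
      using B(1) by (simp add: g_def p_def merge_coords_UNIV right_diff_distrib)
    also have "cmod \<dots> \<le> B * (e / B)"
      unfolding norm_mult using B(1) xs(2) x by (intro mult_mono) auto
    finally show ?thesis using B(1) by simp
  qed
  ultimately show ?thesis by blast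
qed

lemma coord_derivs_bounded_on:
  fixes W :: "('r::finite + 'd::finite) list set"
  assumes "\<rho> > 0" "finite W"
  obtains A where "A > 0" "\<And>(F :: ('r, 'd) cspace \<Rightarrow> complex) S x B cs. open S \<Longrightarrow> sep_hol S F \<Longrightarrow> cball x \<rho> \<subseteq> S \<Longrightarrow>
    (\<And>y. y \<in> cball x \<rho> \<Longrightarrow> cmod (F y) \<le> B) \<Longrightarrow> cs \<in> W \<Longrightarrow> cmod (coord_derivs cs F x) \<le> A * B"
proof -
  have "\<exists>A>0. \<forall>(F :: ('r, 'd) cspace \<Rightarrow> complex) S x B. open S \<longrightarrow> sep_hol S F \<longrightarrow> cball x \<rho> \<subseteq> S \<longrightarrow>
    (\<forall>y\<in>cball x \<rho>. cmod (F y) \<le> B) \<longrightarrow> cmod (coord_derivs cs F x) \<le> A * B" for cs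
  proof -
    obtain A where A: "A > 0" "\<And>(F :: ('r, 'd) cspace \<Rightarrow> complex) S x B. open S \<Longrightarrow> sep_hol S F \<Longrightarrow> cball x \<rho> \<subseteq> S \<Longrightarrow>
      (\<And>y. y \<in> cball x \<rho> \<Longrightarrow> cmod (F y) \<le> B) \<Longrightarrow> cmod (coord_derivs cs F x) \<le> A * B"
      using coord_derivs_bound[OF assms(1), of cs] by blast
    show ?thesis by (intro exI[of _ A] conjI allI impI A) simp_all
  qed
  then obtain A where A: "\<And>cs. A cs > 0" "\<And>cs (F :: ('r, 'd) cspace \<Rightarrow> complex) S x B. open S \<Longrightarrow> sep_hol S F \<Longrightarrow> cball x \<rho> \<subseteq> S \<Longrightarrow>
    \<forall>y\<in>cball x \<rho>. cmod (F y) \<le> B \<Longrightarrow> cmod (coord_derivs cs F x) \<le> A cs * B"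
    by metis
  define A' where "A' = 1 + (\<Sum>cs\<in>W. A cs)"
  have A': "A cs \<le> A'" if "cs \<in> W" for cs
    using member_le_sum[OF that _ assms(2), of A] A(1) by (simp add: A'_def less_imp_le)
  show thesis
  proof (rule that[of A'])
    show "A' > 0" unfolding A'_def using A(1) by (intro add_pos_nonneg sum_nonneg) (auto simp: less_imp_le)
    fix F :: "('r, 'd) cspace \<Rightarrow> complex" and S x B cs
    assume F: "open S" "sep_hol S F" "cball x \<rho> \<subseteq> S" and B: "\<And>y. y \<in> cball x \<rho> \<Longrightarrow> cmod (F y) \<le> B" and cs: "cs \<in> W"
    have "0 \<le> cmod (F x)" by simp
    also have "\<dots> \<le> B" using assms(1) by (intro B) simp
    finally have "B \<ge> 0" .
    have "cmod (coord_derivs cs F x) \<le> A cs * B" using B by (intro A(2)[OF F]) blast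
    also have "\<dots> \<le> A' * B" using A'[OF cs] \<open>B \<ge> 0\<close> by (rule mult_right_mono)
    finally show "cmod (coord_derivs cs F x) \<le> A' * B" .
  qed
qed

lemma tube_vprod:
  fixes K :: "'n::finite \<Rightarrow> complex set"
  assumes K: "\<And>i. compact (K i)" and V: "open V" "vprod K \<subseteq> V" and ne: "vprod K \<noteq> {}"
  obtains U where "\<And>i. open (U i)" "\<And>i. K i \<subseteq> U i" "vprod U \<subseteq> V"
proof -
  obtain e where e: "e > 0" "(\<Union>x\<in>vprod K. ball x e) \<subseteq> V"
    using compact_subset_open_imp_ball_epsilon_subset[OF compact_vprod[of K, OF K] V] by blast
  \<comment> \<open>The distance in the product is at most the sum of the coordinate distances,
    which is then below \<open>e\<close>.\<close>
  define d where "d = e / real CARD('n)"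
  have d: "d > 0" using e by (simp add: d_def)
  define U where "U i = (\<Union>k\<in>K i. ball k d)" for i
  show thesis
  proof (rule that[of U])
    show "open (U i)" for i unfolding U_def by (intro open_UN) auto
    show "K i \<subseteq> U i" for i unfolding U_def using d by auto
    show "vprod U \<subseteq> V"
    proof
      fix x assume "x \<in> vprod U"
      then have "\<forall>i. \<exists>k. k \<in> K i \<and> dist k (x $ i) < d" by (auto simp: vprod_def U_def)
      then obtain k where k: "\<And>i. k i \<in> K i" "\<And>i. dist (k i) (x $ i) < d" by metis
      define y where "y = (\<chi> i. k i)"
      have "dist y x \<le> (\<Sum>i\<in>UNIV. dist (y $ i) (x $ i))"
        unfolding dist_vec_def by (rule L2_set_le_sum) simp
      also have "\<dots> < (\<Sum>i\<in>(UNIV :: 'n set). d)" using k(2) by (intro sum_strict_mono) (auto simp: y_def)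
      also have "\<dots> = e" by (simp add: d_def)
      finally have "x \<in> ball y e" by simp
      moreover have "y \<in> vprod K" using k(1) by (simp add: vprod_def y_def)
      ultimately show "x \<in> V" using e(2) by blast
    qed
  qed
qed

text \<open>Approximation on a box that contains balls of fixed radius around
  \<open>L \<times> vprod K\<close> controls derivatives there by Cauchy's inequality. In the
  \<open>w\<close>-coordinates such a box comes from the exhaustion of \<open>G i\<close>, in the
  \<open>z\<close>-coordinates from filled neighbourhoods of \<open>K j\<close>; both have connected
  complements.\<close>

lemma mpoly_approx_derivs:
  fixes G :: "'r::finite \<Rightarrow> complex set" and K :: "'d::finite \<Rightarrow> complex set"
  assumes G: "\<And>i. simply_connected_domain (G i)" and K: "\<And>i. compact (K i)" "\<And>i. connected (- K i)"
    and V: "open V" "vprod K \<subseteq> V" and L: "compact L" "L \<subseteq> vprod G" and h: "sep_hol (vprod G \<times> V) h"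
    and W: "finite W" and e: "e > 0"
  shows "\<exists>p\<in>mpolys. \<forall>x\<in>L \<times> vprod K. \<forall>cs\<in>W. cmod (coord_derivs cs (\<lambda>x. h x - p x) x) \<le> e"
proof (cases "vprod K = {}")
  case True
  then show ?thesis using mpolys_zero by auto
next
  case False
  obtain U where U: "\<And>i. open (U i)" "\<And>i. K i \<subseteq> U i" "vprod U \<subseteq> V"
    using tube_vprod[OF K(1) V False] by metis
  define Vc where "Vc c = (case c of Inl i \<Rightarrow> G i | Inr j \<Rightarrow> U j)" for c
  define P where "P c = (case c of Inl i \<Rightarrow> (\<lambda>x. x $ i) ` L | Inr j \<Rightarrow> K j)" for c
  have Gop: "open (G i)" for i using G by (simp add: simply_connected_domain_def)
  have Vop: "open (Vc c)" for c using Gop U(1) by (cases c) (auto simp: Vc_def)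
  have "\<exists>T \<rho>. compact T \<and> connected (- T) \<and> T \<subseteq> Vc c \<and> \<rho> > 0 \<and> (\<forall>z\<in>P c. cball z \<rho> \<subseteq> T)" for c
  proof (cases c)
    case (Inl i)
    have "compact (P c)" "P c \<subseteq> G i"
      using L unfolding P_def Inl by (auto intro!: compact_continuous_image continuous_intros simp: vprod_def)
    then obtain \<rho> T where T: "\<rho> > 0" "compact T" "T \<subseteq> G i" "\<And>y. y \<in> P c \<Longrightarrow> cball y \<rho> \<subseteq> T"
      using compact_thickening[OF _ Gop] by metis
    obtain E where E: "\<And>n. compact (E n)" "\<And>n. connected (- E n)" "\<And>n. E n \<subseteq> G i" "\<And>n. E n \<subseteq> E (Suc n)"
      "\<And>C. compact C \<Longrightarrow> C \<subseteq> G i \<Longrightarrow> \<exists>n. C \<subseteq> E n"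
      using simply_connected_exhaustion[OF G] by metis
    obtain n where n: "T \<subseteq> E n" using E(5)[OF T(2,3)] by blast
    show ?thesis
      by (rule exI[of _ "E n"], rule exI[of _ \<rho>]) (use E(1-3)[of n] n T(1,4) in \<open>auto simp: Vc_def Inl\<close>)
  next
    case (Inr j)
    obtain T \<rho> where "compact T" "connected (- T)" "T \<subseteq> U j" "\<rho> > 0" "\<And>z. z \<in> K j \<Longrightarrow> cball z \<rho> \<subseteq> T"
      using hull_thickening[OF K(1)[of j] K(2)[of j] U(1)[of j] U(2)[of j]] by metis
    then show ?thesis by (intro exI[of _ T] exI[of _ \<rho>]) (auto simp: Vc_def P_def Inr)
  qed
  then obtain A \<rho>c where A: "\<And>c. compact (A c)" "\<And>c. connected (- A c)" "\<And>c. A c \<subseteq> Vc c"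
    and \<rho>c: "\<And>c. \<rho>c c > 0" "\<And>c z. z \<in> P c \<Longrightarrow> cball z (\<rho>c c) \<subseteq> A c"
    by metis
  define \<rho> where "\<rho> = Min (range \<rho>c)"
  have \<rho>: "\<rho> > 0" "\<And>c. \<rho> \<le> \<rho>c c" using \<rho>c(1) by (auto simp: \<rho>_def)
  have cb: "cball x \<rho> \<subseteq> coord_box A" if "x \<in> L \<times> vprod K" for x
  proof
    fix y assume y: "y \<in> cball x \<rho>"
    have "coord c y \<in> A c" for c
    proof -
      have "coord c x \<in> P c" using that by (cases c) (auto simp: P_def vprod_def)
      moreover have "dist (coord c x) (coord c y) \<le> \<rho>c c"
        using norm_coord_le[of c "x - y"] y \<rho>(2)[of c] by (simp add: dist_norm)
      ultimately show ?thesis using \<rho>c(2) by fastforce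
    qed
    then show "y \<in> coord_box A" by (simp add: coord_box_def)
  qed
  have boxV: "coord_box Vc \<subseteq> vprod G \<times> V" using U(3) by (auto simp: coord_box_eq Vc_def)
  have hb: "sep_hol (coord_box Vc) h" using h boxV by (rule sep_hol_subset)
  obtain B where B: "B > 0" "\<And>(F :: ('r, 'd) cspace \<Rightarrow> complex) S x M cs. open S \<Longrightarrow> sep_hol S F \<Longrightarrow> cball x \<rho> \<subseteq> S \<Longrightarrow>
    (\<And>y. y \<in> cball x \<rho> \<Longrightarrow> cmod (F y) \<le> M) \<Longrightarrow> cs \<in> W \<Longrightarrow> cmod (coord_derivs cs F x) \<le> B * M"
    using coord_derivs_bounded_on[OF \<rho>(1) W] by metis
  have "e / B > 0" using e B by simp
  then obtain p where p: "p \<in> mpolys" "\<forall>x\<in>coord_box A. cmod (h x - p x) \<le> e / B"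
    using Runge_polydomain[of A Vc h "e / B", OF A(1,2) Vop A(3) hb] by blast
  have AV: "coord_box A \<subseteq> coord_box Vc" by (rule coord_box_mono) (rule A)
  have "cmod (coord_derivs cs (\<lambda>x. h x - p x) x) \<le> e" if x: "x \<in> L \<times> vprod K" and cs: "cs \<in> W" for x cs
  proof -
    have "cmod (coord_derivs cs (\<lambda>x. h x - p x) x) \<le> B * (e / B)"
    proof (rule B(2)[OF open_coord_box[of Vc, OF Vop]])
      show "sep_hol (coord_box Vc) (\<lambda>x. h x - p x)" by (intro sep_hol_diff hb sep_hol_mpoly p)
      show "cball x \<rho> \<subseteq> coord_box Vc" using cb[OF x] AV by blast
      show "cmod (h y - p y) \<le> e / B" if "y \<in> cball x \<rho>" for y using p(2) cb[OF x] that by blast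
    qed (rule cs)
    then show ?thesis using B(1) by simp
  qed
  then show ?thesis using p(1) by blast
qed

section \<open>Separation by a polynomial in one coordinate\<close>

lemma poly_approximable_Runge:
  assumes "compact K" "connected (- K)" "open V" "K \<subseteq> V" "f \<in> unit_hol V"
  shows "poly_approximable K f"
  unfolding poly_approximable_def
proof (intro allI impI)
  fix e :: real assume e: "e > 0"
  obtain xs where xs: "\<And>z. z \<in> K \<Longrightarrow> cmod (f z - quad_sum xs f z) \<le> e"
    using Runge_quadrature[OF assms(1-4), unfolded quadrature_def, rule_format, OF e] assms(5) by blast
  have "quad_sum xs f z = poly (\<Sum>(a, q)\<leftarrow>xs. smult (f a) q) z" for z
    unfolding quad_sum_def by (induction xs) auto
  then show "\<exists>p. \<forall>z\<in>K. cmod (f z - poly p z) \<le> e" using xs by (intro exI ballI) simp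
qed

text \<open>The function equal to 1 near \<open>K\<close> and 0 near \<open>M\<close> is holomorphic
  on disjoint open sets, and the union of the two compacts has connected complement, so Runge's
  theorem approximates it.\<close>

lemma separating_poly:
  fixes K M :: "complex set"
  assumes K: "compact K" "connected (- K)" and M: "compact M" "connected (- M)" and disj: "K \<inter> M = {}" and e: "e > 0"
  shows "\<exists>q. (\<forall>z\<in>K. cmod (1 - poly q z) \<le> e) \<and> (\<forall>z\<in>M. cmod (poly q z) \<le> e)"
proof -
  obtain O1 O2 where O: "open O1" "open O2" "K \<subseteq> O1" "M \<subseteq> O2" "O1 \<inter> O2 = {}"
    using separation_normal[OF compact_imp_closed[OF K(1)] compact_imp_closed[OF M(1)] disj] by blast
  define f :: "complex \<Rightarrow> complex" where "f z = (if z \<in> O1 then 1 else 0)" for z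
  have "f holomorphic_on O1" by (rule holomorphic_transform[of "\<lambda>_. 1"]) (auto simp: f_def)
  moreover have "f holomorphic_on O2" by (rule holomorphic_transform[of "\<lambda>_. 0"]) (use O(5) in \<open>auto simp: f_def\<close>)
  ultimately have "f \<in> unit_hol (O1 \<union> O2)"
    using O(1,2) by (auto simp: unit_hol_def f_def holomorphic_on_Un)
  then have "poly_approximable (K \<union> M) f"
    using O K M by (intro poly_approximable_Runge[of _ "O1 \<union> O2"] connected_Compl_Un_disjoint compact_Un disj) auto
  then obtain q where q: "\<forall>z\<in>K \<union> M. cmod (f z - poly q z) \<le> e" using e unfolding poly_approximable_def by blast
  have "cmod (1 - poly q z) \<le> e" if "z \<in> K" for z
    using bspec[OF q, of z] that O(3) by (auto simp: f_def)
  moreover have "cmod (poly q z) \<le> e" if "z \<in> M" for z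
  proof -
    have "f z = 0" using that O(4,5) by (auto simp: f_def)
    then show ?thesis using bspec[OF q, of z] that by simp
  qed
  ultimately show ?thesis by blast
qed

text \<open>Multiplying \<open>u\<close> by a polynomial in the coordinate \<open>i0\<close> keeps
  it over \<open>K\<close> and suppresses it on \<open>C\<close>. The factor is close to 1 even on a
  neighbourhood of \<open>K i0\<close>, so \<open>u - P\<close> is small there and Cauchy's
  inequality covers the derivatives in \<open>W\<close>.\<close>

lemma mpoly_localize:
  fixes K :: "'d::finite \<Rightarrow> complex set" and u :: "('r::finite, 'd) cspace \<Rightarrow> complex"
  assumes u: "u \<in> mpolys" and K: "\<And>i. compact (K i)" "connected (- K i0)" and M0: "compact M0" "connected (- M0)" "K i0 \<inter> M0 = {}"
    and C: "compact C" "\<And>x. x \<in> C \<Longrightarrow> snd x $ i0 \<in> M0" and L: "compact L" and W: "finite W" and \<delta>: "\<delta> > 0" and e: "e > 0"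
  shows "\<exists>P\<in>mpolys. (\<forall>x\<in>C. cmod (P x) \<le> \<delta>) \<and> (\<forall>x\<in>L \<times> vprod K. \<forall>cs\<in>W. cmod (coord_derivs cs (\<lambda>x. u x - P x) x) \<le> e)"
proof -
  have "open (- M0)" "K i0 \<subseteq> - M0" using M0 by (auto simp: compact_imp_closed open_Compl)
  then obtain K' r1 where K': "compact K'" "connected (- K')" "K' \<subseteq> - M0" "r1 > 0" "\<And>z. z \<in> K i0 \<Longrightarrow> cball z r1 \<subseteq> K'"
    using hull_thickening[OF K(1)[of i0] K(2)] by metis
  have "compact (L \<times> vprod K)" using L K(1) by (intro compact_Times compact_vprod)
  then obtain r2 X where X: "r2 > 0" "compact X" "\<And>y. y \<in> L \<times> vprod K \<Longrightarrow> cball y r2 \<subseteq> X"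
    using compact_thickening[OF _ open_UNIV subset_UNIV] by metis
  define \<rho> where "\<rho> = min r1 r2"
  have \<rho>: "\<rho> > 0" using K' X by (simp add: \<rho>_def)
  obtain B where B: "B > 0" "\<And>(F :: ('r, 'd) cspace \<Rightarrow> complex) S x M cs. open S \<Longrightarrow> sep_hol S F \<Longrightarrow> cball x \<rho> \<subseteq> S \<Longrightarrow>
    (\<And>y. y \<in> cball x \<rho> \<Longrightarrow> cmod (F y) \<le> M) \<Longrightarrow> cs \<in> W \<Longrightarrow> cmod (coord_derivs cs F x) \<le> B * M"
    using coord_derivs_bounded_on[OF \<rho> W] by metis
  obtain Q where Q: "Q > 0" "\<And>x. x \<in> X \<union> C \<Longrightarrow> cmod (u x) \<le> Q"
    using sep_hol_bounded_on_compact[OF sep_hol_mpoly[OF u] compact_Un[OF X(2) C(1)] subset_UNIV] by blast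
  \<comment> \<open>The first term makes the product at most \<delta> on \<open>C\<close>; the
    second absorbs the size \<open>Q\<close> of \<open>u\<close> and the Cauchy constant
    \<open>B\<close> over \<open>K\<close>.\<close>
  define \<eta> where "\<eta> = min (\<delta> / Q) (e / (B * Q))"
  have \<eta>: "\<eta> > 0" "Q * \<eta> \<le> \<delta>" "B * (Q * \<eta>) \<le> e"
  proof -
    show "\<eta> > 0" using \<delta> e Q B by (simp add: \<eta>_def)
    have "Q * \<eta> \<le> Q * (\<delta> / Q)" using Q by (intro mult_left_mono) (simp_all add: \<eta>_def)
    then show "Q * \<eta> \<le> \<delta>" using Q by simp
    have "(B * Q) * \<eta> \<le> (B * Q) * (e / (B * Q))" using Q B by (intro mult_left_mono) (simp_all add: \<eta>_def)
    then show "B * (Q * \<eta>) \<le> e" using Q B by simp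
  qed
  obtain q where q: "\<forall>z\<in>K'. cmod (1 - poly q z) \<le> \<eta>" "\<forall>z\<in>M0. cmod (poly q z) \<le> \<eta>"
    using separating_poly[OF K'(1,2) M0(1,2) _ \<eta>(1)] K'(3) by blast
  define P where "P x = u x * poly q (coord (Inr i0) x)" for x
  have P: "P \<in> mpolys" unfolding P_def by (intro mpolys_mult u mpolys_poly_coord)
  have "cmod (P x) \<le> \<delta>" if x: "x \<in> C" for x
  proof -
    have "cmod (P x) \<le> Q * \<eta>"
      unfolding P_def norm_mult using Q x q(2) C(2)[OF x] by (intro mult_mono) auto
    then show ?thesis using \<eta>(2) by simp
  qed
  moreover have "cmod (coord_derivs cs (\<lambda>x. u x - P x) x) \<le> e" if x: "x \<in> L \<times> vprod K" and cs: "cs \<in> W" for x cs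
  proof -
    have "cmod (coord_derivs cs (\<lambda>x. u x - P x) x) \<le> B * (Q * \<eta>)"
    proof (rule B(2)[OF open_UNIV])
      show "sep_hol UNIV (\<lambda>x. u x - P x)" by (intro sep_hol_diff sep_hol_mpoly u P)
      fix y assume y: "y \<in> cball x \<rho>"
      have "y \<in> cball x r2" using y by (simp add: \<rho>_def)
      then have "y \<in> X" using X(3)[OF x] by blast
      have "dist (coord (Inr i0) x) (coord (Inr i0) y) \<le> r1"
        using norm_coord_le[of "Inr i0" "x - y"] y by (simp add: dist_norm \<rho>_def)
      moreover have "coord (Inr i0) x \<in> K i0" using x by (auto simp: vprod_def)
      ultimately have "coord (Inr i0) y \<in> K'" using K'(5)[of "coord (Inr i0) x"] by (auto simp del: coord.simps)
      then have "cmod (1 - poly q (coord (Inr i0) y)) \<le> \<eta>" using q(1) by blast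
      moreover have "u y - P y = u y * (1 - poly q (coord (Inr i0) y))" unfolding P_def by (simp only: right_diff_distrib mult_1_right)
      ultimately show "cmod (u y - P y) \<le> Q * \<eta>"
        using Q(1) Q(2)[of y] \<open>y \<in> X\<close> by (simp only: norm_mult) (intro mult_mono, auto)
    qed (use cs in simp_all)
    then show ?thesis using \<eta>(3) by simp
  qed
  ultimately show ?thesis using P by blast
qed

text \<open>Codes are finite lists of rational coefficients with exponents, so they form a countable
  type; several codes for one polynomial do no harm.\<close>

primrec qpoly :: "(rat \<times> rat \<times> (nat ^ 'r) \<times> (nat ^ 'd)) list \<Rightarrow> ('r::finite, 'd::finite) cspace \<Rightarrow> complex" where
  "qpoly [] = (\<lambda>x. 0)"
| "qpoly (t # ts) = (case t of (s, s', a, b) \<Rightarrow> (\<lambda>x. Complex (of_rat s) (of_rat s') * monomial a b x + qpoly ts x))"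

lemma qpoly_mpolys: "qpoly ts \<in> mpolys"
  by (induction ts) (auto intro!: mpolys_zero mpolys_add mpolys_cmult mpolys_monomial)

lemma rat_complex_dense:
  assumes "e > 0"
  shows "\<exists>s s'. cmod (c - Complex (of_rat s) (of_rat s')) \<le> e"
proof -
  obtain s where s: "Re c < of_rat s" "of_rat s < Re c + e / 2" using of_rat_dense[of "Re c" "Re c + e / 2"] assms by auto
  obtain s' where s': "Im c < of_rat s'" "of_rat s' < Im c + e / 2" using of_rat_dense[of "Im c" "Im c + e / 2"] assms by auto
  have "cmod (c - Complex (of_rat s) (of_rat s')) \<le> \<bar>Re (c - Complex (of_rat s) (of_rat s'))\<bar> + \<bar>Im (c - Complex (of_rat s) (of_rat s'))\<bar>"
    by (rule cmod_le)
  also have "\<dots> \<le> e" using s s' by simp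
  finally show ?thesis by blast
qed

lemma qpoly_dense:
  fixes p :: "('r::finite, 'd::finite) cspace \<Rightarrow> complex"
  assumes p: "p \<in> mpolys" and X: "compact X" and W: "finite W"
  shows "e > 0 \<Longrightarrow> \<exists>ts. \<forall>x\<in>X. \<forall>cs\<in>W. cmod (coord_derivs cs (\<lambda>x. p x - qpoly ts x) x) \<le> e"
  using p
proof (induction arbitrary: e rule: mpolys_induct)
  case zero
  have "coord_derivs cs (\<lambda>x :: ('r, 'd) cspace. 0 - qpoly [] x) x = 0" for cs x
    using coord_derivs_cmult[OF open_UNIV sep_hol_const, of x cs 0 0] by simp
  then show ?case using zero by (intro exI[of _ "[]"]) simp
next
  case (step c a b p)
  obtain ts where ts: "\<forall>x\<in>X. \<forall>cs\<in>W. cmod (coord_derivs cs (\<lambda>x. p x - qpoly ts x) x) \<le> e / 2"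
    using step.IH[of "e / 2"] step.prems by auto
  have "\<exists>B>0. \<forall>x\<in>X. cmod (coord_derivs cs (monomial a b) x) \<le> B" for cs :: "('r + 'd) list"
    by (rule sep_hol_bounded_on_compact[OF sep_hol_coord_derivs[OF open_UNIV sep_hol_monomial] X subset_UNIV])
  then obtain B where B: "\<And>cs. B cs > 0" "\<And>cs x. x \<in> X \<Longrightarrow> cmod (coord_derivs cs (monomial a b) x) \<le> B cs" by metis
  define B' where "B' = 1 + (\<Sum>cs\<in>W. B cs)"
  have B': "B' > 0" "\<And>cs. cs \<in> W \<Longrightarrow> B cs \<le> B'"
    using B(1) member_le_sum[OF _ _ W, of _ B] unfolding B'_def
    by (auto simp: less_imp_le intro!: add_pos_nonneg sum_nonneg add_increasing)
  obtain s s' where s: "cmod (c - Complex (of_rat s) (of_rat s')) \<le> e / (2 * B')"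
    using rat_complex_dense[of "e / (2 * B')" c] step.prems B'(1) by auto
  define k where "k = c - Complex (of_rat s) (of_rat s')"
  have "cmod (coord_derivs cs (\<lambda>x. (c * monomial a b x + p x) - qpoly ((s, s', a, b) # ts) x) x) \<le> e" if x: "x \<in> X" and cs: "cs \<in> W" for x cs
  proof -
    have "(\<lambda>x. (c * monomial a b x + p x) - qpoly ((s, s', a, b) # ts) x) = (\<lambda>x. k * monomial a b x + (p x - qpoly ts x))"
      by (rule ext) (simp add: k_def algebra_simps)
    moreover have "coord_derivs cs (\<lambda>x. k * monomial a b x + (p x - qpoly ts x)) x
        = coord_derivs cs (\<lambda>x. k * monomial a b x) x + coord_derivs cs (\<lambda>x. p x - qpoly ts x) x"
      by (rule coord_derivs_add[OF open_UNIV sep_hol_mult[OF sep_hol_const sep_hol_monomial]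
            sep_hol_diff[OF sep_hol_mpoly[OF step.hyps] sep_hol_mpoly[OF qpoly_mpolys]] UNIV_I])
    moreover have "coord_derivs cs (\<lambda>x. k * monomial a b x) x = k * coord_derivs cs (monomial a b) x"
      by (rule coord_derivs_cmult[OF open_UNIV sep_hol_monomial UNIV_I])
    moreover have "cmod (k * coord_derivs cs (monomial a b) x) \<le> e / (2 * B') * B'"
      unfolding norm_mult k_def using s B(2)[OF x, of cs] B'(2)[OF cs] step.prems B'(1) by (intro mult_mono) auto
    moreover have "e / (2 * B') * B' = e / 2" using B'(1) by simp
    ultimately show ?thesis
      using norm_triangle_mono[of "k * coord_derivs cs (monomial a b) x" "e / 2" "coord_derivs cs (\<lambda>x. p x - qpoly ts x) x" "e / 2"] ts x cs by simp
  qed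
  then show ?case by blast
qed

section \<open>Generic sequences of holomorphic functions\<close>

text \<open>Weierstrass's theorem on slices: a closed disc in a slice is a compact subset of
  \<open>S\<close>, so the given convergence restricts to it.\<close>

lemma sep_hol_uniform_limit:
  assumes S: "open S" and g: "\<And>m. sep_hol S (g m)"
    and lim: "\<And>C. compact C \<Longrightarrow> C \<subseteq> S \<Longrightarrow> uniform_limit C g f sequentially"
  shows "sep_hol S f"
proof (rule sep_holI[OF S])
  show "continuous_on S f"
    unfolding continuous_on_eq_continuous_at[OF S]
  proof
    fix x assume x: "x \<in> S"
    obtain r where r: "r > 0" "cball x r \<subseteq> S" using S x by (meson open_contains_cball)
    have "continuous_on (cball x r) f"
    proof (rule uniform_limit_theorem[OF _ lim[OF compact_cball r(2)]])
      show "\<forall>\<^sub>F m in sequentially. continuous_on (cball x r) (g m)"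
      proof (intro always_eventually allI)
        show "continuous_on (cball x r) (g m)" for m
          using g[of m] continuous_on_subset[OF _ r(2)] unfolding sep_hol_def by blast
      qed
    qed simp
    moreover have "x \<in> interior (cball x r)" using r(1) by simp
    ultimately show "isCont f x" by (rule continuous_on_interior)
  qed
  fix x c and T :: "complex set" assume T: "open T" "\<And>t. t \<in> T \<Longrightarrow> upd_coord c x t \<in> S"
  show "(\<lambda>t. f (upd_coord c x t)) holomorphic_on T"
  proof (rule holomorphic_uniform_sequence[OF T(1)])
    show "(\<lambda>t. g m (upd_coord c x t)) holomorphic_on T" for m by (rule sep_hol_slice[OF g T(2)])
    fix t0 assume "t0 \<in> T"
    then obtain d where d: "d > 0" "cball t0 d \<subseteq> T" using T(1) by (meson open_contains_cball)
    define C where "C = (\<lambda>t. upd_coord c x t) ` cball t0 d"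
    have "compact C" unfolding C_def by (intro compact_continuous_image continuous_intros) auto
    moreover have "C \<subseteq> S" using T(2) d(2) by (auto simp: C_def)
    ultimately have ul: "uniform_limit C g f sequentially" by (rule lim)
    have "uniform_limit (cball t0 d) (\<lambda>m t. g m (upd_coord c x t)) (\<lambda>t. f (upd_coord c x t)) sequentially"
      using ul unfolding uniform_limit_iff C_def by simp
    then show "\<exists>d>0. cball t0 d \<subseteq> T \<and> uniform_limit (cball t0 d) (\<lambda>m t. g m (upd_coord c x t)) (\<lambda>t. f (upd_coord c x t)) sequentially"
      using d by blast
  qed
qed

text \<open>A Baire category argument in the space of sequences of holomorphic functions: a condition \<open>P\<close>
  is allowed when every sequence of polynomials can be moved, by little in its first \<open>J\<close> members, to the
  centre of a neighbourhood on which \<open>P\<close> holds. The stage is a quadruple of a polynomial sequence, a radius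
  and the indices of the compact set and of the members that are controlled.\<close>

lemma generic_sequence:
  fixes X :: "nat \<Rightarrow> ('r::finite, 'd::finite) cspace set"
  assumes S: "open S" and X: "\<And>n. X n \<subseteq> X (Suc n)" "\<And>C. compact C \<Longrightarrow> C \<subseteq> S \<Longrightarrow> \<exists>n. C \<subseteq> X n" "\<And>n. X n \<subseteq> S"
    and \<P>: "countable \<P>" "\<P> \<noteq> {}"
    and step: "\<And>P (g :: nat \<Rightarrow> ('r, 'd) cspace \<Rightarrow> complex) e n J. P \<in> \<P> \<Longrightarrow> (\<And>j. g j \<in> mpolys) \<Longrightarrow> e > 0 \<Longrightarrow>
      \<exists>g' e' n' J'. (\<forall>j. g' j \<in> mpolys) \<and> (\<forall>j<J. \<forall>x\<in>X n. cmod (g' j x - g j x) \<le> e) \<and> e' > 0 \<and>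
        (\<forall>f. (\<forall>j. sep_hol S (f j)) \<and> (\<forall>j<J'. \<forall>x\<in>X n'. cmod (f j x - g' j x) \<le> e') \<longrightarrow> P f)"
  shows "\<exists>f. (\<forall>j. sep_hol S (f j)) \<and> (\<forall>P\<in>\<P>. P f)"
proof -
  have Xmono: "X m \<subseteq> X n" if "m \<le> n" for m n using lift_Suc_mono_le[of X, OF X(1) that] .
  define P where "P k = from_nat_into \<P> k" for k
  have Prange: "range P = \<P>" unfolding P_def using range_from_nat_into[OF \<P>(2,1)] by simp
  define inv where "inv = (\<lambda>(g :: nat \<Rightarrow> ('r, 'd) cspace \<Rightarrow> complex, e :: real, n :: nat, J :: nat). (\<forall>j. g j \<in> mpolys) \<and> e > 0)"
  \<comment> \<open>Displacement and new radius are each at most half of the old radius, so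
    successive neighbourhoods are nested. The bounds by \<open>Suc k\<close> ensure that every
    compact set and every member is eventually controlled.\<close>
  define R where "R = (\<lambda>k (g :: nat \<Rightarrow> ('r, 'd) cspace \<Rightarrow> complex, e :: real, n :: nat, J :: nat) (g', e', n', J').
    (\<forall>j<J. \<forall>x\<in>X n. cmod (g' j x - g j x) \<le> e / 2) \<and> e' \<le> e / 2 \<and> Suc k \<le> n' \<and> n \<le> n' \<and> Suc k \<le> J' \<and> J \<le> J' \<and>
    (\<forall>f. (\<forall>j. sep_hol S (f j)) \<and> (\<forall>j<J'. \<forall>x\<in>X n'. cmod (f j x - g' j x) \<le> e') \<longrightarrow> P k f))"
  have "\<exists>s. \<forall>k. inv (s k) \<and> R k (s k) (s (Suc k))"
  proof (rule dependent_nat_choice)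
    show "\<exists>x. inv x" by (rule exI[of _ "(\<lambda>j x. 0, 1, 0, 0)"]) (simp add: inv_def mpolys_zero)
    fix x k assume x: "inv x"
    obtain g e n J where xe: "x = (g, e, n, J)" by (cases x)
    have g: "\<And>j. g j \<in> mpolys" and e: "e > 0" using x by (auto simp: inv_def xe)
    have "P k \<in> \<P>" using Prange by blast
    from step[where g = g and n = n and J = J, OF this g half_gt_zero[OF e]] obtain g' e' n' J' where 1: "\<forall>j. g' j \<in> mpolys"
      "\<forall>j<J. \<forall>x\<in>X n. cmod (g' j x - g j x) \<le> e / 2" "e' > 0"
      "\<forall>f. (\<forall>j. sep_hol S (f j)) \<and> (\<forall>j<J'. \<forall>x\<in>X n'. cmod (f j x - g' j x) \<le> e') \<longrightarrow> P k f"
      by (elim exE conjE) rule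
    define n1 J1 where "n1 = max (max n n') (Suc k)" and "J1 = max (max J J') (Suc k)"
    have "P k f" if f: "\<forall>j. sep_hol S (f j)" "\<forall>j<J1. \<forall>x\<in>X n1. cmod (f j x - g' j x) \<le> min e' (e / 2)" for f
    proof -
      have "\<forall>j<J'. \<forall>x\<in>X n'. cmod (f j x - g' j x) \<le> e'"
      proof (intro allI impI ballI)
        fix j x assume "j < J'" "x \<in> X n'"
        moreover have "n' \<le> n1" by (simp add: n1_def)
        ultimately have "j < J1" "x \<in> X n1" using Xmono[of n' n1] by (auto simp: J1_def)
        then show "cmod (f j x - g' j x) \<le> e'" using f(2) by fastforce
      qed
      then show ?thesis using 1(4) f(1) by blast
    qed
    moreover have "min e' (e / 2) \<le> e / 2" "Suc k \<le> n1" "n \<le> n1" "Suc k \<le> J1" "J \<le> J1"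
      by (auto simp: n1_def J1_def le_max_iff_disj)
    ultimately have "R k x (g', min e' (e / 2), n1, J1)"
      unfolding R_def xe prod.case using 1(2) by blast
    moreover have "inv (g', min e' (e / 2), n1, J1)" using 1(1,3) e by (simp add: inv_def)
    ultimately show "\<exists>y. inv y \<and> R k x y" by blast
  qed
  then obtain s where s: "\<And>k. inv (s k)" "\<And>k. R k (s k) (s (Suc k))" by blast
  define g e n J where "g k = fst (s k)" and "e k = fst (snd (s k))" and "n k = fst (snd (snd (s k)))" and "J k = snd (snd (snd (s k)))" for k
  have sk: "s k = (g k, e k, n k, J k)" for k by (simp add: g_def e_def n_def J_def)
  have poly: "g k j \<in> mpolys" and epos: "e k > 0" for k j using s(1)[of k] by (auto simp: sk inv_def)
  have st: "\<forall>j<J k. \<forall>x\<in>X (n k). cmod (g (Suc k) j x - g k j x) \<le> e k / 2" "e (Suc k) \<le> e k / 2"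
    "Suc k \<le> n (Suc k)" "n k \<le> n (Suc k)" "Suc k \<le> J (Suc k)" "J k \<le> J (Suc k)"
    "\<And>f. (\<forall>j. sep_hol S (f j)) \<Longrightarrow> (\<forall>j<J (Suc k). \<forall>x\<in>X (n (Suc k)). cmod (f j x - g (Suc k) j x) \<le> e (Suc k)) \<Longrightarrow> P k f" for k
    using s(2)[of k] unfolding sk R_def by auto
  have nmono: "n k \<le> n m" and Jmono: "J k \<le> J m" if "k \<le> m" for k m
    using lift_Suc_mono_le[of n, OF st(4) that] lift_Suc_mono_le[of J, OF st(6) that] .
  have nJ: "k \<le> n k" "k \<le> J k" for k using st(3,5) by (cases k; simp)+
  \<comment> \<open>A move of at most \<open>e m / 2\<close> is at most
    \<open>e m - e (Suc m)\<close>, so the total displacement telescopes.\<close>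
  have drift: "cmod (g m j x - g k j x) \<le> e k - e m" if "k \<le> m" "j < J k" "x \<in> X (n k)" for k m j x
    using that(1)
  proof (induction m rule: dec_induct)
    case (step m)
    have "j < J m" "x \<in> X (n m)" using that(2,3) Jmono[OF step(1)] Xmono[OF nmono[OF step(1)]] by auto
    then have "cmod (g (Suc m) j x - g m j x) \<le> e m / 2" using st(1) by blast
    from norm_triangle_mono[OF this step.IH] show ?case using st(2)[of m] by simp
  qed simp
  have e2: "e k \<le> e 0 * (1/2) ^ k" for k
  proof (induction k)
    case (Suc k) then show ?case using st(2)[of k] by simp
  qed simp
  have lim0: "(\<lambda>k. e 0 * (1/2) ^ k) \<longlonglongrightarrow> e 0 * 0" by (intro tendsto_intros LIMSEQ_power_zero) simp
  have elim: "\<exists>k0. \<forall>k\<ge>k0. e k < d" if "d > 0" for d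
  proof -
    have "\<forall>\<^sub>F k in sequentially. e 0 * (1/2) ^ k < d"
      using order_tendstoD(2)[OF lim0, of d] that by simp
    then have "\<forall>\<^sub>F k in sequentially. e k < d"
      by (rule eventually_mono) (rule le_less_trans[OF e2])
    then show ?thesis unfolding eventually_sequentially .
  qed
  \<comment> \<open>Convergence is only claimed on \<open>S\<close>; off \<open>S\<close> the values
    of \<open>lim\<close> are arbitrary and are later replaced by 0.\<close>
  define f where "f j x = lim (\<lambda>m. g m j x)" for j x
  have conv: "(\<lambda>m. g m j x) \<longlonglongrightarrow> f j x" if x: "x \<in> S" for j x
  proof -
    obtain n0 where n0: "x \<in> X n0" using X(2)[of "{x}"] x by auto
    have "Cauchy (\<lambda>m. g m j x)"
    proof (rule metric_CauchyI)
      fix d :: real assume d: "d > 0"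
      obtain k0 where k0: "\<forall>k\<ge>k0. e k < d / 2" using elim[of "d / 2"] d by auto
      define k where "k = max k0 (max n0 (Suc j))"
      have "Suc j \<le> k" "n0 \<le> k" by (simp_all add: k_def)
      then have k: "j < J k" "x \<in> X (n k)" using nJ[of k] Xmono[of n0 "n k"] n0 by auto
      have near: "dist (g m j x) (g k j x) < d / 2" if "m \<ge> k" for m
      proof -
        have "e k < d / 2" using k0 by (simp add: k_def)
        then show ?thesis using drift[OF that k] epos[of m] by (simp add: dist_norm)
      qed
      have "dist (g a j x) (g b j x) < d" if "a \<ge> k" "b \<ge> k" for a b
        using near[OF that(1)] near[OF that(2)] dist_triangle2[of "g a j x" "g b j x" "g k j x"] by simp
      then show "\<exists>M. \<forall>a\<ge>M. \<forall>b\<ge>M. dist (g a j x) (g b j x) < d" by blast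
    qed
    then have "convergent (\<lambda>m. g m j x)" by (simp add: Cauchy_convergent_iff)
    then show ?thesis unfolding f_def by (simp add: convergent_LIMSEQ_iff)
  qed
  have close: "cmod (f j x - g k j x) \<le> e k" if "j < J k" "x \<in> X (n k)" for j k x
  proof (rule tendsto_upperbound)
    have "x \<in> S" using that(2) X(3) by blast
    then show "(\<lambda>m. cmod (g m j x - g k j x)) \<longlonglongrightarrow> cmod (f j x - g k j x)"
      by (intro tendsto_intros conv)
    have "cmod (g m j x - g k j x) \<le> e k" if "m \<ge> k" for m
      using drift[OF that \<open>j < J k\<close> \<open>x \<in> X (n k)\<close>] epos[of m] by simp
    then show "\<forall>\<^sub>F m in sequentially. cmod (g m j x - g k j x) \<le> e k"
      unfolding eventually_sequentially by blast
  qed simp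
  have shf: "sep_hol S (f j)" for j
  proof (rule sep_hol_uniform_limit[OF S, of "\<lambda>m. g m j"])
    show "sep_hol S (g m j)" for m by (rule sep_hol_mpoly[OF poly])
    fix C assume "compact C" "C \<subseteq> S"
    then obtain n0 where n0: "C \<subseteq> X n0" using X(2) by blast
    show "uniform_limit C (\<lambda>m. g m j) (f j) sequentially"
      unfolding uniform_limit_iff
    proof (intro allI impI)
      fix d :: real assume "d > 0"
      then obtain k0 where k0: "\<forall>k\<ge>k0. e k < d" using elim by blast
      have "\<forall>x\<in>C. dist (g m j x) (f j x) < d" if m: "m \<ge> max k0 (max n0 (Suc j))" for m
      proof
        fix x assume "x \<in> C"
        then have "x \<in> X (n m)" "j < J m" using n0 Xmono[of n0 "n m"] nJ[of m] m by auto
        then have "cmod (f j x - g m j x) \<le> e m" using close by blast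
        also have "\<dots> < d" using k0 m by simp
        finally show "dist (g m j x) (f j x) < d" by (simp add: dist_norm norm_minus_commute)
      qed
      then show "\<forall>\<^sub>F m in sequentially. \<forall>x\<in>C. dist (g m j x) (f j x) < d"
        unfolding eventually_sequentially by blast
    qed
  qed
  have "P k f" for k by (rule st(7)) (use shf close in auto)
  then show ?thesis using shf Prange by blast
qed

section \<open>The universal class\<close>

definition exhausts :: "complex set \<Rightarrow> (nat \<Rightarrow> complex set) \<Rightarrow> bool"
  where "exhausts S E \<longleftrightarrow> (\<forall>n. compact (E n) \<and> connected (- E n) \<and> E n \<subseteq> S \<and> E n \<subseteq> E (Suc n)) \<and>
    (\<forall>C. compact C \<and> C \<subseteq> S \<longrightarrow> (\<exists>n. C \<subseteq> E n))"

definition exhaustion :: "complex set \<Rightarrow> nat \<Rightarrow> complex set"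
  where "exhaustion S = (SOME E. exhausts S E)"

lemma exhausts_exhaustion:
  assumes "simply_connected_domain S"
  shows "exhausts S (exhaustion S)"
proof -
  obtain E where "\<And>n. compact (E n)" "\<And>n. connected (- E n)" "\<And>n. E n \<subseteq> S" "\<And>n. E n \<subseteq> E (Suc n)"
    "\<And>C. compact C \<Longrightarrow> C \<subseteq> S \<Longrightarrow> \<exists>n. C \<subseteq> E n"
    using simply_connected_exhaustion[OF assms] by metis
  then have "exhausts S E" unfolding exhausts_def by simp
  then show ?thesis unfolding exhaustion_def by (rule someI[of "exhausts S"])
qed

definition exhaustion_prod :: "('n::finite \<Rightarrow> complex set) \<Rightarrow> nat \<Rightarrow> (complex ^ 'n) set"
  where "exhaustion_prod A n = vprod (\<lambda>i. exhaustion (A i) n)"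

lemma vprod_mono: "(\<And>i. A i \<subseteq> B i) \<Longrightarrow> vprod A \<subseteq> vprod B"
  unfolding vprod_def by blast

context
  fixes A :: "'n::finite \<Rightarrow> complex set"
  assumes A: "\<And>i. simply_connected_domain (A i)"
begin

lemma exhaustion_props: "compact (exhaustion (A i) n)" "connected (- exhaustion (A i) n)" "exhaustion (A i) n \<subseteq> A i" "exhaustion (A i) n \<subseteq> exhaustion (A i) (Suc n)"
  using exhausts_exhaustion[OF A[of i]] unfolding exhausts_def by simp_all

lemma exhaustion_mono: "m \<le> n \<Longrightarrow> exhaustion (A i) m \<subseteq> exhaustion (A i) n"
  by (rule lift_Suc_mono_le[of "exhaustion (A i)"]) (rule exhaustion_props(4))

lemma exhaustion_cofinal: "compact C \<Longrightarrow> C \<subseteq> A i \<Longrightarrow> \<exists>n. C \<subseteq> exhaustion (A i) n"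
  using exhausts_exhaustion[OF A[of i]] unfolding exhausts_def by simp

lemma open_domain: "open (vprod A)"
  using A by (intro open_vprod) (simp add: simply_connected_domain_def)

lemma exhaustion_prod_compact: "compact (exhaustion_prod A n)"
  unfolding exhaustion_prod_def by (intro compact_vprod exhaustion_props)

lemma exhaustion_prod_subset: "exhaustion_prod A n \<subseteq> vprod A"
  unfolding exhaustion_prod_def by (intro vprod_mono exhaustion_props)

lemma exhaustion_prod_mono: "m \<le> n \<Longrightarrow> exhaustion_prod A m \<subseteq> exhaustion_prod A n"
  unfolding exhaustion_prod_def by (intro vprod_mono exhaustion_mono)

lemma exhaustion_prod_cofinal:
  assumes "compact C" "C \<subseteq> vprod A"
  shows "\<exists>n. C \<subseteq> exhaustion_prod A n"
proof -
  have "\<exists>n. (\<lambda>x. x $ i) ` C \<subseteq> exhaustion (A i) n" for i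
    using assms by (intro exhaustion_cofinal compact_continuous_image continuous_intros) (auto simp: vprod_def)
  then obtain m where m: "\<And>i. (\<lambda>x. x $ i) ` C \<subseteq> exhaustion (A i) (m i)" by metis
  define n where "n = Max (range m)"
  have "exhaustion (A i) (m i) \<subseteq> exhaustion (A i) n" for i by (rule exhaustion_mono) (simp add: n_def)
  then have "C \<subseteq> exhaustion_prod A n" using m unfolding exhaustion_prod_def vprod_def by blast
  then show ?thesis ..
qed

end

text \<open>Only the coordinate in which \<open>K\<close> has to miss \<open>\<Omega>\<close> needs care; in the others a large disc will do.\<close>

definition avoiding :: "('d::finite \<Rightarrow> complex set) \<Rightarrow> ('d \<Rightarrow> complex set) set"
  where "avoiding \<Omega> = (\<Union>i\<^sub>0. (\<lambda>(K', R::nat). (\<lambda>i. if i = i\<^sub>0 then K' else cball 0 (real R))) ` (disjoint_compacts (\<Omega> i\<^sub>0) \<times> UNIV))"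

lemma countable_avoiding: "countable (avoiding \<Omega>)"
  unfolding avoiding_def
  by (intro countable_UN countable_image countable_SIGMA countable_disjoint_compacts) (auto simp: countable_finite)

lemma avoidingD:
  assumes "K \<in> avoiding \<Omega>" "\<And>i. open (\<Omega> i)"
  shows "compact (K i)" "connected (- K i)" "\<exists>i\<^sub>0. \<Omega> i\<^sub>0 \<inter> K i\<^sub>0 = {}"
proof -
  obtain i0 K' and R :: nat where K: "K' \<in> disjoint_compacts (\<Omega> i0)" "K = (\<lambda>i. if i = i0 then K' else cball 0 (real R))"
    using assms(1) unfolding avoiding_def by auto
  note D = disjoint_compactsD[OF K(1) assms(2)]
  have "connected (- cball (0::complex) (real R))"
    by (rule connected_complement_bounded_convex) simp_all
  then show "compact (K i)" "connected (- K i)" using D by (auto simp: K(2))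
  have "\<Omega> i0 \<inter> K i0 = {}" using D(3) by (simp add: K(2))
  then show "\<exists>i\<^sub>0. \<Omega> i\<^sub>0 \<inter> K i\<^sub>0 = {}" ..
qed

lemma avoiding_cofinal:
  assumes \<Omega>: "\<And>i. simply_connected_domain (\<Omega> i)" and K: "\<And>i. compact (K i)" "\<And>i. connected (- K i)" "\<Omega> i\<^sub>0 \<inter> K i\<^sub>0 = {}"
  shows "\<exists>K'\<in>avoiding \<Omega>. vprod K \<subseteq> vprod K'"
proof -
  obtain K0 where K0: "K0 \<in> disjoint_compacts (\<Omega> i\<^sub>0)" "K i\<^sub>0 \<subseteq> K0"
    using disjoint_compacts_cofinal[OF _ _ K(1,2) K(3)] \<Omega>[of i\<^sub>0] unfolding simply_connected_domain_def by metis
  have "bounded (\<Union>i. K i)" using K(1) by (intro bounded_UN) (auto intro: compact_imp_bounded)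
  then obtain B where B: "\<forall>z\<in>(\<Union>i. K i). cmod z \<le> B" unfolding bounded_iff by blast
  obtain R :: nat where R: "B \<le> real R" using real_arch_simple by blast
  define K' where "K' = (\<lambda>i. if i = i\<^sub>0 then K0 else cball 0 (real R))"
  have "K' \<in> avoiding \<Omega>" unfolding avoiding_def K'_def using K0(1) by (intro UN_I[of i\<^sub>0] image_eqI[of _ _ "(K0, R)"]) auto
  moreover have "K i \<subseteq> K' i" for i using K0(2) B R by (force simp: K'_def)
  ultimately show ?thesis using vprod_mono[of K K'] by blast
qed

definition op_words :: "nat \<Rightarrow> ('r::finite + 'd::finite) list set"
  where "op_words s = (\<lambda>(a, b). op_word a b) ` ({a. \<forall>i. a $ i \<le> s} \<times> {b. \<forall>j. b $ j \<le> s})"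

lemma finite_op_words: "finite (op_words s)"
  unfolding op_words_def by (intro finite_imageI finite_cartesian_product finite_bounded_vec)

lemma op_words_mono: "s \<le> t \<Longrightarrow> op_words s \<subseteq> op_words t"
  unfolding op_words_def by (intro image_mono) (auto intro: order.trans)

lemma op_words_cofinal: "\<exists>s. op_word a b \<in> op_words s"
proof
  define s where "s = Max (range (($) a)) + Max (range (($) b))"
  have "a $ i \<le> s" for i unfolding s_def by (rule trans_le_add1) (simp add: Max_ge)
  moreover have "b $ j \<le> s" for j unfolding s_def by (rule trans_le_add2) (simp add: Max_ge)
  ultimately show "op_word a b \<in> op_words s" unfolding op_words_def by auto
qed

lemma SUP_SUP_SUP_ennreal_le_iff:
  assumes "e \<ge> 0"
  shows "(SUP x\<in>A. SUP y\<in>B. SUP z\<in>C. ennreal (f x y z)) \<le> ennreal e \<longleftrightarrow> (\<forall>x\<in>A. \<forall>y\<in>B. \<forall>z\<in>C. f x y z \<le> e)"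
  using assms by (simp add: SUP_le_iff ennreal_le_iff)

locale universal_setting =
  fixes G :: "'r::finite \<Rightarrow> complex set" and \<Omega> :: "'d::finite \<Rightarrow> complex set"
    and N :: "nat \<Rightarrow> nat ^ 'd" and \<mu> :: "nat set"
  assumes G: "\<And>i. simply_connected_domain (G i)" and \<Omega>: "\<And>i. simply_connected_domain (\<Omega> i)"
    and N: "bij N" and \<mu>: "infinite \<mu>"
begin

abbreviation S :: "('r, 'd) cspace set" where "S \<equiv> vprod G \<times> vprod \<Omega>"

definition level :: "nat \<Rightarrow> ('r, 'd) cspace set" where "level s = exhaustion_prod G s \<times> exhaustion_prod \<Omega> s"

lemma open_G: "open (vprod G)" and open_\<Omega>: "open (vprod \<Omega>)" and open_\<Omega>i: "open (\<Omega> i)"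
  using open_domain[of G] open_domain[of \<Omega>] G \<Omega> by (auto simp: simply_connected_domain_def)

lemma open_S: "open S"
  by (intro open_Times open_G open_\<Omega>)

lemmas exhaustion_G = exhaustion_prod_compact[of G, OF G] exhaustion_prod_subset[of G, OF G] exhaustion_prod_mono[of G, OF G]
lemmas exhaustion_Om = exhaustion_prod_compact[of \<Omega>, OF \<Omega>] exhaustion_prod_subset[of \<Omega>, OF \<Omega>] exhaustion_prod_mono[of \<Omega>, OF \<Omega>]

lemma level_compact: "compact (level s)" and level_subset: "level s \<subseteq> S" and level_mono: "m \<le> n \<Longrightarrow> level m \<subseteq> level n"
  unfolding level_def by (intro compact_Times Sigma_mono exhaustion_G exhaustion_Om; simp)+

lemma level_cofinal:
  assumes "compact C" "C \<subseteq> S"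
  shows "\<exists>n. C \<subseteq> level n"
proof -
  have "compact (fst ` C)" "fst ` C \<subseteq> vprod G" "compact (snd ` C)" "snd ` C \<subseteq> vprod \<Omega>"
    using assms by (auto intro!: compact_continuous_image continuous_intros)
  note pr = this
  obtain m where m: "fst ` C \<subseteq> exhaustion_prod G m" using exhaustion_prod_cofinal[of G, OF G pr(1,2)] by (elim exE)
  obtain n where n: "snd ` C \<subseteq> exhaustion_prod \<Omega> n" using exhaustion_prod_cofinal[of \<Omega>, OF \<Omega> pr(3,4)] by (elim exE)
  have "C \<subseteq> level (max m n)"
  proof
    fix x assume "x \<in> C"
    then have "fst x \<in> exhaustion_prod G (max m n)" "snd x \<in> exhaustion_prod \<Omega> (max m n)"
      using m n exhaustion_G(3)[of m "max m n"] exhaustion_Om(3)[of n "max m n"] by auto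
    then show "x \<in> level (max m n)" unfolding level_def by (cases x) simp
  qed
  then show ?thesis ..
qed

text \<open>A single index \<open>s\<close> governs the centres, the parameters \<open>w\<close>,
  the points over \<Omega> and the differential operators, so that letting \<open>s\<close> grow
  exhausts all the quantifiers of universality at once.\<close>

definition doubly_approx :: "('d \<Rightarrow> complex set) \<Rightarrow> (('r, 'd) cspace \<Rightarrow> complex) \<Rightarrow> nat \<Rightarrow> nat \<Rightarrow> (('r, 'd) cspace \<Rightarrow> complex) \<Rightarrow> real \<Rightarrow> bool"
  where "doubly_approx K h s n f e \<longleftrightarrow> (\<forall>\<zeta>\<in>exhaustion_prod \<Omega> s. \<forall>w\<in>exhaustion_prod G s.
    (\<forall>z\<in>vprod K. \<forall>cs\<in>op_words s. cmod (coord_derivs cs (\<lambda>x. partial_sum N n f (fst x) \<zeta> (snd x) - h x) (w, z)) \<le> e) \<and>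
    (\<forall>z\<in>exhaustion_prod \<Omega> s. cmod (partial_sum N n f w \<zeta> z - f (w, z)) \<le> e))"

lemma doubly_approx_mono: "doubly_approx K h s n f e \<Longrightarrow> t \<le> s \<Longrightarrow> e \<le> e' \<Longrightarrow> doubly_approx K h t n f e'"
  unfolding doubly_approx_def using exhaustion_G(3)[of t s] exhaustion_Om(3)[of t s] op_words_mono[of t s] by (meson order.trans subsetD)

text \<open>For a fixed order the partial sum is linear and continuous in \<open>f\<close>, so a
  small change of \<open>f\<close> on a compact set changes every quantity in
  \<open>doubly_approx\<close> by little.\<close>

lemma doubly_approx_stable:
  assumes f: "sep_hol S f" and h: "sep_hol UNIV h" and K: "\<And>i. compact (K i)" and doubly_approx: "doubly_approx K h s n f e" and d: "d > 0"
  shows "\<exists>C \<delta>. compact C \<and> C \<subseteq> S \<and> \<delta> > 0 \<and> (\<forall>g. sep_hol S g \<longrightarrow> (\<forall>x\<in>C. cmod (g x - f x) \<le> \<delta>) \<longrightarrow> doubly_approx K h s n g (e + d))"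
proof -
  define Y where "Y = vprod K \<union> exhaustion_prod \<Omega> s"
  have Y: "compact Y" unfolding Y_def by (intro compact_Un compact_vprod K exhaustion_Om)
  \<comment> \<open>The empty word supplies the plain values of the partial sum, wanted for the
    approximation of \<open>f\<close> itself.\<close>
  have "finite (insert [] (op_words s) :: ('r + 'd) list set)" using finite_op_words by simp
  then obtain C0 A where C0: "partial_sum_bounded (vprod G) (vprod \<Omega>) (exhaustion_prod G s) (exhaustion_prod \<Omega> s) Y N n (insert [] (op_words s)) C0 A"
    using partial_sum_bounded_exists[OF open_G open_\<Omega> exhaustion_G(1,2) exhaustion_Om(1,2) Y] by metis
  then have A: "compact C0" "C0 \<subseteq> S" "A > 0" unfolding partial_sum_bounded_def by auto
  \<comment> \<open>Chosen so that \<open>A * \<delta> + \<delta> = d\<close>: the second estimate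
    is charged both for the partial sum of the difference and for the difference itself.\<close>
  define \<delta> where "\<delta> = d / (A + 1)"
  have "(A + 1) * \<delta> = d" using A(3) unfolding \<delta>_def by simp
  then have "A * \<delta> + \<delta> = d" by (simp only: distrib_right mult_1_left)
  moreover have "\<delta> > 0" using A(3) d by (simp add: \<delta>_def)
  ultimately have \<delta>: "\<delta> > 0" "A * \<delta> + \<delta> = d" by simp_all
  have "A * \<delta> \<le> d" using \<delta> by simp
  have "doubly_approx K h s n g (e + d)" if g: "sep_hol S g" and gf: "\<forall>x\<in>C0 \<union> level s. cmod (g x - f x) \<le> \<delta>" for g
    unfolding doubly_approx_def
  proof (intro ballI conjI)
    fix \<zeta> w assume mem: "\<zeta> \<in> exhaustion_prod \<Omega> s" "w \<in> exhaustion_prod G s"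
    have \<zeta>: "\<zeta> \<in> vprod \<Omega>" and w: "w \<in> vprod G" using mem exhaustion_G(2) exhaustion_Om(2) by auto
    let ?D = "\<lambda>x. g x - f x"
    have D: "sep_hol S ?D" using g f by (rule sep_hol_diff)
    have bound: "cmod (coord_derivs cs (\<lambda>x. partial_sum N n ?D (fst x) \<zeta> (snd x)) (w, z)) \<le> A * \<delta>"
      if "z \<in> Y" "cs \<in> insert [] (op_words s)" for z cs
      by (rule partial_sum_boundedD[OF C0 D _ _ mem that]) (use gf \<delta> in auto)
    {
      fix z cs assume z: "z \<in> vprod K" and cs: "cs \<in> (op_words s :: ('r + 'd) list set)"
      let ?Z = "vprod G \<times> (UNIV :: (complex ^ 'd) set)"
      have oZ: "open ?Z" by (intro open_Times open_G open_UNIV)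
      have wz: "(w, z) \<in> ?Z" using w by simp
      have sf: "sep_hol ?Z (\<lambda>x. partial_sum N n f (fst x) \<zeta> (snd x) - h x)"
        by (rule sep_hol_diff[OF sep_hol_partial_sum[OF open_G open_\<Omega> f \<zeta>] sep_hol_subset[OF h subset_UNIV]])
      have sD: "sep_hol ?Z (\<lambda>x. partial_sum N n ?D (fst x) \<zeta> (snd x))"
        by (rule sep_hol_partial_sum[OF open_G open_\<Omega> D \<zeta>])
      have "coord_derivs cs (\<lambda>x. partial_sum N n g (fst x) \<zeta> (snd x) - h x) (w, z)
          = coord_derivs cs (\<lambda>x. (partial_sum N n f (fst x) \<zeta> (snd x) - h x) + partial_sum N n ?D (fst x) \<zeta> (snd x)) (w, z)"
      proof (rule coord_derivs_cong[OF oZ _ wz])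
        fix y assume "y \<in> ?Z"
        then have "(fst y, \<zeta>) \<in> S" using \<zeta> by auto
        from partial_sum_diff[OF open_S g f this, of N n "snd y"]
        show "partial_sum N n g (fst y) \<zeta> (snd y) - h y = (partial_sum N n f (fst y) \<zeta> (snd y) - h y) + partial_sum N n ?D (fst y) \<zeta> (snd y)"
          by simp
      qed
      also have "\<dots> = coord_derivs cs (\<lambda>x. partial_sum N n f (fst x) \<zeta> (snd x) - h x) (w, z) + coord_derivs cs (\<lambda>x. partial_sum N n ?D (fst x) \<zeta> (snd x)) (w, z)"
        by (rule coord_derivs_add[OF oZ sf sD wz])
      also have "cmod \<dots> \<le> e + A * \<delta>"
        using doubly_approx mem z cs bound[of z cs] unfolding doubly_approx_def Y_def by (intro norm_triangle_mono) auto
      finally show "cmod (coord_derivs cs (\<lambda>x. partial_sum N n g (fst x) \<zeta> (snd x) - h x) (w, z)) \<le> e + d"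
        using \<open>A * \<delta> \<le> d\<close> by simp
    }
    fix z assume z: "z \<in> exhaustion_prod \<Omega> s"
    have "(w, \<zeta>) \<in> S" using w \<zeta> by simp
    from partial_sum_diff[OF open_S g f this, of N n z]
    have "partial_sum N n g w \<zeta> z - g (w, z) = (partial_sum N n f w \<zeta> z - f (w, z)) + (partial_sum N n ?D w \<zeta> z - ?D (w, z))"
      by simp
    also have "cmod \<dots> \<le> e + (A * \<delta> + \<delta>)"
    proof (rule norm_triangle_mono)
      show "cmod (partial_sum N n f w \<zeta> z - f (w, z)) \<le> e" using doubly_approx mem z unfolding doubly_approx_def by blast
      have "cmod (partial_sum N n ?D w \<zeta> z) \<le> A * \<delta>" using bound[of z "[]"] z by (simp add: Y_def)
      moreover have "cmod (?D (w, z)) \<le> \<delta>" using gf mem z by (auto simp: level_def)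
      ultimately show "cmod (partial_sum N n ?D w \<zeta> z - ?D (w, z)) \<le> A * \<delta> + \<delta>"
        by (rule order.trans[OF norm_triangle_ineq4 add_mono])
    qed
    finally show "cmod (partial_sum N n g w \<zeta> z - g (w, z)) \<le> e + d" using \<delta>(2) by simp
  qed
  then show ?thesis
    using A level_compact level_subset \<delta>(1) by (intro exI[of _ "C0 \<union> level s"] exI[of _ \<delta>]) (auto intro: compact_Un)
qed

lemma hol_space_sep_hol: "f \<in> hol_space S \<Longrightarrow> sep_hol S f"
  unfolding hol_space_def by (simp add: mholomorphic_imp_sep_hol)

text \<open>The strict inequality for \<open>e\<close> leaves room for perturbation, which makes the
  condition open; \<open>n \<ge> s\<close> drives the orders to infinity.\<close>

definition task :: "('d \<Rightarrow> complex set) \<Rightarrow> (rat \<times> rat \<times> (nat ^ 'r) \<times> (nat ^ 'd)) list \<Rightarrow> nat \<Rightarrow> (('r, 'd) cspace \<Rightarrow> complex) set"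
  where "task K ts s = {f \<in> hol_space S. \<exists>n\<in>\<mu>. n \<ge> s \<and> (\<exists>e < 1 / real (Suc s). doubly_approx K (qpoly ts) s n f e)}"

lemma openin_task:
  assumes "K \<in> avoiding \<Omega>"
  shows "openin (hol_topology S) (task K ts s)"
  unfolding openin_hol_topology open_in_hol_space_def
proof (intro conjI ballI)
  show "task K ts s \<subseteq> hol_space S" by (auto simp: task_def)
  fix f assume "f \<in> task K ts s"
  then obtain n e where f: "f \<in> hol_space S" "n \<in> \<mu>" "n \<ge> s" "e < 1 / real (Suc s)" "doubly_approx K (qpoly ts) s n f e"
    by (auto simp: task_def)
  obtain e' where e': "e < e'" "e' < 1 / real (Suc s)" using dense[OF f(4)] by blast
  define d where "d = e' - e"
  have d: "d > 0" "e + d < 1 / real (Suc s)" using e' by (simp_all add: d_def)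
  obtain C \<delta> where C: "compact C" "C \<subseteq> S" "\<delta> > 0" "\<And>g. sep_hol S g \<Longrightarrow> \<forall>x\<in>C. cmod (g x - f x) \<le> \<delta> \<Longrightarrow> doubly_approx K (qpoly ts) s n g (e + d)"
    using doubly_approx_stable[OF hol_space_sep_hol[OF f(1)] sep_hol_mpoly[OF qpoly_mpolys] avoidingD(1)[OF assms open_\<Omega>i] f(5) d(1)] by metis
  show "\<exists>C \<epsilon>. compact C \<and> C \<subseteq> S \<and> \<epsilon> > 0 \<and> (\<forall>g\<in>hol_space S. (\<forall>p\<in>C. cmod (g p - f p) < \<epsilon>) \<longrightarrow> g \<in> task K ts s)"
  proof (intro exI conjI ballI impI)
    fix g assume g: "g \<in> hol_space S" "\<forall>p\<in>C. cmod (g p - f p) < \<delta>"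
    then have "doubly_approx K (qpoly ts) s n g (e + d)" by (intro C(4) hol_space_sep_hol) (auto simp: less_imp_le)
    then show "g \<in> task K ts s" unfolding task_def using g(1) f(2,3) d(2) by blast
  qed (rule C)+
qed

lemma universal_imp_task:
  assumes f: "f \<in> universal_class N \<mu> (vprod G) \<Omega>" and K: "K \<in> avoiding \<Omega>"
  shows "f \<in> task K ts s"
proof -
  note KD = avoidingD[OF K open_\<Omega>i]
  have fH: "f \<in> hol_space S" using f by (simp add: universal_class_def)
  \<comment> \<open>The test polynomial is defined for all \<open>z\<close>, so the whole space can
    serve as the neighbourhood of \<open>K\<close>.\<close>
  have "qpoly ts mholomorphic_on (vprod G \<times> UNIV)"
    by (intro sep_hol_imp_mholomorphic open_Times open_G open_UNIV sep_hol_mpoly qpoly_mpolys)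
  then have "\<exists>l::nat \<Rightarrow> nat. strict_mono l \<and> range l \<subseteq> \<mu> \<and>
        (\<forall>L M a b. compact L \<and> L \<subseteq> vprod G \<and> compact M \<and> M \<subseteq> vprod \<Omega> \<longrightarrow>
          ((\<lambda>n. SUP \<zeta>\<in>M. SUP w\<in>L. SUP z\<in>vprod K.
              ennreal (cmod (mixed_diff_op a b
                (\<lambda>(w, z). partial_sum N (l n) f w \<zeta> z - qpoly ts (w, z)) (w, z)))) \<longlonglongrightarrow> 0) \<and>
          ((\<lambda>n. SUP \<zeta>\<in>M. SUP w\<in>L. SUP z\<in>M.
              ennreal (cmod (partial_sum N (l n) f w \<zeta> z - f (w, z)))) \<longlonglongrightarrow> 0))"
    using f KD unfolding universal_class_def by (auto dest!: spec[of _ K] spec[of _ UNIV] spec[of _ "qpoly ts"])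
  then obtain l :: "nat \<Rightarrow> nat" where l: "strict_mono l" "range l \<subseteq> \<mu>"
    and lim: "\<And>L M a b. compact L \<and> L \<subseteq> vprod G \<and> compact M \<and> M \<subseteq> vprod \<Omega> \<Longrightarrow>
          ((\<lambda>n. SUP \<zeta>\<in>M. SUP w\<in>L. SUP z\<in>vprod K.
              ennreal (cmod (mixed_diff_op a b
                (\<lambda>(w, z). partial_sum N (l n) f w \<zeta> z - qpoly ts (w, z)) (w, z)))) \<longlonglongrightarrow> 0) \<and>
          ((\<lambda>n. SUP \<zeta>\<in>M. SUP w\<in>L. SUP z\<in>M.
              ennreal (cmod (partial_sum N (l n) f w \<zeta> z - f (w, z)))) \<longlonglongrightarrow> 0)"
    by (elim exE conjE) blast
  define e where "e = 1 / (2 * real (Suc s))"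
  have e: "e > 0" "e < 1 / real (Suc s)" by (simp_all add: e_def divide_simps)
  have LM: "compact (exhaustion_prod G s) \<and> exhaustion_prod G s \<subseteq> vprod G \<and> compact (exhaustion_prod \<Omega> s) \<and> exhaustion_prod \<Omega> s \<subseteq> vprod \<Omega>"
    using exhaustion_G exhaustion_Om by blast
  have ev1: "\<forall>\<^sub>F n in sequentially. \<forall>\<zeta>\<in>exhaustion_prod \<Omega> s. \<forall>w\<in>exhaustion_prod G s. \<forall>z\<in>vprod K.
      cmod (coord_derivs (op_word a b) (\<lambda>x. partial_sum N (l n) f (fst x) \<zeta> (snd x) - qpoly ts x) (w, z)) \<le> e" for a b
  proof -
    have "\<forall>\<^sub>F n in sequentially. (SUP \<zeta>\<in>exhaustion_prod \<Omega> s. SUP w\<in>exhaustion_prod G s. SUP z\<in>vprod K.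
              ennreal (cmod (mixed_diff_op a b
                (\<lambda>(w, z). partial_sum N (l n) f w \<zeta> z - qpoly ts (w, z)) (w, z)))) < ennreal e"
      using order_tendstoD(2)[OF conjunct1[OF lim[OF LM]], of "ennreal e"] e by simp
    then show ?thesis
    proof (rule eventually_mono)
      fix n
      assume "(SUP \<zeta>\<in>exhaustion_prod \<Omega> s. SUP w\<in>exhaustion_prod G s. SUP z\<in>vprod K.
              ennreal (cmod (mixed_diff_op a b
                (\<lambda>(w, z). partial_sum N (l n) f w \<zeta> z - qpoly ts (w, z)) (w, z)))) < ennreal e"
      from less_imp_le[OF this] show "\<forall>\<zeta>\<in>exhaustion_prod \<Omega> s. \<forall>w\<in>exhaustion_prod G s. \<forall>z\<in>vprod K.
          cmod (coord_derivs (op_word a b) (\<lambda>x. partial_sum N (l n) f (fst x) \<zeta> (snd x) - qpoly ts x) (w, z)) \<le> e"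
        unfolding SUP_SUP_SUP_ennreal_le_iff[OF less_imp_le[OF e(1)]] by (simp add: mixed_diff_op_eq_coord_derivs split_def)
    qed
  qed
  have ev2: "\<forall>\<^sub>F n in sequentially. \<forall>\<zeta>\<in>exhaustion_prod \<Omega> s. \<forall>w\<in>exhaustion_prod G s. \<forall>z\<in>exhaustion_prod \<Omega> s.
      cmod (partial_sum N (l n) f w \<zeta> z - f (w, z)) \<le> e"
  proof -
    have "\<forall>\<^sub>F n in sequentially. (SUP \<zeta>\<in>exhaustion_prod \<Omega> s. SUP w\<in>exhaustion_prod G s. SUP z\<in>exhaustion_prod \<Omega> s.
              ennreal (cmod (partial_sum N (l n) f w \<zeta> z - f (w, z)))) < ennreal e"
      using order_tendstoD(2)[OF conjunct2[OF lim[OF LM]], of "ennreal e"] e by simp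
    then show ?thesis
    proof (rule eventually_mono)
      fix n
      assume "(SUP \<zeta>\<in>exhaustion_prod \<Omega> s. SUP w\<in>exhaustion_prod G s. SUP z\<in>exhaustion_prod \<Omega> s.
              ennreal (cmod (partial_sum N (l n) f w \<zeta> z - f (w, z)))) < ennreal e"
      from less_imp_le[OF this] show "\<forall>\<zeta>\<in>exhaustion_prod \<Omega> s. \<forall>w\<in>exhaustion_prod G s. \<forall>z\<in>exhaustion_prod \<Omega> s.
          cmod (partial_sum N (l n) f w \<zeta> z - f (w, z)) \<le> e"
        unfolding SUP_SUP_SUP_ennreal_le_iff[OF less_imp_le[OF e(1)]] .
    qed
  qed
  have "\<forall>\<^sub>F n in sequentially. \<forall>cs\<in>op_words s. \<forall>\<zeta>\<in>exhaustion_prod \<Omega> s. \<forall>w\<in>exhaustion_prod G s. \<forall>z\<in>vprod K.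
      cmod (coord_derivs cs (\<lambda>x. partial_sum N (l n) f (fst x) \<zeta> (snd x) - qpoly ts x) (w, z)) \<le> e"
    using finite_op_words
  proof (rule eventually_ball_finite, intro ballI)
    fix cs assume "cs \<in> (op_words s :: ('r + 'd) list set)"
    then obtain a b where "cs = op_word a b" by (auto simp: op_words_def)
    then show "\<forall>\<^sub>F n in sequentially. \<forall>\<zeta>\<in>exhaustion_prod \<Omega> s. \<forall>w\<in>exhaustion_prod G s. \<forall>z\<in>vprod K.
      cmod (coord_derivs cs (\<lambda>x. partial_sum N (l n) f (fst x) \<zeta> (snd x) - qpoly ts x) (w, z)) \<le> e" using ev1 by simp
  qed
  from eventually_conj[OF eventually_ge_at_top[of s] eventually_conj[OF this ev2]]
  obtain n where n: "n \<ge> s" "\<forall>cs\<in>op_words s. \<forall>\<zeta>\<in>exhaustion_prod \<Omega> s. \<forall>w\<in>exhaustion_prod G s. \<forall>z\<in>vprod K.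
      cmod (coord_derivs cs (\<lambda>x. partial_sum N (l n) f (fst x) \<zeta> (snd x) - qpoly ts x) (w, z)) \<le> e"
      "\<forall>\<zeta>\<in>exhaustion_prod \<Omega> s. \<forall>w\<in>exhaustion_prod G s. \<forall>z\<in>exhaustion_prod \<Omega> s. cmod (partial_sum N (l n) f w \<zeta> z - f (w, z)) \<le> e"
    using eventually_happens'[OF sequentially_bot] by blast
  have "doubly_approx K (qpoly ts) s (l n) f e" unfolding doubly_approx_def using n(2,3) by blast
  moreover have "l n \<ge> s" using strict_mono_imp_increasing[OF l(1), of n] n(1) by simp
  moreover have "l n \<in> \<mu>" using l(2) by blast
  ultimately show ?thesis unfolding task_def using fH e(2) by blast
qed

text \<open>A diagonal choice: one sequence of orders, with the level growing along it, works for
  every \<open>L\<close>, \<open>M\<close> and operator, since each of these is dominated by some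
  level. The constant 3 anticipates three errors of size \<open>1 / real (Suc s)\<close>.\<close>

lemma doubly_approx_imp_universal:
  assumes K: "\<And>s. \<exists>n\<in>\<mu>. n \<ge> s \<and> doubly_approx K h s n f (3 / real (Suc s))"
  shows "\<exists>l::nat \<Rightarrow> nat. strict_mono l \<and> range l \<subseteq> \<mu> \<and>
        (\<forall>L M a b. compact L \<and> L \<subseteq> vprod G \<and> compact M \<and> M \<subseteq> vprod \<Omega> \<longrightarrow>
          ((\<lambda>n. SUP \<zeta>\<in>M. SUP w\<in>L. SUP z\<in>vprod K.
              ennreal (cmod (mixed_diff_op a b
                (\<lambda>(w, z). partial_sum N (l n) f w \<zeta> z - h (w, z)) (w, z)))) \<longlonglongrightarrow> 0) \<and>
          ((\<lambda>n. SUP \<zeta>\<in>M. SUP w\<in>L. SUP z\<in>M.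
              ennreal (cmod (partial_sum N (l n) f w \<zeta> z - f (w, z)))) \<longlonglongrightarrow> 0))"
proof -
  obtain nn where nn: "\<And>s. nn s \<in> \<mu>" "\<And>s. nn s \<ge> s" "\<And>s. doubly_approx K h s (nn s) f (3 / real (Suc s))"
    using K by metis
  \<comment> \<open>The next level exceeds the order just chosen, and an order is at least its
    level, so the orders increase strictly.\<close>
  define r where "r = rec_nat 0 (\<lambda>_ t. Suc (nn t))"
  have r: "r (Suc k) = Suc (nn (r k))" for k by (simp add: r_def)
  define l where "l k = nn (r k)" for k
  have lmono: "strict_mono l"
    unfolding strict_mono_Suc_iff
  proof
    fix k show "l k < l (Suc k)" using nn(2)[of "r (Suc k)"] by (simp add: l_def r)
  qed
  have rk: "k \<le> r k" for k
  proof (induction k)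
    case (Suc k) then show ?case using nn(2)[of "r k"] by (simp add: r)
  qed simp
  have doubly_approx: "doubly_approx K h s (l k) f (3 / real (Suc k))" if "s \<le> k" for s k
  proof (rule doubly_approx_mono)
    show "doubly_approx K h (r k) (l k) f (3 / real (Suc (r k)))" unfolding l_def by (rule nn(3))
    show "s \<le> r k" using rk[of k] that by simp
    show "3 / real (Suc (r k)) \<le> 3 / real (Suc k)" using rk[of k] by (simp add: frac_le)
  qed
  have lim0: "(\<lambda>k. ennreal (3 / real (Suc k))) \<longlonglongrightarrow> 0"
  proof -
    have "(\<lambda>k. 3 * (1 / real (Suc k))) \<longlonglongrightarrow> 3 * 0"
      by (intro tendsto_mult tendsto_const) (rule LIMSEQ_Suc[OF lim_1_over_n])
    then have "(\<lambda>k. ennreal (3 * (1 / real (Suc k)))) \<longlonglongrightarrow> ennreal (3 * 0)" by (rule tendsto_ennrealI)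
    then show ?thesis by simp
  qed
  have squeeze: "g \<longlonglongrightarrow> 0" if "\<And>k. k \<ge> s \<Longrightarrow> g k \<le> ennreal (3 / real (Suc k))" for g :: "nat \<Rightarrow> ennreal" and s
  proof (rule tendsto_sandwich[OF _ _ tendsto_const lim0])
    show "\<forall>\<^sub>F k in sequentially. g k \<le> ennreal (3 / real (Suc k))"
      unfolding eventually_sequentially using that by blast
  qed simp
  show ?thesis
  proof (intro exI[of _ l] conjI allI impI)
    show "range l \<subseteq> \<mu>" using nn(1) by (auto simp: l_def)
    fix L :: "(complex ^ 'r) set" and M :: "(complex ^ 'd) set"
      and a :: "nat ^ 'r" and b :: "nat ^ 'd"
    assume LM: "compact L \<and> L \<subseteq> vprod G \<and> compact M \<and> M \<subseteq> vprod \<Omega>"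
    obtain s1 where s1: "L \<subseteq> exhaustion_prod G s1" using exhaustion_prod_cofinal[of G, OF G] LM by blast
    obtain s2 where s2: "M \<subseteq> exhaustion_prod \<Omega> s2" using exhaustion_prod_cofinal[of \<Omega>, OF \<Omega>] LM by blast
    obtain s3 where s3: "op_word a b \<in> op_words s3" using op_words_cofinal by blast
    define s where "s = max s1 (max s2 s3)"
    have "s1 \<le> s" "s2 \<le> s" "s3 \<le> s" by (simp_all add: s_def)
    then have sub: "L \<subseteq> exhaustion_prod G s" "M \<subseteq> exhaustion_prod \<Omega> s" "op_word a b \<in> op_words s"
      using s1 s2 s3 exhaustion_G(3)[of s1 s] exhaustion_Om(3)[of s2 s] op_words_mono[of s3 s] by auto
    show "(\<lambda>n. SUP \<zeta>\<in>M. SUP w\<in>L. SUP z\<in>vprod K.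
              ennreal (cmod (mixed_diff_op a b
                (\<lambda>(w, z). partial_sum N (l n) f w \<zeta> z - h (w, z)) (w, z)))) \<longlonglongrightarrow> 0"
    proof (rule squeeze)
      fix k assume "k \<ge> s"
      have "3 / real (Suc k) \<ge> 0" by simp
      show "(SUP \<zeta>\<in>M. SUP w\<in>L. SUP z\<in>vprod K.
              ennreal (cmod (mixed_diff_op a b
                (\<lambda>(w, z). partial_sum N (l k) f w \<zeta> z - h (w, z)) (w, z)))) \<le> ennreal (3 / real (Suc k))"
        unfolding SUP_SUP_SUP_ennreal_le_iff[OF \<open>3 / real (Suc k) \<ge> 0\<close>] mixed_diff_op_eq_coord_derivs split_def
        using doubly_approx[OF \<open>k \<ge> s\<close>] sub unfolding doubly_approx_def by (auto simp: subset_iff)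
    qed
    show "(\<lambda>n. SUP \<zeta>\<in>M. SUP w\<in>L. SUP z\<in>M.
              ennreal (cmod (partial_sum N (l n) f w \<zeta> z - f (w, z)))) \<longlonglongrightarrow> 0"
    proof (rule squeeze)
      fix k assume "k \<ge> s"
      have "3 / real (Suc k) \<ge> 0" by simp
      show "(SUP \<zeta>\<in>M. SUP w\<in>L. SUP z\<in>M.
              ennreal (cmod (partial_sum N (l k) f w \<zeta> z - f (w, z)))) \<le> ennreal (3 / real (Suc k))"
        unfolding SUP_SUP_SUP_ennreal_le_iff[OF \<open>3 / real (Suc k) \<ge> 0\<close>]
        using doubly_approx[OF \<open>k \<ge> s\<close>] sub unfolding doubly_approx_def by blast
    qed
  qed (rule lmono)
qed

text \<open>Reduction of an arbitrary pair \<open>K\<close>, \<open>h\<close> to the countable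
  tests: enlarge \<open>K\<close> to a member of \<open>avoiding \<Omega>\<close>, approximate
  \<open>h\<close> near the given \<open>K\<close> by a polynomial and this by a rational one. Each
  of the three errors is at most \<open>1 / real (Suc s)\<close>.\<close>

lemma tasks_imp_universal:
  assumes f: "f \<in> hol_space S" and tasks: "\<And>K ts s. K \<in> avoiding \<Omega> \<Longrightarrow> f \<in> task K ts s"
  shows "f \<in> universal_class N \<mu> (vprod G) \<Omega>"
proof -
  have shf: "sep_hol S f" using f by (rule hol_space_sep_hol)
  have main: "\<exists>n\<in>\<mu>. n \<ge> s \<and> doubly_approx K h s n f (3 / real (Suc s))"
    if K: "\<forall>i. compact (K i) \<and> connected (- K i)" "\<exists>i\<^sub>0. \<Omega> i\<^sub>0 \<inter> K i\<^sub>0 = {}"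
      and V: "open V" "vprod K \<subseteq> V" and h: "h mholomorphic_on (vprod G \<times> V)" for K V h s
  proof -
    have Kc: "\<And>i. compact (K i)" "\<And>i. connected (- K i)" using K(1) by auto
    obtain K' where K': "K' \<in> avoiding \<Omega>" "vprod K \<subseteq> vprod K'"
      using K(2) avoiding_cofinal[of \<Omega> K, OF \<Omega> Kc] by blast
    have sh: "sep_hol (vprod G \<times> V) h" using h by (rule mholomorphic_imp_sep_hol)
    define e where "e = 1 / real (Suc s)"
    have e: "e > 0" by (simp add: e_def)
    obtain p where p: "p \<in> mpolys" "\<forall>x\<in>exhaustion_prod G s \<times> vprod K. \<forall>cs\<in>op_words s. cmod (coord_derivs cs (\<lambda>x. h x - p x) x) \<le> e"
      using mpoly_approx_derivs[of G K V, OF G Kc V exhaustion_G(1,2) sh finite_op_words e] by blast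
    have "compact (exhaustion_prod G s \<times> vprod K)" by (intro compact_Times exhaustion_G compact_vprod Kc)
    then obtain ts where ts: "\<forall>x\<in>exhaustion_prod G s \<times> vprod K. \<forall>cs\<in>op_words s. cmod (coord_derivs cs (\<lambda>x. p x - qpoly ts x) x) \<le> e"
      using qpoly_dense[OF p(1) _ finite_op_words e] by blast
    obtain n e' where n: "n \<in> \<mu>" "n \<ge> s" "e' < e" "doubly_approx K' (qpoly ts) s n f e'"
      using tasks[OF K'(1), of ts s] unfolding task_def e_def by blast
    have "doubly_approx K h s n f (3 / real (Suc s))"
      unfolding doubly_approx_def
    proof (intro ballI conjI)
      fix \<zeta> w assume mem: "\<zeta> \<in> exhaustion_prod \<Omega> s" "w \<in> exhaustion_prod G s"
      have \<zeta>: "\<zeta> \<in> vprod \<Omega>" and w: "w \<in> vprod G" using mem exhaustion_G(2) exhaustion_Om(2) by auto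
      {
        fix z cs assume z: "z \<in> vprod K" and cs: "cs \<in> (op_words s :: ('r + 'd) list set)"
        let ?F = "\<lambda>x. partial_sum N n f (fst x) \<zeta> (snd x)"
        have oZ: "open (vprod G \<times> V)" by (intro open_Times open_G V)
        have wz: "(w, z) \<in> vprod G \<times> V" using w z V(2) by auto
        have sF: "sep_hol (vprod G \<times> V) ?F"
          by (rule sep_hol_subset[OF sep_hol_partial_sum[OF open_G open_\<Omega> shf \<zeta>]]) auto
        have sq: "sep_hol (vprod G \<times> V) (qpoly ts)" and sp: "sep_hol (vprod G \<times> V) p" by (intro sep_hol_mpoly qpoly_mpolys p)+
        have "coord_derivs cs (\<lambda>x. ?F x - h x) (w, z) = coord_derivs cs (\<lambda>x. (?F x - qpoly ts x) - ((h x - p x) + (p x - qpoly ts x))) (w, z)"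
          by (rule coord_derivs_cong[OF oZ _ wz]) simp
        also have "\<dots> = coord_derivs cs (\<lambda>x. ?F x - qpoly ts x) (w, z) - (coord_derivs cs (\<lambda>x. h x - p x) (w, z) + coord_derivs cs (\<lambda>x. p x - qpoly ts x) (w, z))"
          by (simp only: coord_derivs_diff[OF oZ sep_hol_diff[OF sF sq] sep_hol_add[OF sep_hol_diff[OF sh sp] sep_hol_diff[OF sp sq]] wz]
              coord_derivs_add[OF oZ sep_hol_diff[OF sh sp] sep_hol_diff[OF sp sq] wz])
        also have "cmod \<dots> \<le> e + (e + e)"
        proof (rule order.trans[OF norm_triangle_ineq4 add_mono[OF _ norm_triangle_mono]])
          have "cmod (coord_derivs cs (\<lambda>x. ?F x - qpoly ts x) (w, z)) \<le> e'"
            using n(4) mem z cs K'(2) unfolding doubly_approx_def by blast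
          then show "cmod (coord_derivs cs (\<lambda>x. ?F x - qpoly ts x) (w, z)) \<le> e" using n(3) by simp
          show "cmod (coord_derivs cs (\<lambda>x. h x - p x) (w, z)) \<le> e" "cmod (coord_derivs cs (\<lambda>x. p x - qpoly ts x) (w, z)) \<le> e"
            using p(2) ts mem z cs by blast+
        qed
        finally show "cmod (coord_derivs cs (\<lambda>x. ?F x - h x) (w, z)) \<le> 3 / real (Suc s)" by (simp add: e_def)
      }
      fix z assume "z \<in> exhaustion_prod \<Omega> s"
      then have "cmod (partial_sum N n f w \<zeta> z - f (w, z)) \<le> e'" using n(4) mem unfolding doubly_approx_def by blast
      also have "3 / real (Suc s) = 3 * e" by (simp add: e_def)
      then have "e' \<le> 3 / real (Suc s)" using n(3) e by linarith
      finally show "cmod (partial_sum N n f w \<zeta> z - f (w, z)) \<le> 3 / real (Suc s)" .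
    qed
    then show ?thesis using n(1,2) by blast
  qed
  show ?thesis
    unfolding universal_class_def mem_Collect_eq
  proof (intro conjI allI impI f, elim conjE)
    fix K V h
    assume "\<forall>i. compact (K i) \<and> connected (- K i)" "\<exists>i\<^sub>0. \<Omega> i\<^sub>0 \<inter> K i\<^sub>0 = {}" "open V" "vprod K \<subseteq> V" "h mholomorphic_on (vprod G \<times> V)"
    from doubly_approx_imp_universal[OF main[OF this]]
    show "\<exists>l::nat \<Rightarrow> nat. strict_mono l \<and> range l \<subseteq> \<mu> \<and>
        (\<forall>L M a b. compact L \<and> L \<subseteq> vprod G \<and> compact M \<and> M \<subseteq> vprod \<Omega> \<longrightarrow>
          ((\<lambda>n. SUP \<zeta>\<in>M. SUP w\<in>L. SUP z\<in>vprod K.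
              ennreal (cmod (mixed_diff_op a b
                (\<lambda>(w, z). partial_sum N (l n) f w \<zeta> z - h (w, z)) (w, z)))) \<longlonglongrightarrow> 0) \<and>
          ((\<lambda>n. SUP \<zeta>\<in>M. SUP w\<in>L. SUP z\<in>M.
              ennreal (cmod (partial_sum N (l n) f w \<zeta> z - f (w, z)))) \<longlonglongrightarrow> 0))" .
  qed
qed

lemma universal_class_iff:
  "f \<in> universal_class N \<mu> (vprod G) \<Omega> \<longleftrightarrow> f \<in> hol_space S \<and> (\<forall>K\<in>avoiding \<Omega>. \<forall>ts s. f \<in> task K ts s)"
proof
  assume f: "f \<in> universal_class N \<mu> (vprod G) \<Omega>"
  then have "f \<in> hol_space S" by (simp add: universal_class_def)
  then show "f \<in> hol_space S \<and> (\<forall>K\<in>avoiding \<Omega>. \<forall>ts s. f \<in> task K ts s)"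
    using universal_imp_task[OF f] by blast
next
  assume "f \<in> hol_space S \<and> (\<forall>K\<in>avoiding \<Omega>. \<forall>ts s. f \<in> task K ts s)"
  then show "f \<in> universal_class N \<mu> (vprod G) \<Omega>" by (intro tasks_imp_universal) blast+
qed

lemma gdelta_universal: "gdelta_in (hol_topology S) (universal_class N \<mu> (vprod G) \<Omega>)"
proof -
  \<comment> \<open>Including the whole space keeps the family nonempty and its intersection inside
    \<open>hol_space S\<close>.\<close>
  define \<C> where "\<C> = insert (hol_space S) ((\<lambda>(K, ts, s). task K ts s) ` (avoiding \<Omega> \<times> UNIV \<times> UNIV))"
  have "universal_class N \<mu> (vprod G) \<Omega> = \<Inter>\<C>"
    by (auto simp: universal_class_iff \<C>_def)
  moreover have "countable \<C>"
    unfolding \<C>_def by (intro countable_insert countable_image countable_SIGMA countable_avoiding countableI_type)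
  moreover have "gdelta_in (hol_topology S) T" if "T \<in> \<C>" for T
    using that open_imp_gdelta_in[OF openin_task] gdelta_in_topspace[of "hol_topology S"]
    by (auto simp: \<C>_def topspace_hol_topology)
  ultimately show ?thesis using gdelta_in_Inter[of \<C>] by (simp add: \<C>_def)
qed

lemma hol_space_iff: "f \<in> hol_space S \<longleftrightarrow> sep_hol S f \<and> (\<forall>p. p \<notin> S \<longrightarrow> f p = 0)"
  using mholomorphic_imp_sep_hol sep_hol_imp_mholomorphic[OF open_S] by (auto simp: hol_space_def)

section \<open>A sequence with simultaneous universal approximation\<close>

definition zero_extend :: "(('r, 'd) cspace \<Rightarrow> complex) \<Rightarrow> ('r, 'd) cspace \<Rightarrow> complex"
  where "zero_extend h x = (if x \<in> S then h x else 0)"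

lemma zero_extend_hol: "sep_hol S h \<Longrightarrow> zero_extend h \<in> hol_space S"
  unfolding hol_space_iff by (auto simp: zero_extend_def intro: sep_hol_cong[OF _ open_S])

definition near_cond :: "(rat \<times> rat \<times> (nat ^ 'r) \<times> (nat ^ 'd)) list \<Rightarrow> nat \<Rightarrow> (nat \<Rightarrow> ('r, 'd) cspace \<Rightarrow> complex) \<Rightarrow> bool"
  where "near_cond ts s f \<longleftrightarrow> (\<exists>j. \<forall>x\<in>level s. cmod (zero_extend (f j) x - qpoly ts x) \<le> 1 / real (Suc s))"

text \<open>Singling out one member and sending the others to 0 is what later isolates one nonzero
  coefficient of a linear combination.\<close>

definition target :: "nat \<Rightarrow> (rat \<times> rat \<times> (nat ^ 'r) \<times> (nat ^ 'd)) list \<Rightarrow> nat \<Rightarrow> ('r, 'd) cspace \<Rightarrow> complex"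
  where "target j\<^sub>0 ts j = (if j = j\<^sub>0 then qpoly ts else (\<lambda>x. 0))"

text \<open>The order \<open>n\<close> is chosen before \<open>j\<close>: a common order for all
  members up to \<open>J\<close> is what allows the estimates to be added.\<close>

definition approx_cond :: "nat \<Rightarrow> nat \<Rightarrow> ('d \<Rightarrow> complex set) \<Rightarrow> (rat \<times> rat \<times> (nat ^ 'r) \<times> (nat ^ 'd)) list \<Rightarrow> nat \<Rightarrow>
    (nat \<Rightarrow> ('r, 'd) cspace \<Rightarrow> complex) \<Rightarrow> bool"
  where "approx_cond J j\<^sub>0 K ts s f \<longleftrightarrow>
    (\<exists>n\<in>\<mu>. n \<ge> s \<and> (\<forall>j\<le>J. doubly_approx K (target j\<^sub>0 ts j) s n (zero_extend (f j)) (1 / real (Suc s))))"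

lemma target_mpolys: "target j\<^sub>0 ts j \<in> mpolys"
  by (simp add: target_def qpoly_mpolys mpolys_zero)

text \<open>Only members below \<open>J\<close> are protected, so the rational polynomial is put
  into place \<open>J\<close> and nothing else is moved.\<close>

lemma near_step:
  fixes g :: "nat \<Rightarrow> ('r, 'd) cspace \<Rightarrow> complex"
  assumes g: "\<And>j. g j \<in> mpolys"
  shows "\<exists>g' e' n' J'. (\<forall>j. g' j \<in> mpolys) \<and> (\<forall>j<J. \<forall>x\<in>level n. cmod (g' j x - g j x) \<le> 0) \<and> e' > 0 \<and>
        (\<forall>f. (\<forall>j. sep_hol S (f j)) \<and> (\<forall>j<J'. \<forall>x\<in>level n'. cmod (f j x - g' j x) \<le> e') \<longrightarrow> near_cond ts s f)"
proof (rule exI[of _ "g(J := qpoly ts)"], rule exI[of _ "1 / real (Suc s)"], rule exI[of _ s], rule exI[of _ "Suc J"], intro conjI allI impI)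
  fix f assume f: "(\<forall>j. sep_hol S (f j)) \<and> (\<forall>j<Suc J. \<forall>x\<in>level s. cmod (f j x - (g(J := qpoly ts)) j x) \<le> 1 / real (Suc s))"
  have "cmod (zero_extend (f J) x - qpoly ts x) \<le> 1 / real (Suc s)" if "x \<in> level s" for x
    using f that level_subset[of s] by (auto simp: zero_extend_def)
  then show "near_cond ts s f" unfolding near_cond_def by blast
qed (use g qpoly_mpolys in auto)

text \<open>From each \<open>g j\<close> one subtracts a polynomial that resembles
  \<open>g j - target\<close> over \<open>K\<close> and is small on the protected set. The result is
  near its target over \<open>K\<close>, and its late partial sums equal it exactly.\<close>

lemma doubly_approx_step:
  fixes g :: "nat \<Rightarrow> ('r, 'd) cspace \<Rightarrow> complex"
  assumes K: "K \<in> avoiding \<Omega>" and g: "\<And>j. g j \<in> mpolys" and e: "e > 0"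
  shows "\<exists>g' e' n' J'. (\<forall>j. g' j \<in> mpolys) \<and> (\<forall>j<J\<^sub>0. \<forall>x\<in>level n. cmod (g' j x - g j x) \<le> e) \<and> e' > 0 \<and>
        (\<forall>f. (\<forall>j. sep_hol S (f j)) \<and> (\<forall>j<J'. \<forall>x\<in>level n'. cmod (f j x - g' j x) \<le> e') \<longrightarrow> approx_cond J j\<^sub>0 K ts s f)"
proof -
  note KD = avoidingD[OF K open_\<Omega>i]
  obtain i0 where i0: "\<Omega> i0 \<inter> K i0 = {}" using KD(3) by blast
  define M0 where "M0 = exhaustion (\<Omega> i0) n"
  have M0: "compact M0" "connected (- M0)" "M0 \<subseteq> \<Omega> i0" unfolding M0_def using exhaustion_props[of \<Omega>, OF \<Omega>] by auto
  have disj: "K i0 \<inter> M0 = {}" using M0(3) i0 by blast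
  have XM: "snd x $ i0 \<in> M0" if "x \<in> level n" for x
    using that by (auto simp: level_def exhaustion_prod_def vprod_def M0_def)
  \<comment> \<open>Half of the tolerance is spent over \<open>K\<close>, the other half is reserved
    for stability under perturbation.\<close>
  define \<eta> where "\<eta> = 1 / (2 * real (Suc s))"
  have \<eta>: "\<eta> > 0" "\<eta> + \<eta> = 1 / real (Suc s)" by (simp_all add: \<eta>_def divide_simps)
  let ?T = "target j\<^sub>0 ts"
  have "\<exists>P\<in>mpolys. (\<forall>x\<in>level n. cmod (P x) \<le> e) \<and>
      (\<forall>x\<in>exhaustion_prod G s \<times> vprod K. \<forall>cs\<in>op_words s. cmod (coord_derivs cs (\<lambda>x. (g j x - ?T j x) - P x) x) \<le> \<eta>)" for j
  proof (rule mpoly_localize[where ?i0.0 = i0 and u = "\<lambda>x. g j x - ?T j x"])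
    show "(\<lambda>x. g j x - ?T j x) \<in> mpolys" by (rule mpolys_diff[OF g target_mpolys])
    show "snd x $ i0 \<in> M0" if "x \<in> level n" for x using that by (rule XM)
  qed (rule KD M0 disj level_compact exhaustion_G finite_op_words e \<eta>)+
  then have "\<forall>j. \<exists>P. P \<in> mpolys \<and> (\<forall>x\<in>level n. cmod (P x) \<le> e) \<and>
      (\<forall>x\<in>exhaustion_prod G s \<times> vprod K. \<forall>cs\<in>op_words s. cmod (coord_derivs cs (\<lambda>x. (g j x - ?T j x) - P x) x) \<le> \<eta>)" by blast
  from choice[OF this] obtain P where "\<forall>j. P j \<in> mpolys \<and> (\<forall>x\<in>level n. cmod (P j x) \<le> e) \<and>
      (\<forall>x\<in>exhaustion_prod G s \<times> vprod K. \<forall>cs\<in>op_words s. cmod (coord_derivs cs (\<lambda>x. (g j x - ?T j x) - P j x) x) \<le> \<eta>)" ..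
  then have P: "\<And>j. P j \<in> mpolys" "\<And>j x. x \<in> level n \<Longrightarrow> cmod (P j x) \<le> e"
    "\<And>j x cs. x \<in> exhaustion_prod G s \<times> vprod K \<Longrightarrow> cs \<in> op_words s \<Longrightarrow> cmod (coord_derivs cs (\<lambda>x. (g j x - ?T j x) - P j x) x) \<le> \<eta>"
    by blast+
  define g' where "g' j = (\<lambda>x. g j x - P j x)" for j
  have g': "g' j \<in> mpolys" for j unfolding g'_def by (intro mpolys_diff g P)
  have "\<exists>n0. \<forall>n\<ge>n0. \<forall>w \<zeta> z. partial_sum N n (g' j) w \<zeta> z = g' j (w, z)" for j
    by (rule partial_sum_mpoly[OF N g'])
  then obtain n0 where n0: "\<And>j n w \<zeta> z. n \<ge> n0 j \<Longrightarrow> partial_sum N n (g' j) w \<zeta> z = g' j (w, z)" by metis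
  \<comment> \<open>Beyond \<open>m0\<close> the finitely many polynomials with index at most
    \<open>J\<close> coincide with their partial sums; since \<mu> is infinite, it contains such an
    order.\<close>
  define m0 where "m0 = max s (Max (n0 ` {..J}))"
  obtain m where m: "m \<in> \<mu>" "m \<ge> m0" using \<mu> unfolding infinite_nat_iff_unbounded_le by blast
  have ms: "m \<ge> s" using m(2) by (simp add: m0_def)
  have hits: "doubly_approx K (?T j) s m (g' j) \<eta>" if j: "j \<le> J" for j
  proof -
    have "n0 j \<le> m" using m(2) j by (simp add: m0_def)
    note eq = n0[OF this]
    \<comment> \<open>As the partial sum of \<open>g' j\<close> is \<open>g' j\<close> itself, its
      distance to the target is exactly the quantity estimated by the localization.\<close>
    have slice: "(\<lambda>x. partial_sum N m (g' j) (fst x) \<zeta> (snd x) - ?T j x) = (\<lambda>x. (g j x - ?T j x) - P j x)" for \<zeta>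
      unfolding eq prod.collapse by (rule ext) (simp add: g'_def)
    show ?thesis
      unfolding doubly_approx_def slice
    proof (intro ballI conjI)
      fix \<zeta> w z assume w: "w \<in> exhaustion_prod G s"
      show "cmod (coord_derivs cs (\<lambda>x. (g j x - ?T j x) - P j x) (w, z)) \<le> \<eta>" if "z \<in> vprod K" "cs \<in> op_words s" for cs
        using w that by (intro P(3)) simp_all
      show "cmod (partial_sum N m (g' j) w \<zeta> z - g' j (w, z)) \<le> \<eta>" using \<eta>(1) by (simp add: eq)
    qed
  qed
  define stable where "stable j C \<delta> \<longleftrightarrow> compact C \<and> C \<subseteq> S \<and> \<delta> > 0 \<and>
      (\<forall>f. sep_hol S f \<longrightarrow> (\<forall>x\<in>C. cmod (f x - g' j x) \<le> \<delta>) \<longrightarrow> doubly_approx K (?T j) s m f (\<eta> + \<eta>))" for j C \<delta>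
  have "\<exists>C \<delta>. stable j C \<delta>" if "j \<le> J" for j
    unfolding stable_def
    by (rule doubly_approx_stable[OF sep_hol_mpoly[OF g'] sep_hol_mpoly[OF target_mpolys] KD(1) hits[OF that] \<eta>(1)])
  then obtain C \<delta> where "\<And>j. j \<le> J \<Longrightarrow> stable j (C j) (\<delta> j)" by metis
  then have C: "\<And>j. j \<le> J \<Longrightarrow> compact (C j)" "\<And>j. j \<le> J \<Longrightarrow> C j \<subseteq> S" "\<And>j. j \<le> J \<Longrightarrow> \<delta> j > 0"
      "\<And>j f. j \<le> J \<Longrightarrow> sep_hol S f \<Longrightarrow> \<forall>x\<in>C j. cmod (f x - g' j x) \<le> \<delta> j \<Longrightarrow> doubly_approx K (?T j) s m f (\<eta> + \<eta>)"
    unfolding stable_def by blast+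
  have "compact (\<Union>j\<le>J. C j)" "(\<Union>j\<le>J. C j) \<subseteq> S" using C(1,2) by (auto intro: compact_UN)
  then obtain n' where n': "(\<Union>j\<le>J. C j) \<subseteq> level n'" using level_cofinal by blast
  define e' where "e' = Min (\<delta> ` {..J})"
  have e': "e' > 0" "\<And>j. j \<le> J \<Longrightarrow> e' \<le> \<delta> j" using C(3) by (auto simp: e'_def)
  show ?thesis
  proof (rule exI[of _ g'], rule exI[of _ e'], rule exI[of _ n'], rule exI[of _ "Suc J"], intro conjI allI impI ballI)
    show "g' j \<in> mpolys" for j by (rule g')
    show "cmod (g' j x - g j x) \<le> e" if "x \<in> level n" for j x using P(2)[OF that] by (simp add: g'_def)
    show "e' > 0" by (rule e')
    fix f assume f: "(\<forall>j. sep_hol S (f j)) \<and> (\<forall>j<Suc J. \<forall>x\<in>level n'. cmod (f j x - g' j x) \<le> e')"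
    have "doubly_approx K (?T j) s m (zero_extend (f j)) (\<eta> + \<eta>)" if j: "j \<le> J" for j
    proof (rule C(4)[OF j])
      show "sep_hol S (zero_extend (f j))" using zero_extend_hol[of "f j"] f by (simp add: hol_space_iff)
      show "\<forall>x\<in>C j. cmod (zero_extend (f j) x - g' j x) \<le> \<delta> j"
      proof
        fix x assume x: "x \<in> C j"
        then have "x \<in> level n'" "x \<in> S" using n' C(2)[OF j] j by blast+
        then have "cmod (f j x - g' j x) \<le> e'" using f j by simp
        then show "cmod (zero_extend (f j) x - g' j x) \<le> \<delta> j" using e'(2)[OF j] \<open>x \<in> S\<close> by (simp add: zero_extend_def)
      qed
    qed
    then show "approx_cond J j\<^sub>0 K ts s f" unfolding approx_cond_def \<eta>(2) using m(1) ms by blast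
  qed
qed

lemma universal_sequence:
  obtains F where "\<And>j. F j \<in> hol_space S" "\<And>ts s. \<exists>j. \<forall>x\<in>level s. cmod (F j x - qpoly ts x) \<le> 1 / real (Suc s)"
    "\<And>J j\<^sub>0 K ts s. K \<in> avoiding \<Omega> \<Longrightarrow> \<exists>n\<in>\<mu>. n \<ge> s \<and> (\<forall>j\<le>J. doubly_approx K (target j\<^sub>0 ts j) s n (F j) (1 / real (Suc s)))"
proof -
  define \<P> where "\<P> = range (\<lambda>(ts, s). near_cond ts s) \<union>
    (\<lambda>(J, j\<^sub>0, K, ts, s). approx_cond J j\<^sub>0 K ts s) ` (UNIV \<times> UNIV \<times> avoiding \<Omega> \<times> UNIV \<times> UNIV)"
  have "\<exists>f. (\<forall>j. sep_hol S (f j)) \<and> (\<forall>P\<in>\<P>. P f)"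
  proof (rule generic_sequence[OF open_S, of level])
    show "level n \<subseteq> level (Suc n)" for n by (rule level_mono) simp
    show "level n \<subseteq> S" for n by (rule level_subset)
    show "\<exists>n. C \<subseteq> level n" if "compact C" "C \<subseteq> S" for C using that by (rule level_cofinal)
    show "countable \<P>"
      unfolding \<P>_def by (intro countable_Un countable_image countable_SIGMA countable_avoiding countableI_type)
    show "\<P> \<noteq> {}" by (auto simp: \<P>_def)
    fix P and g :: "nat \<Rightarrow> ('r, 'd) cspace \<Rightarrow> complex" and e :: real and n J
    assume P: "P \<in> \<P>" and g: "\<And>j. g j \<in> mpolys" and e: "e > 0"
    from P consider ts s where "P = near_cond ts s" | J' j\<^sub>0 K ts s where "K \<in> avoiding \<Omega>" "P = approx_cond J' j\<^sub>0 K ts s"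
      unfolding \<P>_def by auto
    then show "\<exists>g' e' n' J'. (\<forall>j. g' j \<in> mpolys) \<and> (\<forall>j<J. \<forall>x\<in>level n. cmod (g' j x - g j x) \<le> e) \<and> e' > 0 \<and>
        (\<forall>f. (\<forall>j. sep_hol S (f j)) \<and> (\<forall>j<J'. \<forall>x\<in>level n'. cmod (f j x - g' j x) \<le> e') \<longrightarrow> P f)"
    proof cases
      case 1
      from near_step[of g J n ts s, OF g] obtain g' e' n' J' where *: "\<forall>j. g' j \<in> mpolys"
        "\<forall>j<J. \<forall>x\<in>level n. cmod (g' j x - g j x) \<le> 0" "e' > 0"
        "\<forall>f. (\<forall>j. sep_hol S (f j)) \<and> (\<forall>j<J'. \<forall>x\<in>level n'. cmod (f j x - g' j x) \<le> e') \<longrightarrow> near_cond ts s f"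
        by (elim exE conjE) rule
      have "\<forall>j<J. \<forall>x\<in>level n. cmod (g' j x - g j x) \<le> e" using *(2) e by (meson less_imp_le order.trans)
      then show ?thesis
        by (intro exI[of _ g'] exI[of _ e'] exI[of _ n'] exI[of _ J'] conjI) (use * 1 in simp_all)
    next
      case 2
      show ?thesis unfolding 2(2) by (rule doubly_approx_step[OF 2(1) g e])
    qed
  qed
  then obtain f where f: "\<And>j. sep_hol S (f j)" "\<And>P. P \<in> \<P> \<Longrightarrow> P f" by blast
  show thesis
  proof (rule that[of "\<lambda>j. zero_extend (f j)"])
    show "zero_extend (f j) \<in> hol_space S" for j by (rule zero_extend_hol[OF f(1)])
    fix ts s
    have "near_cond ts s \<in> \<P>" unfolding \<P>_def by auto
    from f(2)[OF this] show "\<exists>j. \<forall>x\<in>level s. cmod (zero_extend (f j) x - qpoly ts x) \<le> 1 / real (Suc s)"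
      unfolding near_cond_def .
  next
    fix J j\<^sub>0 K ts s assume "K \<in> avoiding \<Omega>"
    then have "approx_cond J j\<^sub>0 K ts s \<in> \<P>" unfolding \<P>_def by (intro UnI2 image_eqI[of _ _ "(J, j\<^sub>0, K, ts, s)"]) auto
    from f(2)[OF this] show "\<exists>n\<in>\<mu>. n \<ge> s \<and> (\<forall>j\<le>J. doubly_approx K (target j\<^sub>0 ts j) s n (zero_extend (f j)) (1 / real (Suc s)))"
      unfolding approx_cond_def .
  qed
qed

lemma partial_sum_comb:
  fixes F :: "nat \<Rightarrow> ('r, 'd) cspace \<Rightarrow> complex"
  assumes "\<And>j. sep_hol S (F j)" "(w, \<zeta>) \<in> S"
  shows "partial_sum N n (\<lambda>x. \<Sum>j<J. c j * F j x) w \<zeta> z = (\<Sum>j<J. c j * partial_sum N n (F j) w \<zeta> z)"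
proof (induction J)
  case 0
  show ?case using partial_sum_cmult[OF open_S sep_hol_const assms(2), of N n 0 0 z] by simp
next
  case (Suc J)
  have "partial_sum N n (\<lambda>x. (\<Sum>j<J. c j * F j x) + c J * F J x) w \<zeta> z
      = partial_sum N n (\<lambda>x. \<Sum>j<J. c j * F j x) w \<zeta> z + partial_sum N n (\<lambda>x. c J * F J x) w \<zeta> z"
    by (rule partial_sum_add[OF open_S sep_hol_sum[OF sep_hol_mult[OF sep_hol_const assms(1)]] sep_hol_mult[OF sep_hol_const assms(1)] assms(2)])
  then show ?case by (simp add: Suc.IH partial_sum_cmult[OF open_S assms(1) assms(2)])
qed

text \<open>To reach \<open>qpoly ts\<close>, the member \<open>j\<^sub>0\<close> is aimed at
  \<open>qpoly ts\<close> divided by \<open>c j\<^sub>0\<close> and all others at 0, with one common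
  order; the sum then has the right limit.\<close>

lemma combination_universal:
  fixes F :: "nat \<Rightarrow> ('r, 'd) cspace \<Rightarrow> complex"
  assumes F: "\<And>j. F j \<in> hol_space S"
    and hits: "\<And>J j\<^sub>0 K ts s. K \<in> avoiding \<Omega> \<Longrightarrow> \<exists>n\<in>\<mu>. n \<ge> s \<and> (\<forall>j\<le>J. doubly_approx K (target j\<^sub>0 ts j) s n (F j) (1 / real (Suc s)))"
    and j0: "j\<^sub>0 < J" "c j\<^sub>0 \<noteq> 0"
  shows "(\<lambda>x. \<Sum>j<J. c j * F j x) \<in> universal_class N \<mu> (vprod G) \<Omega>"
  unfolding universal_class_iff
proof (intro conjI ballI allI)
  let ?f = "\<lambda>x. \<Sum>j<J. c j * F j x"
  have shF: "sep_hol S (F j)" for j by (rule hol_space_sep_hol[OF F])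
  show fH: "?f \<in> hol_space S"
    using F unfolding hol_space_iff by (auto intro!: sep_hol_sum sep_hol_mult)
  fix K ts s assume K: "K \<in> avoiding \<Omega>"
  define A where "A = (\<Sum>j<J. cmod (c j))"
  have A: "A \<ge> 0" by (simp add: A_def sum_nonneg)
  define u where "u x = inverse (c j\<^sub>0) * qpoly ts x" for x :: "('r, 'd) cspace"
  have u: "u \<in> mpolys" unfolding u_def by (intro mpolys_cmult qpoly_mpolys)
  \<comment> \<open>Two errors occur, one from the members and one from the rational approximation
    of \<open>u\<close>; with a quarter of the threshold for each, their sum stays strictly below
    it.\<close>
  define b where "b = 1 / (4 * real (Suc s))"
  have b: "b > 0" "b + b < 1 / real (Suc s)" by (simp_all add: b_def divide_simps)
  define \<tau> where "\<tau> = b / cmod (c j\<^sub>0)"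
  have \<tau>: "\<tau> > 0" "cmod (c j\<^sub>0) * \<tau> = b" using b(1) j0(2) by (simp_all add: \<tau>_def)
  have "compact (exhaustion_prod G s \<times> vprod K)" using avoidingD(1)[OF K open_\<Omega>i] by (intro compact_Times exhaustion_G compact_vprod)
  then obtain ts' where ts': "\<forall>x\<in>exhaustion_prod G s \<times> vprod K. \<forall>cs\<in>op_words s. cmod (coord_derivs cs (\<lambda>x. u x - qpoly ts' x) x) \<le> \<tau>"
    using qpoly_dense[OF u _ finite_op_words \<tau>(1)] by blast
  obtain k :: nat where k: "A / b \<le> real k" using real_arch_simple by blast
  \<comment> \<open>A higher level than \<open>s\<close>, so that the tolerance
    \<open>1 / real (Suc s')\<close> times the sum \<open>A\<close> of the moduli of the
    coefficients is at most \<open>b\<close>.\<close>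
  define s' where "s' = max s k"
  define \<epsilon> where "\<epsilon> = 1 / real (Suc s')"
  have "A \<le> b * real (Suc s')"
  proof -
    have "A \<le> b * real k" using k b(1) by (simp add: pos_divide_le_eq mult.commute)
    also have "\<dots> \<le> b * real (Suc s')" using b(1) by (intro mult_left_mono) (simp_all add: s'_def)
    finally show ?thesis .
  qed
  then have A\<epsilon>: "A * \<epsilon> \<le> b" by (simp add: \<epsilon>_def pos_divide_le_eq)
  let ?T = "target j\<^sub>0 ts'"
  have "\<exists>n\<in>\<mu>. n \<ge> s' \<and> (\<forall>j\<le>J. doubly_approx K (?T j) s' n (F j) \<epsilon>)"
    unfolding \<epsilon>_def by (rule hits[OF K])
  then obtain n where n: "n \<in> \<mu>" "n \<ge> s'" "\<forall>j\<le>J. doubly_approx K (?T j) s' n (F j) \<epsilon>"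
    by (elim bexE conjE) rule
  have hitj: "doubly_approx K (?T j) s n (F j) \<epsilon>" if "j < J" for j
  proof (rule doubly_approx_mono)
    show "doubly_approx K (?T j) s' n (F j) \<epsilon>" using n(3) that by simp
  qed (simp_all add: s'_def)
  have sumb: "cmod (\<Sum>j<J. c j * v j) \<le> b" if "\<And>j. j < J \<Longrightarrow> cmod (v j) \<le> \<epsilon>" for v
  proof -
    have "cmod (\<Sum>j<J. c j * v j) \<le> (\<Sum>j<J. cmod (c j) * \<epsilon>)"
      by (rule order.trans[OF norm_sum]) (auto simp: norm_mult intro!: sum_mono mult_left_mono that)
    also have "\<dots> = A * \<epsilon>" by (simp add: A_def sum_distrib_right)
    finally show ?thesis using A\<epsilon> by simp
  qed
  have "doubly_approx K (qpoly ts) s n ?f (b + b)"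
    unfolding doubly_approx_def
  proof (intro ballI conjI)
    fix \<zeta> w assume mem: "\<zeta> \<in> exhaustion_prod \<Omega> s" "w \<in> exhaustion_prod G s"
    have \<zeta>: "\<zeta> \<in> vprod \<Omega>" and w: "w \<in> vprod G" using mem exhaustion_G(2) exhaustion_Om(2) by auto
    {
      fix z cs assume z: "z \<in> vprod K" and cs: "cs \<in> (op_words s :: ('r + 'd) list set)"
      let ?Z = "vprod G \<times> (UNIV :: (complex ^ 'd) set)"
      let ?H = "\<lambda>j x. partial_sum N n (F j) (fst x) \<zeta> (snd x) - ?T j x"
      have oZ: "open ?Z" by (intro open_Times open_G open_UNIV)
      have wz: "(w, z) \<in> ?Z" using w by simp
      have sH: "sep_hol ?Z (?H j)" for j
        by (rule sep_hol_diff[OF sep_hol_partial_sum[OF open_G open_\<Omega> shF \<zeta>] sep_hol_mpoly[OF target_mpolys]])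
      have suq: "sep_hol ?Z (\<lambda>x. u x - qpoly ts' x)" by (intro sep_hol_diff sep_hol_mpoly u qpoly_mpolys)
      have "coord_derivs cs (\<lambda>x. partial_sum N n ?f (fst x) \<zeta> (snd x) - qpoly ts x) (w, z)
          = coord_derivs cs (\<lambda>x. (\<Sum>j<J. c j * ?H j x) - c j\<^sub>0 * (u x - qpoly ts' x)) (w, z)"
      proof (rule coord_derivs_cong[OF oZ _ wz])
        fix y assume "y \<in> ?Z"
        then have "(fst y, \<zeta>) \<in> S" using \<zeta> by auto
        note comb = partial_sum_comb[where F = F, OF shF this]
        have "(\<Sum>j<J. c j * ?T j y) = (\<Sum>j<J. if j = j\<^sub>0 then c j\<^sub>0 * qpoly ts' y else 0)"
          by (intro sum.cong) (auto simp: target_def)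
        also have "\<dots> = c j\<^sub>0 * qpoly ts' y" using j0(1) by simp
        finally have T: "(\<Sum>j<J. c j * ?T j y) = c j\<^sub>0 * qpoly ts' y" .
        have "c j\<^sub>0 * u y = qpoly ts y" using j0(2) by (simp add: u_def)
        then show "partial_sum N n ?f (fst y) \<zeta> (snd y) - qpoly ts y = (\<Sum>j<J. c j * ?H j y) - c j\<^sub>0 * (u y - qpoly ts' y)"
          unfolding comb by (simp add: right_diff_distrib sum_subtractf T)
      qed
      also have "\<dots> = coord_derivs cs (\<lambda>x. \<Sum>j<J. c j * ?H j x) (w, z) - coord_derivs cs (\<lambda>x. c j\<^sub>0 * (u x - qpoly ts' x)) (w, z)"
        by (rule coord_derivs_diff[OF oZ sep_hol_sum[OF sep_hol_mult[OF sep_hol_const sH]] sep_hol_mult[OF sep_hol_const suq] wz])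
      also have "coord_derivs cs (\<lambda>x. \<Sum>j<J. c j * ?H j x) (w, z) = (\<Sum>j<J. c j * coord_derivs cs (?H j) (w, z))"
        by (simp only: coord_derivs_sum[OF oZ sep_hol_mult[OF sep_hol_const sH] wz] coord_derivs_cmult[OF oZ sH wz])
      also have "coord_derivs cs (\<lambda>x. c j\<^sub>0 * (u x - qpoly ts' x)) (w, z) = c j\<^sub>0 * coord_derivs cs (\<lambda>x. u x - qpoly ts' x) (w, z)"
        by (rule coord_derivs_cmult[OF oZ suq wz])
      also have "cmod ((\<Sum>j<J. c j * coord_derivs cs (?H j) (w, z)) - c j\<^sub>0 * coord_derivs cs (\<lambda>x. u x - qpoly ts' x) (w, z)) \<le> b + b"
      proof (rule order.trans[OF norm_triangle_ineq4 add_mono])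
        show "cmod (\<Sum>j<J. c j * coord_derivs cs (?H j) (w, z)) \<le> b"
        proof (rule sumb)
          show "cmod (coord_derivs cs (?H j) (w, z)) \<le> \<epsilon>" if "j < J" for j
            using hitj[OF that] mem z cs unfolding doubly_approx_def by blast
        qed
        have "cmod (c j\<^sub>0 * coord_derivs cs (\<lambda>x. u x - qpoly ts' x) (w, z)) \<le> cmod (c j\<^sub>0) * \<tau>"
          unfolding norm_mult using ts' mem z cs by (intro mult_left_mono) auto
        then show "cmod (c j\<^sub>0 * coord_derivs cs (\<lambda>x. u x - qpoly ts' x) (w, z)) \<le> b" using \<tau>(2) by simp
      qed
      finally show "cmod (coord_derivs cs (\<lambda>x. partial_sum N n ?f (fst x) \<zeta> (snd x) - qpoly ts x) (w, z)) \<le> b + b" .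
    }
    fix z assume z: "z \<in> exhaustion_prod \<Omega> s"
    have "(w, \<zeta>) \<in> S" using w \<zeta> by simp
    note comb = partial_sum_comb[where F = F, OF shF this]
    have "partial_sum N n ?f w \<zeta> z - ?f (w, z) = (\<Sum>j<J. c j * (partial_sum N n (F j) w \<zeta> z - F j (w, z)))"
      unfolding comb by (simp add: right_diff_distrib sum_subtractf)
    also have "cmod \<dots> \<le> b"
    proof (rule sumb)
      show "cmod (partial_sum N n (F j) w \<zeta> z - F j (w, z)) \<le> \<epsilon>" if "j < J" for j
        using hitj[OF that] mem z unfolding doubly_approx_def by blast
    qed
    finally show "cmod (partial_sum N n ?f w \<zeta> z - ?f (w, z)) \<le> b + b" using b(1) by simp
  qed
  moreover have "n \<ge> s" using n(2) by (simp add: s'_def)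
  ultimately show "?f \<in> task K ts s" unfolding task_def using fH n(1) b(2) by blast
qed

section \<open>Density and the dense subspace\<close>

lemma approx_sequence_dense:
  fixes F :: "nat \<Rightarrow> ('r, 'd) cspace \<Rightarrow> complex"
  assumes near: "\<And>ts s. \<exists>j. \<forall>x\<in>level s. cmod (F j x - qpoly ts x) \<le> 1 / real (Suc s)"
    and h: "h \<in> hol_space S" and C: "compact C" "C \<subseteq> S" and e: "e > 0"
  shows "\<exists>j. \<forall>x\<in>C. cmod (F j x - h x) < e"
proof -
  obtain m where m: "C \<subseteq> level m" using level_cofinal[OF C] by blast
  have e4: "e / 4 > 0" using e by simp
  \<comment> \<open>Here the compact product lies inside \<Omega>, with
    \<open>vprod \<Omega>\<close> as its neighbourhood; with the empty word as the only operator,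
    the approximation theorem gives plain density of polynomials.\<close>
  define K where "K i = exhaustion (\<Omega> i) m" for i
  have K: "\<And>i. compact (K i)" "\<And>i. connected (- K i)" "vprod K = exhaustion_prod \<Omega> m"
    using exhaustion_props[of \<Omega>, OF \<Omega>] by (simp_all add: K_def[abs_def] exhaustion_prod_def)
  obtain p where p: "p \<in> mpolys" "\<forall>x\<in>exhaustion_prod G m \<times> vprod K. \<forall>cs\<in>{[]}. cmod (coord_derivs cs (\<lambda>x. h x - p x) x) \<le> e / 4"
    using mpoly_approx_derivs[of G K "vprod \<Omega>" "exhaustion_prod G m" h "{[]}" "e / 4",
      OF G K(1,2) open_\<Omega> _ exhaustion_G(1,2) hol_space_sep_hol[OF h] _ e4] exhaustion_Om(2) K(3) by auto
  obtain ts where ts: "\<forall>x\<in>level m. \<forall>cs\<in>{[]}. cmod (coord_derivs cs (\<lambda>x. p x - qpoly ts x) x) \<le> e / 4"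
    using qpoly_dense[OF p(1) level_compact[of m] _ e4, of "{[]}"] by auto
  obtain k where k: "1 / real (Suc k) < e / 4" using nat_approx_posE[OF e4] by blast
  define s where "s = max m k"
  obtain j where j: "\<forall>x\<in>level s. cmod (F j x - qpoly ts x) \<le> 1 / real (Suc s)" using near by blast
  have "cmod (F j x - h x) < e" if x: "x \<in> C" for x
  proof -
    have xm: "x \<in> level m" using x m by blast
    then have "x \<in> level s" using level_mono[of m s] by (auto simp: s_def)
    have "1 / real (Suc s) \<le> 1 / real (Suc k)" by (simp add: s_def frac_le)
    then have 1: "cmod (F j x - qpoly ts x) \<le> e / 4" using j \<open>x \<in> level s\<close> k by fastforce
    have 2: "cmod (h x - p x) \<le> e / 4" using p(2) xm unfolding K(3) level_def[symmetric] by simp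
    have 3: "cmod (p x - qpoly ts x) \<le> e / 4" using ts xm by simp
    have "F j x - h x = (F j x - qpoly ts x) - ((h x - p x) + (p x - qpoly ts x))" by simp
    also have "cmod \<dots> \<le> e / 4 + (e / 4 + e / 4)"
      by (rule order.trans[OF norm_triangle_ineq4 add_mono[OF 1 norm_triangle_mono[OF 2 3]]])
    also have "\<dots> < e" using e by simp
    finally show ?thesis .
  qed
  then show ?thesis by blast
qed

lemma closure_of_hol_topology_eq:
  assumes "T \<subseteq> hol_space S"
    and "\<And>h C e. h \<in> hol_space S \<Longrightarrow> compact C \<Longrightarrow> C \<subseteq> S \<Longrightarrow> e > 0 \<Longrightarrow> \<exists>f\<in>T. \<forall>x\<in>C. cmod (f x - h x) < e"
  shows "hol_topology S closure_of T = topspace (hol_topology S)"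
proof (intro subset_antisym closure_of_subset_topspace subsetI)
  fix h assume "h \<in> topspace (hol_topology S)"
  then have h: "h \<in> hol_space S" by (simp add: topspace_hol_topology)
  have "\<exists>f. f \<in> T \<and> f \<in> W" if W: "h \<in> W" "openin (hol_topology S) W" for W
  proof -
    obtain C e where C: "compact C" "C \<subseteq> S" "e > 0" "\<forall>g\<in>hol_space S. (\<forall>p\<in>C. cmod (g p - h p) < e) \<longrightarrow> g \<in> W"
      using W unfolding openin_hol_topology open_in_hol_space_def by blast
    obtain f where "f \<in> T" "\<forall>x\<in>C. cmod (f x - h x) < e" using assms(2)[OF h C(1-3)] by blast
    then show ?thesis using C(4) assms(1) by blast
  qed
  then show "h \<in> hol_topology S closure_of T"
    using h by (auto simp: in_closure_of topspace_hol_topology)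
qed

lemma universal_class_properties:
  "gdelta_in (hol_topology S) (universal_class N \<mu> (vprod G) \<Omega>) \<and>
   hol_topology S closure_of universal_class N \<mu> (vprod G) \<Omega> = topspace (hol_topology S) \<and>
   (\<exists>E. fun_cspace.subspace E \<and> E \<subseteq> topspace (hol_topology S) \<and>
      hol_topology S closure_of E = topspace (hol_topology S) \<and> E - {0} \<subseteq> universal_class N \<mu> (vprod G) \<Omega>)"
proof (rule universal_sequence)
  fix F assume F: "\<And>j. F j \<in> hol_space S" "\<And>ts s. \<exists>j. \<forall>x\<in>level s. cmod (F j x - qpoly ts x) \<le> 1 / real (Suc s)"
    "\<And>J j\<^sub>0 K ts s. K \<in> avoiding \<Omega> \<Longrightarrow> \<exists>n\<in>\<mu>. n \<ge> s \<and> (\<forall>j\<le>J. doubly_approx K (target j\<^sub>0 ts j) s n (F j) (1 / real (Suc s)))"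
  note dense = approx_sequence_dense[of F, OF F(2)]
  note universal = combination_universal[of F, OF F(1) F(3)]
  \<comment> \<open>Coefficients may vanish, so sums over initial segments already make up the
    linear span of the sequence.\<close>
  define E where "E = {\<lambda>x. \<Sum>j<J. c j * F j x | c J. True}"
  have FU: "F j \<in> universal_class N \<mu> (vprod G) \<Omega>" for j
  proof -
    define c :: "nat \<Rightarrow> complex" where "c i = (if i = j then 1 else 0)" for i
    have "(\<Sum>i<Suc j. c i * F i x) = F j x" for x
      by (simp add: c_def sum.lessThan_Suc)
    then show ?thesis using universal[of j "Suc j" c] by (simp add: c_def)
  qed
  have U: "universal_class N \<mu> (vprod G) \<Omega> \<subseteq> hol_space S" by (auto simp: universal_class_def)
  have 1: "hol_topology S closure_of universal_class N \<mu> (vprod G) \<Omega> = topspace (hol_topology S)"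
    by (rule closure_of_hol_topology_eq[OF U]) (use dense FU in blast)
  have comb: "(\<lambda>x. \<Sum>j<J. c j * F j x) \<in> E" for c J
    unfolding E_def by blast
  have FE: "F j \<in> E" for j
  proof -
    have "(\<lambda>x. \<Sum>i<Suc j. (if i = j then 1 else 0) * F i x) = F j"
      by (simp add: sum.lessThan_Suc)
    then show ?thesis using comb[where c = "\<lambda>i. if i = j then 1 else 0" and J = "Suc j"] by (simp only:)
  qed
  have EH: "E \<subseteq> hol_space S"
  proof
    fix p assume "p \<in> E"
    then obtain c J where p: "p = (\<lambda>x. \<Sum>j<J. c j * F j x)" unfolding E_def by blast
    show "p \<in> hol_space S"
      using F(1) unfolding p hol_space_iff by (auto intro!: sep_hol_sum sep_hol_mult)
  qed
  have 2: "hol_topology S closure_of E = topspace (hol_topology S)"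
    by (rule closure_of_hol_topology_eq[OF EH]) (use dense FE in blast)
  have 3: "fun_cspace.subspace E"
    unfolding fun_cspace.subspace_def
  proof (intro conjI ballI allI)
    show "0 \<in> E" unfolding E_def zero_fun_def by (rule CollectI, rule exI, rule exI[of _ 0]) simp
    fix p assume "p \<in> E"
    then obtain c J where p: "p = (\<lambda>x. \<Sum>j<J. c j * F j x)" unfolding E_def by blast
    show "(\<lambda>x. k * p x) \<in> E" for k
    proof -
      have "(\<lambda>x. k * p x) = (\<lambda>x. \<Sum>j<J. (k * c j) * F j x)"
        unfolding p by (simp add: sum_distrib_left mult.assoc)
      then show ?thesis using comb by (simp only:)
    qed
    fix q assume "q \<in> E"
    then obtain c' J' where q: "q = (\<lambda>x. \<Sum>j<J'. c' j * F j x)" unfolding E_def by blast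
    define M where "M = max J J'"
    have ext: "(\<Sum>j<I. a j * F j x) = (\<Sum>j<M. (if j < I then a j else 0) * F j x)" if "I \<le> M" for I a x
      by (rule sum.mono_neutral_cong_left) (use that in auto)
    have "p + q = (\<lambda>x. \<Sum>j<M. ((if j < J then c j else 0) + (if j < J' then c' j else 0)) * F j x)"
    proof
      fix x
      have "p x = (\<Sum>j<M. (if j < J then c j else 0) * F j x)" unfolding p by (rule ext) (simp add: M_def)
      moreover have "q x = (\<Sum>j<M. (if j < J' then c' j else 0) * F j x)" unfolding q by (rule ext) (simp add: M_def)
      ultimately show "(p + q) x = (\<Sum>j<M. ((if j < J then c j else 0) + (if j < J' then c' j else 0)) * F j x)"
        by (simp only: plus_fun_apply distrib_right sum.distrib)
    qed
    then show "p + q \<in> E" using comb by (simp only:)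
  qed
  have 4: "E - {0} \<subseteq> universal_class N \<mu> (vprod G) \<Omega>"
  proof
    fix p assume p: "p \<in> E - {0}"
    then obtain c J where pe: "p = (\<lambda>x. \<Sum>j<J. c j * F j x)" unfolding E_def by blast
    \<comment> \<open>A combination whose coefficients all vanish is the zero function, which has
      been removed.\<close>
    have "\<exists>j\<^sub>0<J. c j\<^sub>0 \<noteq> 0"
    proof (rule ccontr)
      assume "\<not> (\<exists>j\<^sub>0<J. c j\<^sub>0 \<noteq> 0)"
      then have "p = 0" unfolding pe zero_fun_def by simp
      then show False using p by simp
    qed
    then show "p \<in> universal_class N \<mu> (vprod G) \<Omega>" unfolding pe using universal by blast
  qed
  show ?thesis using gdelta_universal 1 2 3 4 EH by (auto simp: topspace_hol_topology)
qed

end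

theorem theorem4p5:
  fixes G :: "'r::finite \<Rightarrow> complex set" and \<Omega> :: "'d::finite \<Rightarrow> complex set"
    and N :: "nat \<Rightarrow> nat ^ 'd" and \<mu> :: "nat set"
  assumes "\<And>i. simply_connected_domain (G i)"
    and "\<And>i. simply_connected_domain (\<Omega> i)"
    and "bij N"
    and "infinite \<mu>"
  defines "H \<equiv> hol_topology (vprod G \<times> vprod \<Omega>)"
    and "U \<equiv> universal_class N \<mu> (vprod G) \<Omega>"
  shows "gdelta_in H U \<and> H closure_of U = topspace H \<and>
    (\<exists>E. fun_cspace.subspace E \<and> E \<subseteq> topspace H \<and> H closure_of E = topspace H \<and> E - {0} \<subseteq> U)"
proof -
  interpret universal_setting G \<Omega> N \<mu>
    by unfold_locales (use assms(1-4) in auto)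
  show ?thesis unfolding H_def U_def by (rule universal_class_properties)
qed

end
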